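(* Let $V=\mathbb C^{12}$. Then \[ M_1(SL(V),\wedge^4V) = \mathcal Q(C^2(\operatorname{Gr}_4(V))) = \left\{ [\omega]\in\mathbb P(\wedge^4V): \omega\wedge\omega=0 \right\}. \] Moreover, this variety is reducible.
   Context: The base field is $\mathbb C$. For a projective variety $Y\subset\mathbb P(W)$, $I(Y)_2\subset S^2(W^* )$ is the space of quadratic forms vanishing on $Y$, and the quadratic hull of $Y$ is $\mathcal Q(Y)=Z(I(Y)_2)\subset\mathbb P(W)$, taken set-theoretically (reduced structure). For a connected complex semisimple algebraic group $G$ with Lie algebra $\mathfrak g$ and an irreducible $G$-module $V_\nu$ with highest weight vector $v_\nu$, let $X_\nu=G\cdot[v_\nu]\subset\mathbb P(V_\nu)$, let $U_{\le p}(\mathfrak g)\subset U(\mathfrak g)$ be the span of products of at most $p$ elements of $\mathfrak g$, and let $E_p(\nu)=U_{\le p}(\mathfrak g)v_\nu$. The $p$-osculating variety is $T^pX_\nu=\overline{G\cdot\mathbb P(E_p(\nu))}$, and $M_p(G,V_\nu):=\mathcal Q(T^pX_\nu)\subset\mathbb P(V_\nu)$. For $G=SL(V)$ and $V_\nu=\wedge^4V$, the orbit $X_\nu$ is the Grassmannian $\operatorname{Gr}_4(V)\subset\mathbb P(\wedge^4V)$ of $4$-planes in $V$ in its Plücker embedding. For $q\ge1$, the $q$-restricted chordal variety $C^q(\operatorname{Gr}_k(V))\subset\mathbb P(\wedge^kV)$ is the closure of the union of the lines joining two points of $\operatorname{Gr}_k(V)$ corresponding to $k$-planes $L,M\subset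 V$ such that $\dim(L\cap M)\ge k-2q+1$. *)

theory Defs
  imports "HOL-Analysis.Analysis"
begin

section \<open>Projective algebraic sets\<close>

text \<open>
  A finite-dimensional complex vector space \<open>W\<close> is given as a linear subspace of a coordinate
  space \<open>\<complex>\<^sup>I\<close>.  The points of its projectivization are the lines \<open>[w] = \<complex>w\<close>, as sets of vectors.
  Forms on \<open>W\<close> are restrictions of forms on \<open>\<complex>\<^sup>I\<close>; every form on \<open>W\<close> arises in this way.
\<close>

definition proj_point :: "complex ^ 'i \<Rightarrow> (complex ^ 'i) set" where
  "proj_point w = vec.span {w}"

definition proj :: "(complex ^ 'i) set \<Rightarrow> (complex ^ 'i) set set" where
  "proj W = {proj_point w | w. w \<in> W \<and> w \<noteq> 0}"

definition homogeneous_form :: "nat \<Rightarrow> (complex ^ 'i \<Rightarrow> complex) \<Rightarrow> bool" where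
  "homogeneous_form d f \<longleftrightarrow>
     (\<exists>c :: ('i \<Rightarrow> nat) \<Rightarrow> complex.
        f = (\<lambda>x. \<Sum>a | (\<Sum>i\<in>UNIV. a i) = d. c a * (\<Prod>i\<in>UNIV. (x $ i) ^ a i)))"

lemma finite_exponents: "finite {a :: 'i::finite \<Rightarrow> nat. (\<Sum>i\<in>UNIV. a i) = d}"
proof (rule finite_subset)
  show "{a :: 'i \<Rightarrow> nat. (\<Sum>i\<in>UNIV. a i) = d} \<subseteq> Pi\<^sub>E UNIV (\<lambda>_. {..d})"
    by (auto simp: PiE_def Pi_def intro: member_le_sum)
  show "finite (Pi\<^sub>E (UNIV :: 'i set) (\<lambda>_. {..d}))"
    by (intro finite_PiE) auto
qed

definition vanishing_forms :: "nat \<Rightarrow> (complex ^ 'i) set set \<Rightarrow> (complex ^ 'i \<Rightarrow> complex) set" where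
  "vanishing_forms d Y = {f. homogeneous_form d f \<and> (\<forall>p\<in>Y. \<forall>x\<in>p. f x = 0)}"

definition zero_locus ::
  "(complex ^ 'i) set \<Rightarrow> (complex ^ 'i \<Rightarrow> complex) set \<Rightarrow> (complex ^ 'i) set set" where
  "zero_locus W F = {p \<in> proj W. \<forall>f\<in>F. \<forall>x\<in>p. f x = 0}"

definition zariski_closed :: "(complex ^ 'i) set \<Rightarrow> (complex ^ 'i) set set \<Rightarrow> bool" where
  "zariski_closed W Y \<longleftrightarrow>
     (\<exists>F. (\<forall>f\<in>F. \<exists>d. homogeneous_form d f) \<and> Y = zero_locus W F)"

definition zariski_closure ::
  "(complex ^ 'i) set \<Rightarrow> (complex ^ 'i) set set \<Rightarrow> (complex ^ 'i) set set" where
  "zariski_closure W Y = zero_locus W (\<Union>d. vanishing_forms d Y)"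

definition quadratic_hull ::
  "(complex ^ 'i) set \<Rightarrow> (complex ^ 'i) set set \<Rightarrow> (complex ^ 'i) set set" where
  "quadratic_hull W Y = zero_locus W (vanishing_forms 2 Y)"

definition reducible_variety :: "(complex ^ 'i) set \<Rightarrow> (complex ^ 'i) set set \<Rightarrow> bool" where
  "reducible_variety W Y \<longleftrightarrow>
     zariski_closed W Y \<and>
     (\<exists>Y1 Y2. zariski_closed W Y1 \<and> zariski_closed W Y2 \<and>
        Y = Y1 \<union> Y2 \<and> Y1 \<noteq> Y \<and> Y2 \<noteq> Y)"


section \<open>Osculating varieties of homogeneous varieties\<close>

text \<open>
  A representation on \<open>W\<close> is given by a group \<open>G\<close> acting by \<open>\<rho>\<close>, with Lie algebra \<open>\<gg>\<close> acting by
  \<open>d\<rho>\<close>.  The first definition is \<open>U\<^bsub>\<le>p\<^esub>(\<gg>) v\<close>.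
\<close>

definition osculating_space ::
  "'x set \<Rightarrow> ('x \<Rightarrow> complex ^ 'i \<Rightarrow> complex ^ 'i) \<Rightarrow> nat \<Rightarrow> complex ^ 'i \<Rightarrow> (complex ^ 'i) set" where
  "osculating_space \<gg> d\<rho> p v =
     vec.span {foldr d\<rho> Xs v | Xs. set Xs \<subseteq> \<gg> \<and> length Xs \<le> p}"

definition osculating_variety ::
  "(complex ^ 'i) set \<Rightarrow> 'g set \<Rightarrow> ('g \<Rightarrow> complex ^ 'i \<Rightarrow> complex ^ 'i) \<Rightarrow>
   'x set \<Rightarrow> ('x \<Rightarrow> complex ^ 'i \<Rightarrow> complex ^ 'i) \<Rightarrow> nat \<Rightarrow> complex ^ 'i \<Rightarrow> (complex ^ 'i) set set" where
  "osculating_variety W G \<rho> \<gg> d\<rho> p v =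
     zariski_closure W {\<rho> g ` L | g L. g \<in> G \<and> L \<in> proj (osculating_space \<gg> d\<rho> p v)}"


section \<open>The exterior algebra\<close>

text \<open>
  For \<open>V = \<complex>\<^sup>n\<close> with basis \<open>(e\<^sub>i)\<close>, the exterior algebra of \<open>V\<close> has the basis \<open>e\<^sub>S\<close>, \<open>S\<close> ranging over
  the sets of indices, where \<open>e\<^sub>S\<close> is the wedge product of the \<open>e\<^sub>i\<close>, \<open>i \<in> S\<close>, in increasing order.
  Thus \<open>e\<^sub>T \<and> e\<^sub>U\<close> is zero unless \<open>T\<close> and \<open>U\<close> are disjoint, and then it is \<open>e\<^bsub>T \<union> U\<^esub>\<close> times the sign
  of the permutation that sorts the concatenation of \<open>T\<close> and \<open>U\<close>.
\<close>

definition shuffle_sign :: "'n::linorder set \<Rightarrow> 'n set \<Rightarrow> complex" where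
  "shuffle_sign T U = (- 1) ^ card {(t, u). t \<in> T \<and> u \<in> U \<and> u < t}"

definition wedge ::
  "complex ^ ('n::{finite,linorder} set) \<Rightarrow> complex ^ ('n set) \<Rightarrow> complex ^ ('n set)"
  (infixr \<open>\<and>\<^sub>E\<close> 72) where
  "x \<and>\<^sub>E y = (\<chi> S. \<Sum>T\<in>Pow S. shuffle_sign T (S - T) * x $ T * y $ (S - T))"

definition ext_vec :: "complex ^ 'n::{finite,linorder} \<Rightarrow> complex ^ ('n set)" where
  "ext_vec v = (\<Sum>i\<in>UNIV. v $ i *s axis {i} 1)"

definition wedge_list :: "(complex ^ 'n::{finite,linorder}) list \<Rightarrow> complex ^ ('n set)" where
  "wedge_list vs = foldr (\<lambda>v x. ext_vec v \<and>\<^sub>E x) vs (axis {} 1)"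

definition ext_power :: "nat \<Rightarrow> (complex ^ ('n::{finite,linorder} set)) set" where
  "ext_power k = {x. \<forall>S. x $ S \<noteq> 0 \<longrightarrow> card S = k}"

definition basis_list :: "'n set \<Rightarrow> (complex ^ 'n::{finite,linorder}) list" where
  "basis_list S = map (\<lambda>i. axis i 1) (sorted_list_of_set S)"

text \<open>
  The group action \<open>v\<^sub>1 \<and> \<dots> \<and> v\<^sub>k \<mapsto> A v\<^sub>1 \<and> \<dots> \<and> A v\<^sub>k\<close> and the Lie algebra action
  \<open>v\<^sub>1 \<and> \<dots> \<and> v\<^sub>k \<mapsto> \<Sum>\<^sub>j v\<^sub>1 \<and> \<dots> \<and> A v\<^sub>j \<and> \<dots> \<and> v\<^sub>k\<close>, on basis vectors and extended linearly.
\<close>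

definition ext_map ::
  "complex ^ 'n::{finite,linorder} ^ 'n::{finite,linorder} \<Rightarrow> complex ^ ('n set) \<Rightarrow> complex ^ ('n set)" where
  "ext_map A x = (\<Sum>S\<in>UNIV. x $ S *s wedge_list (map ((*v) A) (basis_list S)))"

definition ext_deriv ::
  "complex ^ 'n::{finite,linorder} ^ 'n::{finite,linorder} \<Rightarrow> complex ^ ('n set) \<Rightarrow> complex ^ ('n set)" where
  "ext_deriv A x =
     (\<Sum>S\<in>UNIV. x $ S *s
        (\<Sum>j<card S. wedge_list ((basis_list S)[j := A *v (basis_list S ! j)])))"


section \<open>The modules \<open>\<And>\<^sup>k V\<close> of \<open>SL(V)\<close>\<close>

definition SL :: "(complex ^ 'n ^ 'n) set" where
  "SL = {A. det A = 1}"

definition sl :: "(complex ^ 'n ^ 'n) set" where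
  "sl = {A. trace A = 0}"

text \<open>Highest weight vectors are taken with respect to the Borel subalgebra of upper triangular
  matrices.\<close>

definition highest_weight_vector :: "nat \<Rightarrow> complex ^ ('n::{finite,linorder} set) \<Rightarrow> bool" where
  "highest_weight_vector k v \<longleftrightarrow>
     v \<in> ext_power k \<and> v \<noteq> 0 \<and>
     (\<forall>A\<in>sl. (\<forall>i j. A $ i $ j \<noteq> 0 \<longrightarrow> i < j) \<longrightarrow> ext_deriv A v = 0) \<and>
     (\<forall>A\<in>sl. (\<forall>i j. A $ i $ j \<noteq> 0 \<longrightarrow> i = j) \<longrightarrow> (\<exists>c. ext_deriv A v = c *s v))"

definition M_SL :: "nat \<Rightarrow> nat \<Rightarrow> complex ^ ('n::{finite,linorder} set) \<Rightarrow> (complex ^ ('n set)) set set"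
  where
  "M_SL p k v =
     quadratic_hull (ext_power k) (osculating_variety (ext_power k) SL ext_map sl ext_deriv p v)"


section \<open>Grassmannians and restricted chordal varieties\<close>

definition planes :: "nat \<Rightarrow> (complex ^ 'n) set set" where
  "planes k = {L. vec.subspace L \<and> vec.dim L = k}"

text \<open>The Pluecker point of \<open>L\<close> is the line \<open>\<And>\<^sup>k L \<subseteq> \<And>\<^sup>k V\<close> with \<open>k = dim L\<close>.\<close>

definition pluecker :: "(complex ^ 'n::{finite,linorder}) set \<Rightarrow> (complex ^ ('n set)) set" where
  "pluecker L = vec.span {wedge_list vs | vs. set vs \<subseteq> L \<and> length vs = vec.dim L}"

definition proj_line ::
  "(complex ^ 'i) set \<Rightarrow> (complex ^ 'i) set \<Rightarrow> (complex ^ 'i) set set" where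
  "proj_line p q = proj (vec.span (p \<union> q))"

text \<open>The bound \<open>dim (L \<inter> M) \<ge> k - 2q + 1\<close> is stated without subtraction, since the right-hand side
  can be negative.\<close>

definition restricted_chordal ::
  "nat \<Rightarrow> nat \<Rightarrow> (complex ^ ('n::{finite,linorder} set)) set set" where
  "restricted_chordal q k =
     zariski_closure (ext_power k)
       (\<Union> {proj_line (pluecker L) (pluecker M) | L M.
             L \<in> planes k \<and> M \<in> planes k \<and> L \<noteq> M \<and> k + 1 \<le> vec.dim (L \<inter> M) + 2 * q})"


section \<open>Highest weight vectors exist\<close>

lemma wedge_axis:
  "axis T a \<and>\<^sub>E axis U b =
     (if T \<inter> U = {} then shuffle_sign T U * a * b else 0) *s axis (T \<union> U) 1"
proof -
  have "(axis T a \<and>\<^sub>E axis U b) $ S =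
      ((if T \<inter> U = {} then shuffle_sign T U * a * b else 0) *s axis (T \<union> U) 1) $ S" for S
  proof -
    have "(axis T a \<and>\<^sub>E axis U b) $ S =
        (\<Sum>T'\<in>Pow S. if T' = T then (if S - T = U then shuffle_sign T U * a * b else 0) else 0)"
      unfolding wedge_def vec_lambda_beta by (rule sum.cong) (auto simp: axis_def)
    also have "\<dots> = (if T \<subseteq> S \<and> S - T = U then shuffle_sign T U * a * b else 0)"
      by (subst sum.delta) auto
    also have "T \<subseteq> S \<and> S - T = U \<longleftrightarrow> T \<inter> U = {} \<and> S = T \<union> U"
      by auto
    finally show ?thesis by (auto simp: axis_def)
  qed
  thus ?thesis by (simp add: vec_eq_iff)
qed

lemma wedge_lincomb_left:
  "(\<Sum>i\<in>I. c i *s x i) \<and>\<^sub>E y = (\<Sum>i\<in>I. c i *s (x i \<and>\<^sub>E y))"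
  by (subst vec_eq_iff, simp add: wedge_def sum_distrib_left sum_distrib_right, intro allI,
      subst sum.swap) (simp add: mult_ac)

lemma wedge_lincomb_right:
  "x \<and>\<^sub>E (\<Sum>i\<in>I. c i *s y i) = (\<Sum>i\<in>I. c i *s (x \<and>\<^sub>E y i))"
  by (subst vec_eq_iff, simp add: wedge_def sum_distrib_left sum_distrib_right, intro allI,
      subst sum.swap) (simp add: mult_ac)

lemma ext_vec_axis: "ext_vec (axis j 1) = axis {j} 1"
proof -
  have "ext_vec (axis j 1) = (\<Sum>i\<in>UNIV. if i = j then axis {j} 1 else 0)"
    unfolding ext_vec_def by (intro sum.cong) (auto simp: axis_def)
  thus ?thesis by simp
qed

lemma ext_vec_lincomb: "ext_vec (\<Sum>i\<in>I. c i *s w i) = (\<Sum>i\<in>I. c i *s ext_vec (w i))"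
  unfolding ext_vec_def
  by (subst vec_eq_iff, simp add: sum_distrib_left sum_distrib_right, intro allI, subst sum.swap)
     (simp add: mult_ac)

lemma wedge_list_lincomb:
  assumes "j < length vs"
  shows "wedge_list (vs[j := \<Sum>i\<in>I. c i *s w i]) = (\<Sum>i\<in>I. c i *s wedge_list (vs[j := w i]))"
  using assms
proof (induction vs arbitrary: j)
  case (Cons v vs)
  show ?case
  proof (cases j)
    case 0
    thus ?thesis
      by (simp add: wedge_list_def ext_vec_lincomb wedge_lincomb_left)
  next
    case (Suc m)
    with Cons have "wedge_list (vs[m := \<Sum>i\<in>I. c i *s w i])
        = (\<Sum>i\<in>I. c i *s wedge_list (vs[m := w i]))"
      by simp
    thus ?thesis
      using Suc by (simp add: wedge_list_def wedge_lincomb_right)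
  qed
qed simp

lemma wedge_list_axes:
  "\<exists>c. wedge_list (map (\<lambda>i. axis i 1) xs) = c *s axis (set xs) 1 \<and> (\<not> distinct xs \<longrightarrow> c = 0)"
proof (induction xs)
  case Nil
  show ?case by (rule exI[of _ 1]) (simp add: wedge_list_def)
next
  case (Cons a xs)
  then obtain c where c: "wedge_list (map (\<lambda>i. axis i 1) xs) = c *s axis (set xs) 1"
    "\<not> distinct xs \<longrightarrow> c = 0" by blast
  have "c *s axis (set xs) 1 = (axis (set xs) c :: complex ^ 'a set)"
    by (auto simp: vec_eq_iff axis_def)
  hence "wedge_list (map (\<lambda>i. axis i 1) (a # xs)) = axis {a} 1 \<and>\<^sub>E axis (set xs) c"
    using c by (simp add: wedge_list_def ext_vec_axis)
  thus ?case using c(2) by (auto simp: wedge_axis)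
qed

text \<open>For an initial segment \<open>S\<close> of the indices, \<open>e\<^sub>S\<close> is a highest weight vector.\<close>

lemma highest_weight_vector_axis:
  fixes S :: "'n::{finite,linorder} set"
  assumes initial: "\<And>i j. i < j \<Longrightarrow> j \<in> S \<Longrightarrow> i \<in> S"
  shows "highest_weight_vector (card S) (axis S 1)"
proof -
  define l where "l = sorted_list_of_set S"
  have l: "distinct l" "set l = S" "length l = card S"
    by (simp_all add: l_def)
  obtain c0 where c0: "wedge_list (map (\<lambda>i. axis i 1) l) = c0 *s axis S 1"
    using wedge_list_axes[of l] l by auto
  have deriv: "ext_deriv A (axis S 1) =
      (\<Sum>j<card S. \<Sum>i\<in>UNIV. A $ i $ (l ! j) *s wedge_list (map (\<lambda>i. axis i 1) (l[j := i])))" for A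
  proof -
    have "ext_deriv A (axis S 1) =
        (\<Sum>T\<in>UNIV. if T = S
           then (\<Sum>j<card S. wedge_list ((basis_list S)[j := A *v (basis_list S ! j)])) else 0)"
      unfolding ext_deriv_def by (intro sum.cong) (auto simp: axis_def)
    also have "\<dots> = (\<Sum>j<card S. wedge_list ((basis_list S)[j := A *v (basis_list S ! j)]))"
      by simp
    also have "\<dots> = (\<Sum>j<card S. \<Sum>i\<in>UNIV.
        A $ i $ (l ! j) *s wedge_list (map (\<lambda>i. axis i 1) (l[j := i])))"
    proof (intro sum.cong refl)
      fix j assume "j \<in> {..<card S}"
      hence j: "j < length l" by (simp add: l)
      have "A *v (basis_list S ! j) = (\<Sum>i\<in>UNIV. A $ i $ (l ! j) *s axis i 1)"
        using j by (simp add: basis_list_def l_def [symmetric] matrix_vector_mult_def vec_eq_iff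
            axis_def if_distrib cong: if_cong)
      thus "wedge_list ((basis_list S)[j := A *v (basis_list S ! j)]) =
          (\<Sum>i\<in>UNIV. A $ i $ (l ! j) *s wedge_list (map (\<lambda>i. axis i 1) (l[j := i])))"
        using j by (simp add: wedge_list_lincomb basis_list_def l_def [symmetric] map_update)
    qed
    finally show ?thesis .
  qed
  have "ext_deriv A (axis S 1) = 0" if A: "\<forall>i j. A $ i $ j \<noteq> 0 \<longrightarrow> i < j" for A
    unfolding deriv
  proof (intro sum.neutral ballI)
    fix j i assume "j \<in> {..<card S}"
    hence j: "j < length l" by (simp add: l)
    show "A $ i $ (l ! j) *s wedge_list (map (\<lambda>i. axis i 1) (l[j := i])) = 0"
    proof (cases "A $ i $ (l ! j) = 0")
      case False
      with A have i: "i < l ! j" by blast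
      with initial j l have "i \<in> set l" by (metis nth_mem)
      then obtain m where m: "m < length l" "l ! m = i" by (auto simp: in_set_conv_nth)
      with i have "m \<noteq> j" by auto
      hence "l[j := i] ! m = l[j := i] ! j" "m \<noteq> j" using m j by auto
      hence "\<not> distinct (l[j := i])"
        using m j by (metis length_list_update nth_eq_iff_index_eq)
      thus ?thesis using wedge_list_axes[of "l[j := i]"] by auto
    qed simp
  qed
  moreover have "\<exists>c. ext_deriv A (axis S 1) = c *s axis S 1"
    if A: "\<forall>i j. A $ i $ j \<noteq> 0 \<longrightarrow> i = j" for A
  proof -
    have "ext_deriv A (axis S 1) = (\<Sum>j<card S. \<Sum>i\<in>UNIV.
        if i = l ! j then (A $ (l ! j) $ (l ! j) * c0) *s axis S 1 else 0)"
      unfolding deriv using A by (intro sum.cong refl) (auto simp: c0)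
    also have "\<dots> = (\<Sum>j<card S. A $ (l ! j) $ (l ! j) * c0) *s axis S 1"
      by (simp add: vec.scale_sum_left)
    finally show ?thesis by blast
  qed
  ultimately show ?thesis
    unfolding highest_weight_vector_def ext_power_def by (auto simp: axis_def vec_eq_iff)
qed

corollary highest_weight_vector_exists:
  assumes "k \<le> CARD('n::{finite,linorder})"
  shows "\<exists>v :: complex ^ ('n set). highest_weight_vector k v"
proof -
  have "\<exists>S :: 'n set. card S = k \<and> (\<forall>i j. i < j \<longrightarrow> j \<in> S \<longrightarrow> i \<in> S)"
    using assms
  proof (induction k)
    case 0
    show ?case by (intro exI[of _ "{}"]) auto
  next
    case (Suc k)
    then obtain S :: "'n set" where S: "card S = k" "\<forall>i j. i < j \<longrightarrow> j \<in> S \<longrightarrow> i \<in> S"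
      by auto
    define m where "m = Min (- S)"
    have "S \<noteq> UNIV" using S(1) Suc.prems by auto
    hence "- S \<noteq> {}" by blast
    hence m: "m \<in> - S" "\<And>i. i < m \<Longrightarrow> i \<in> S"
      unfolding m_def by (meson Min_in finite) (metis ComplI Min_le finite leD)
    show ?case
      by (rule exI[of _ "insert m S"]) (use S m in auto)
  qed
  thus ?thesis by (metis highest_weight_vector_axis)
qed

end

theory Submission
  imports Defs "HOL-Computational_Algebra.Polynomial"
begin

text \<open>
  Everything is compared with the variety \<open>Z\<close> of the points \<open>[\<omega>]\<close> with \<open>\<omega> \<and> \<omega> = 0\<close>.

  A tangent vector of the Grassmannian is a sum of terms \<open>v\<^sub>1 \<and> \<dots> \<and> w \<and> \<dots> \<and> v\<^sub>4\<close>
  with one \<open>v\<^sub>j\<close> replaced; any two such terms share a factor, so its square is zero.  A point of a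
  chord through two 4-planes that share a nonzero vector \<open>u\<close> is annihilated by \<open>u\<close>, hence divisible
  by \<open>u\<close>, and again its square is zero.  So the coefficients of \<open>\<omega> \<and> \<omega>\<close> are quadrics through both
  varieties.  Conversely, both varieties contain the points \<open>u \<and> v \<and> (a \<and> b + c \<and> d)\<close>; the polar
  form \<open>B\<close> of a quadratic form that vanishes there satisfies
  \<open>B(u \<and> v \<and> a \<and> b, u \<and> v \<and> c \<and> d) = 0\<close>.  Polarizing this in \<open>u\<close> and \<open>v\<close> shows that
  \<open>B(x\<^sub>1 \<and> \<dots> \<and> x\<^sub>4, x\<^sub>5 \<and> \<dots> \<and> x\<^sub>8)\<close> changes sign when a vector of the first factor is exchanged
  with one of the second (\<open>exchange_first\<close>).  So it is alternating in all eight vectors and a linear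
  function of \<open>x\<^sub>1 \<and> \<dots> \<and> x\<^sub>8\<close>; thus \<open>B(\<omega>, \<omega>)\<close> is a linear function of \<open>\<omega> \<and> \<omega>\<close> and vanishes on \<open>Z\<close>.

  As to reducibility, the \<open>\<omega>\<close> divisible by a vector form a subset of \<open>Z\<close>.  It is not all of \<open>Z\<close>,
  since a tangent vector of rank 4 is not divisible, but it contains a nonempty open part of \<open>Z\<close>.
  To see this, write \<open>\<omega> = e\<^sub>s \<and> \<alpha> + \<beta>\<close>, where \<open>\<alpha>\<close> and \<open>\<beta>\<close> are forms of degrees 3 and 4 in the other
  eleven basis vectors.  Then \<open>\<omega> \<and> \<omega> = 0\<close> gives \<open>\<alpha> \<and> \<beta> = 0\<close>.  The kernel of \<open>\<beta> \<mapsto> \<alpha> \<and> \<beta>\<close>, a map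
  between spaces of the same dimension 330, always contains the products \<open>u \<and> \<alpha>\<close>, and for generic \<open>\<alpha>\<close>
  it contains nothing else.  In that case \<open>\<beta> = u \<and> \<alpha>\<close> for some \<open>u\<close>, and then \<open>e\<^sub>s + u\<close> divides \<open>\<omega>\<close>.
  Genericity is expressed by a form \<open>F\<close>, a product of two determinants (\<open>generic_divisibility\<close>), and
  non-divisibility by a determinant \<open>G\<close>; so \<open>Z\<close> is the union of its intersections with \<open>F = 0\<close> and
  \<open>G = 0\<close>.  That \<open>F\<close> does not vanish identically on \<open>Z\<close> can be seen from a single \<open>\<alpha>\<close>.  The one
  used here is a sum of sixteen products of basis vectors, sparse enough that its 330 equations can
  be solved one unknown at a time.
\<close>

section \<open>The exterior algebra\<close>

lemma shuffle_sign_union_left: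
  fixes T U W :: "'n::{finite,linorder} set"
  assumes "T \<inter> U = {}"
  shows "shuffle_sign (T \<union> U) W = shuffle_sign T W * shuffle_sign U W"
proof -
  have "{(t, u). t \<in> T \<union> U \<and> u \<in> W \<and> u < t} =
      {(t, u). t \<in> T \<and> u \<in> W \<and> u < t} \<union> {(t, u). t \<in> U \<and> u \<in> W \<and> u < t}"
    by auto
  moreover have "{(t, u). t \<in> T \<and> u \<in> W \<and> u < t} \<inter> {(t, u). t \<in> U \<and> u \<in> W \<and> u < t} = {}"
    using assms by auto
  ultimately show ?thesis
    by (simp add: shuffle_sign_def card_Un_disjoint power_add)
qed

lemma shuffle_sign_union_right:
  fixes T U W :: "'n::{finite,linorder} set"
  assumes "U \<inter> W = {}"
  shows "shuffle_sign T (U \<union> W) = shuffle_sign T U * shuffle_sign T W"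
proof -
  have "{(t, u). t \<in> T \<and> u \<in> U \<union> W \<and> u < t} =
      {(t, u). t \<in> T \<and> u \<in> U \<and> u < t} \<union> {(t, u). t \<in> T \<and> u \<in> W \<and> u < t}"
    by auto
  moreover have "{(t, u). t \<in> T \<and> u \<in> U \<and> u < t} \<inter> {(t, u). t \<in> T \<and> u \<in> W \<and> u < t} = {}"
    using assms by auto
  ultimately show ?thesis
    by (simp add: shuffle_sign_def card_Un_disjoint power_add)
qed

lemma shuffle_sign_commute:
  fixes T U :: "'n::{finite,linorder} set"
  assumes "T \<inter> U = {}"
  shows "shuffle_sign T U = (- 1) ^ (card T * card U) * shuffle_sign U T"
proof -
  let ?A = "{(t, u). t \<in> T \<and> u \<in> U \<and> u < t}" and ?B = "{(t, u). t \<in> T \<and> u \<in> U \<and> t < u}"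
  have "T \<times> U = ?A \<union> ?B"
    using assms by (auto simp: neq_iff)
  then have "card T * card U = card (?A \<union> ?B)"
    by (simp flip: card_cartesian_product)
  also have "\<dots> = card ?A + card ?B"
    by (rule card_Un_disjoint) auto
  finally have "card T * card U = card ?A + card ?B" .
  moreover have "card ?B = card {(u, t). u \<in> U \<and> t \<in> T \<and> t < u}"
    by (rule bij_betw_same_card[of "\<lambda>(t, u). (u, t)"])
       (auto simp: bij_betw_def inj_on_def image_def)
  ultimately show ?thesis
    by (simp add: shuffle_sign_def power_add)
qed

lemma shuffle_sign_nonzero: "shuffle_sign T U \<noteq> 0"
  by (simp add: shuffle_sign_def)

lemma wedge_add_left: "(x + y) \<and>\<^sub>E z = x \<and>\<^sub>E z + y \<and>\<^sub>E z"
  by (simp add: vec_eq_iff wedge_def algebra_simps sum.distrib)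

lemma wedge_add_right: "z \<and>\<^sub>E (x + y) = z \<and>\<^sub>E x + z \<and>\<^sub>E y"
  by (simp add: vec_eq_iff wedge_def algebra_simps sum.distrib)

lemma wedge_scale_left: "(c *s x) \<and>\<^sub>E y = c *s (x \<and>\<^sub>E y)"
  by (simp add: vec_eq_iff wedge_def sum_distrib_left mult_ac)

lemma wedge_scale_right: "x \<and>\<^sub>E (c *s y) = c *s (x \<and>\<^sub>E y)"
  by (simp add: vec_eq_iff wedge_def sum_distrib_left mult_ac)

lemma wedge_zero [simp]: "0 \<and>\<^sub>E x = 0" "x \<and>\<^sub>E 0 = 0"
  by (simp_all add: vec_eq_iff wedge_def)

lemma wedge_minus_left: "(- x) \<and>\<^sub>E y = - (x \<and>\<^sub>E y)"
  by (simp add: vec_eq_iff wedge_def sum_negf)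

lemma wedge_minus_right: "x \<and>\<^sub>E (- y) = - (x \<and>\<^sub>E y)"
  by (simp add: vec_eq_iff wedge_def sum_negf)

lemma wedge_diff_right: "z \<and>\<^sub>E (x - y) = z \<and>\<^sub>E x - z \<and>\<^sub>E y"
  by (simp add: vec_eq_iff wedge_def algebra_simps sum_subtractf)

lemma wedge_sum_left: "(\<Sum>i\<in>I. x i) \<and>\<^sub>E y = (\<Sum>i\<in>I. x i \<and>\<^sub>E y)"
  using wedge_lincomb_left[of "\<lambda>_. 1" x I y] by simp

lemma wedge_sum_right: "y \<and>\<^sub>E (\<Sum>i\<in>I. x i) = (\<Sum>i\<in>I. y \<and>\<^sub>E x i)"
  using wedge_lincomb_right[of y "\<lambda>_. 1" x I] by simp

lemma wedge_axis_left:
  "(axis T 1 \<and>\<^sub>E x) $ S = (if T \<subseteq> S then shuffle_sign T (S - T) * x $ (S - T) else 0)"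
proof -
  have "(axis T 1 \<and>\<^sub>E x) $ S =
      (\<Sum>T'\<in>Pow S. if T' = T then shuffle_sign T (S - T) * x $ (S - T) else 0)"
    unfolding wedge_def vec_lambda_beta by (rule sum.cong) (auto simp: axis_def)
  then show ?thesis by (simp add: sum.delta)
qed

lemma wedge_basis:
  "axis T 1 \<and>\<^sub>E axis U 1 = (if T \<inter> U = {} then shuffle_sign T U else 0) *s axis (T \<union> U) 1"
  by (simp add: wedge_axis)

lemma wedge_assoc_basis:
  fixes S T U :: "'n::{finite,linorder} set"
  shows "(axis S 1 \<and>\<^sub>E axis T 1) \<and>\<^sub>E axis U 1 = axis S 1 \<and>\<^sub>E (axis T 1 \<and>\<^sub>E axis U 1)"
proof (cases "S \<inter> T = {} \<and> S \<inter> U = {} \<and> T \<inter> U = {}")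
  case True
  then have "(S \<union> T) \<inter> U = {}" "S \<inter> (T \<union> U) = {}" by auto
  with True show ?thesis
    by (simp add: wedge_basis wedge_scale_left wedge_scale_right shuffle_sign_union_left
        shuffle_sign_union_right Un_assoc mult_ac)
next
  case False
  show ?thesis
  proof (cases "S \<inter> T = {} \<and> T \<inter> U = {}")
    case True
    with False have "(S \<union> T) \<inter> U \<noteq> {}" "S \<inter> (T \<union> U) \<noteq> {}" by auto
    then show ?thesis
      by (simp add: wedge_basis wedge_scale_left wedge_scale_right)
  next
    case False
    then have "(S \<inter> T \<noteq> {} \<or> (S \<union> T) \<inter> U \<noteq> {}) \<and> (T \<inter> U \<noteq> {} \<or> S \<inter> (T \<union> U) \<noteq> {})"
      by auto
    then show ?thesis
      by (auto simp: wedge_basis wedge_scale_left wedge_scale_right)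
  qed
qed

lemma wedge_assoc: "(x \<and>\<^sub>E y) \<and>\<^sub>E z = x \<and>\<^sub>E (y \<and>\<^sub>E z)"
proof -
  let ?b = "\<lambda>S. axis S 1 :: complex ^ 'a set"
  have "((\<Sum>S\<in>UNIV. x $ S *s ?b S) \<and>\<^sub>E (\<Sum>T\<in>UNIV. y $ T *s ?b T)) \<and>\<^sub>E (\<Sum>U\<in>UNIV. z $ U *s ?b U) =
      (\<Sum>S\<in>UNIV. x $ S *s ?b S) \<and>\<^sub>E ((\<Sum>T\<in>UNIV. y $ T *s ?b T) \<and>\<^sub>E (\<Sum>U\<in>UNIV. z $ U *s ?b U))"
    by (simp only: wedge_lincomb_left wedge_lincomb_right wedge_scale_left wedge_scale_right
        wedge_assoc_basis)
  then show ?thesis by (simp only: basis_expansion)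
qed

text \<open>
  Moving one factor past the other transposes every element of \<open>T\<close> with every element of \<open>S - T\<close>,
  which contributes the same sign to every coefficient.
\<close>

lemma wedge_commute_graded:
  assumes "x \<in> ext_power k" "y \<in> ext_power l"
  shows "x \<and>\<^sub>E y = (- 1) ^ (k * l) *s (y \<and>\<^sub>E x)"
proof -
  have "(x \<and>\<^sub>E y) $ S = (- 1) ^ (k * l) * (y \<and>\<^sub>E x) $ S" for S
  proof -
    have "(x \<and>\<^sub>E y) $ S = (\<Sum>T\<in>Pow S. shuffle_sign (S - T) (S - (S - T)) * x $ (S - T) * y $ (S - (S - T)))"
      unfolding wedge_def vec_lambda_beta
      by (rule sum.reindex_bij_witness[of _ "\<lambda>T. S - T" "\<lambda>T. S - T"]) (auto simp: double_diff)
    also have "\<dots> = (\<Sum>T\<in>Pow S. (- 1) ^ (k * l) * (shuffle_sign T (S - T) * y $ T * x $ (S - T)))"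
    proof (intro sum.cong refl)
      fix T assume "T \<in> Pow S"
      then have eq: "S - (S - T) = T" by auto
      show "shuffle_sign (S - T) (S - (S - T)) * x $ (S - T) * y $ (S - (S - T)) =
          (- 1) ^ (k * l) * (shuffle_sign T (S - T) * y $ T * x $ (S - T))"
      proof (cases "x $ (S - T) = 0 \<or> y $ T = 0")
        case False
        with assms have "card (S - T) = k" "card T = l" by (auto simp: ext_power_def)
        moreover have "(S - T) \<inter> T = {}" by auto
        ultimately show ?thesis
          by (simp add: eq shuffle_sign_commute[of "S - T" T])
      qed (auto simp: eq)
    qed
    also have "\<dots> = (- 1) ^ (k * l) * (y \<and>\<^sub>E x) $ S"
      by (simp add: wedge_def sum_distrib_left)
    finally show ?thesis .
  qed
  then show ?thesis
    unfolding vec_eq_iff vector_smult_component by blast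
qed

lemma ext_power_zero [simp]: "0 \<in> ext_power k"
  by (simp add: ext_power_def)

lemma ext_power_add: "x \<in> ext_power k \<Longrightarrow> y \<in> ext_power k \<Longrightarrow> x + y \<in> ext_power k"
  by (auto simp: ext_power_def) (metis add.right_neutral)

lemma ext_power_scale: "x \<in> ext_power k \<Longrightarrow> c *s x \<in> ext_power k"
  by (auto simp: ext_power_def)

lemma ext_power_sum: "(\<And>i. i \<in> I \<Longrightarrow> x i \<in> ext_power k) \<Longrightarrow> (\<Sum>i\<in>I. x i) \<in> ext_power k"
  by (induction I rule: infinite_finite_induct) (auto intro: ext_power_add)

lemma ext_power_wedge:
  assumes "x \<in> ext_power k" "y \<in> ext_power l"
  shows "x \<and>\<^sub>E y \<in> ext_power (k + l)"
  unfolding ext_power_def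
proof (intro CollectI allI impI)
  fix S assume "(x \<and>\<^sub>E y) $ S \<noteq> 0"
  then obtain T where T: "T \<subseteq> S" "x $ T \<noteq> 0" "y $ (S - T) \<noteq> 0"
    unfolding wedge_def vec_lambda_beta by (auto elim!: sum.not_neutral_contains_not_neutral)
  with assms have "card T = k" "card (S - T) = l" by (auto simp: ext_power_def)
  with T(1) show "card S = k + l"
    by (metis card_Diff_subset card_mono finite le_add_diff_inverse)
qed

lemma ext_vec_ext_power: "ext_vec v \<in> ext_power 1"
  unfolding ext_vec_def by (intro ext_power_sum ext_power_scale) (auto simp: ext_power_def axis_def)

lemma ext_vec_nth: "ext_vec v $ S = (if card S = 1 then v $ the_elem S else 0)"
proof (cases "card S = 1")
  case True
  then obtain i where "S = {i}" by (auto simp: card_1_singleton_iff)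
  then show ?thesis by (simp add: ext_vec_def axis_def if_distrib cong: if_cong)
next
  case False
  then show ?thesis using ext_vec_ext_power[of v] by (auto simp: ext_power_def)
qed

lemma ext_vec_add: "ext_vec (u + v) = ext_vec u + ext_vec v"
  by (simp add: ext_vec_def sum.distrib vec.scale_left_distrib)

lemma ext_vec_scale: "ext_vec (c *s u) = c *s ext_vec u"
  by (simp add: ext_vec_def vec.scale_sum_right)

lemma ext_vec_zero [simp]: "ext_vec 0 = 0"
  by (simp add: ext_vec_def)

lemma ext_vec_square: "ext_vec v \<and>\<^sub>E ext_vec v = 0"
proof -
  have "ext_vec v \<and>\<^sub>E ext_vec v = - (ext_vec v \<and>\<^sub>E ext_vec v)"
    using wedge_commute_graded[OF ext_vec_ext_power ext_vec_ext_power, of v v] by simp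
  then show ?thesis by (simp add: vec_eq_iff eq_neg_iff_add_eq_0)
qed

lemma ext_vec_square_wedge: "ext_vec v \<and>\<^sub>E (ext_vec v \<and>\<^sub>E x) = 0"
  by (simp add: wedge_assoc[symmetric] ext_vec_square)

lemma ext_vec_swap: "ext_vec u \<and>\<^sub>E ext_vec v = - (ext_vec v \<and>\<^sub>E ext_vec u)"
  using wedge_commute_graded[OF ext_vec_ext_power ext_vec_ext_power, of u v] by simp

lemma wedge_unit_left [simp]: "axis {} 1 \<and>\<^sub>E x = x"
proof -
  have *: "axis {} 1 \<and>\<^sub>E axis S 1 = (axis S 1 :: complex ^ 'a set)" for S
    by (simp add: wedge_basis shuffle_sign_def)
  have "axis {} 1 \<and>\<^sub>E (\<Sum>S\<in>UNIV. x $ S *s axis S 1) = (\<Sum>S\<in>UNIV. x $ S *s axis S 1)"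
    by (simp only: wedge_lincomb_right *)
  then show ?thesis by (simp only: basis_expansion)
qed

section \<open>Alternating functions of lists\<close>

lemma wedge_list_Nil: "wedge_list [] = axis {} 1"
  by (simp add: wedge_list_def)

lemma wedge_list_Cons: "wedge_list (v # vs) = ext_vec v \<and>\<^sub>E wedge_list vs"
  by (simp add: wedge_list_def)

lemma wedge_list_append: "wedge_list (us @ vs) = wedge_list us \<and>\<^sub>E wedge_list vs"
  by (induction us) (simp_all add: wedge_list_Nil wedge_list_Cons wedge_assoc)

lemma wedge_list_ext_power: "wedge_list vs \<in> ext_power (length vs)"
proof (induction vs)
  case Nil
  show ?case by (simp add: wedge_list_Nil ext_power_def axis_def)
next
  case (Cons v vs)
  with ext_power_wedge[OF ext_vec_ext_power this, of v] show ?case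
    by (simp add: wedge_list_Cons)
qed

text \<open>
  The length is fixed because the functions considered later cut their argument at a fixed position.
\<close>

definition alternating :: "nat \<Rightarrow> ('a list \<Rightarrow> 'b::real_vector) \<Rightarrow> bool" where
  "alternating n H \<longleftrightarrow>
     (\<forall>xs a b ys. length (xs @ a # b # ys) = n \<longrightarrow> H (xs @ a # b # ys) = - H (xs @ b # a # ys))"

lemma eq_uminus_zero:
  fixes x :: "'b::real_vector"
  assumes "x = - x"
  shows "x = 0"
proof -
  have "2 *\<^sub>R x = x + x" by (rule scaleR_2)
  also have "\<dots> = 0" using assms by (simp only: eq_neg_iff_add_eq_0)
  finally show ?thesis by simp
qed

lemma alternatingD:
  "alternating n H \<Longrightarrow> length (xs @ a # b # ys) = n \<Longrightarrow> H (xs @ a # b # ys) = - H (xs @ b # a # ys)"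
  unfolding alternating_def by blast

lemma alternating_move:
  assumes "alternating n H" "length (xs @ a # ys @ zs) = n"
  shows "H (xs @ a # ys @ zs) = 0 \<longleftrightarrow> H (xs @ ys @ a # zs) = 0"
  using assms(2)
proof (induction ys arbitrary: xs)
  case (Cons y ys)
  have swap: "H (xs @ a # y # ys @ zs) = - H (xs @ y # a # ys @ zs)"
    using Cons.prems by (intro alternatingD[OF assms(1)]) simp
  have "H (xs @ a # (y # ys) @ zs) = 0 \<longleftrightarrow> - H (xs @ y # a # ys @ zs) = 0"
    by (simp only: swap append_Cons)
  also have "\<dots> \<longleftrightarrow> H ((xs @ [y]) @ a # ys @ zs) = 0" by simp
  also have "\<dots> \<longleftrightarrow> H ((xs @ [y]) @ ys @ a # zs) = 0"
    using Cons by (intro Cons.IH) simp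
  finally show ?case by simp
qed simp

lemma alternating_zero_mset:
  assumes "alternating n H" "length (xs @ l) = n" "mset l = mset l'"
  shows "H (xs @ l) = 0 \<longleftrightarrow> H (xs @ l') = 0"
  using assms(2,3)
proof (induction l arbitrary: xs l')
  case (Cons a l)
  then have "a \<in> set l'" by (metis list.set_intros(1) set_mset_mset)
  then obtain ys zs where l': "l' = ys @ a # zs" by (meson split_list)
  have "H (xs @ a # l) = 0 \<longleftrightarrow> H ((xs @ [a]) @ l) = 0" by simp
  also have "\<dots> \<longleftrightarrow> H ((xs @ [a]) @ (ys @ zs)) = 0"
    using Cons.prems l' by (intro Cons.IH) auto
  also have "\<dots> \<longleftrightarrow> H (xs @ a # ys @ zs) = 0" by simp
  also have "\<dots> \<longleftrightarrow> H (xs @ ys @ a # zs) = 0"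
  proof (rule alternating_move[OF assms(1)])
    have "length l' = length (a # l)" using Cons.prems(2) by (metis size_mset)
    then show "length (xs @ a # ys @ zs) = n" using Cons.prems(1) l' by simp
  qed
  finally show ?case by (simp add: l')
qed simp

lemma alternating_repeat:
  assumes "alternating n H" "length l = n" "\<not> distinct l"
  shows "H l = 0"
proof -
  obtain xs ys zs a where l: "l = xs @ [a] @ ys @ [a] @ zs"
    using assms(3) not_distinct_decomp by blast
  have "H (xs @ a # ys @ a # zs) = 0 \<longleftrightarrow> H (xs @ ys @ a # a # zs) = 0"
    using alternating_move[OF assms(1), of xs a ys "a # zs"] assms(2) l by simp
  moreover have "H ((xs @ ys) @ a # a # zs) = - H ((xs @ ys) @ a # a # zs)"
    using assms l by (intro alternatingD[OF assms(1)]) simp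
  then have "H (xs @ ys @ a # a # zs) = 0"
    unfolding append_assoc by (rule eq_uminus_zero)
  ultimately show ?thesis by (simp add: l)
qed

text \<open>
  Adjacent transpositions sort any list, so only strictly increasing lists matter; a list with a
  repetition can be brought into a form where two neighbours are equal.  This replaces all sign
  bookkeeping with permutations: two alternating functions are compared through their difference.
\<close>

lemma alternating_zero:
  fixes H :: "'a::linorder list \<Rightarrow> 'b::real_vector"
  assumes "alternating n H" "\<And>l. length l = n \<Longrightarrow> sorted_wrt (<) l \<Longrightarrow> H l = 0" "length l = n"
  shows "H l = 0"
proof (cases "distinct l")
  case True
  then have "sorted_wrt (<) (sort l)" by (simp add: strict_sorted_iff)
  then have "H ([] @ sort l) = 0" using assms(2)[of "sort l"] assms(3) by simp
  then show ?thesis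
    using alternating_zero_mset[OF assms(1), of "[]" l "sort l"] assms(3) by simp
qed (use alternating_repeat assms in blast)

lemma wedge_list_swap: "wedge_list (xs @ a # b # ys) = - wedge_list (xs @ b # a # ys)"
proof -
  have "wedge_list (xs @ a # b # ys) =
      wedge_list xs \<and>\<^sub>E (ext_vec a \<and>\<^sub>E ext_vec b) \<and>\<^sub>E wedge_list ys"
    by (simp add: wedge_list_append wedge_list_Cons wedge_assoc)
  also have "\<dots> = - (wedge_list xs \<and>\<^sub>E (ext_vec b \<and>\<^sub>E ext_vec a) \<and>\<^sub>E wedge_list ys)"
    by (subst ext_vec_swap) (simp add: wedge_minus_left wedge_minus_right)
  finally show ?thesis
    by (simp add: wedge_list_append wedge_list_Cons wedge_assoc)
qed

lemma alternating_wedge_list: "alternating n wedge_list"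
  unfolding alternating_def using wedge_list_swap by blast

lemma wedge_list_repeat: "\<not> distinct vs \<Longrightarrow> wedge_list vs = 0"
  using alternating_repeat alternating_wedge_list by blast

text \<open>
  Expanding one vector in the others gives wedge products with a repeated factor.
\<close>

lemma wedge_list_dependent:
  assumes "vec.dependent (set vs)"
  shows "wedge_list vs = 0"
proof -
  obtain v where v: "v \<in> set vs" "v \<in> vec.span (set vs - {v})"
    using assms by (auto simp: vec.dependent_def)
  then obtain j where j: "j < length vs" "vs ! j = v" by (auto simp: in_set_conv_nth)
  obtain c where c: "v = (\<Sum>w\<in>set vs - {v}. c w *s w)"
    using v(2) by (auto simp: vec.span_finite)
  have "wedge_list vs = wedge_list (vs[j := \<Sum>w\<in>set vs - {v}. c w *s w])"
    using j c by (metis list_update_id)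
  also have "\<dots> = (\<Sum>w\<in>set vs - {v}. c w *s wedge_list (vs[j := w]))"
    using j(1) by (rule wedge_list_lincomb)
  also have "\<dots> = 0"
  proof (rule sum.neutral, rule ballI)
    fix w assume w: "w \<in> set vs - {v}"
    then obtain m where m: "m < length vs" "vs ! m = w" by (auto simp: in_set_conv_nth)
    with j w have "m \<noteq> j" by auto
    then have "vs[j := w] ! m = vs[j := w] ! j" using m j by simp
    then have "\<not> distinct (vs[j := w])"
      using m(1) j(1) \<open>m \<noteq> j\<close> by (metis length_list_update nth_eq_iff_index_eq)
    then show "c w *s wedge_list (vs[j := w]) = 0" by (simp add: wedge_list_repeat)
  qed
  finally show ?thesis .
qed

lemma wedge_list_sorted_axes:
  assumes "sorted_wrt (<) l"
  shows "wedge_list (map (\<lambda>i. axis i 1) l) = axis (set l) 1"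
  using assms
proof (induction l)
  case (Cons a l)
  have "{(t, u). t \<in> {a} \<and> u \<in> set l \<and> u < t} = {}" "a \<notin> set l"
    using Cons.prems by force+
  then have "shuffle_sign {a} (set l) = 1"
    by (simp only: shuffle_sign_def) simp
  with Cons \<open>a \<notin> set l\<close> show ?case
    by (simp add: wedge_list_Cons ext_vec_axis wedge_basis)
qed (simp add: wedge_list_Nil)

lemma wedge_list_basis_list: "wedge_list (basis_list S) = axis S 1"
  by (simp add: basis_list_def wedge_list_sorted_axes)

lemma length_basis_list [simp]: "length (basis_list S) = card S"
  by (simp add: basis_list_def)

section \<open>Homogeneous forms\<close>

lemma homogeneous_form_monomial:
  "homogeneous_form (\<Sum>i\<in>UNIV. a i) (\<lambda>x :: complex ^ 'i. \<Prod>i\<in>UNIV. (x $ i) ^ a i)"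
  unfolding homogeneous_form_def
proof (intro exI ext)
  fix x :: "complex ^ 'i"
  have "(\<Sum>b | (\<Sum>i\<in>UNIV. b i) = (\<Sum>i\<in>UNIV. a i).
        (if b = a then 1 else 0) * (\<Prod>i\<in>UNIV. (x $ i) ^ b i)) =
      (\<Sum>b | (\<Sum>i\<in>UNIV. b i) = (\<Sum>i\<in>UNIV. a i).
        if b = a then \<Prod>i\<in>UNIV. (x $ i) ^ b i else 0)"
    by (rule sum.cong) auto
  also have "\<dots> = (\<Prod>i\<in>UNIV. (x $ i) ^ a i)"
    by (subst sum.delta) (auto simp: finite_exponents)
  finally show "(\<Prod>i\<in>UNIV. (x $ i) ^ a i) =
      (\<Sum>b | (\<Sum>i\<in>UNIV. b i) = (\<Sum>i\<in>UNIV. a i).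
        (if b = a then 1 else 0) * (\<Prod>i\<in>UNIV. (x $ i) ^ b i))" ..
qed

lemma homogeneous_form_zero: "homogeneous_form d (\<lambda>_. 0)"
  unfolding homogeneous_form_def by (rule exI[of _ "\<lambda>_. 0"]) simp

lemma homogeneous_form_scale:
  assumes "homogeneous_form d f"
  shows "homogeneous_form d (\<lambda>x. k * f x)"
proof -
  obtain c where "f = (\<lambda>x. \<Sum>a | (\<Sum>i\<in>UNIV. a i) = d. c a * (\<Prod>i\<in>UNIV. (x $ i) ^ a i))"
    using assms unfolding homogeneous_form_def by blast
  then show ?thesis
    unfolding homogeneous_form_def
    by (intro exI[of _ "\<lambda>a. k * c a"]) (simp add: sum_distrib_left mult.assoc)
qed

lemma homogeneous_form_add:
  assumes "homogeneous_form d f" "homogeneous_form d g"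
  shows "homogeneous_form d (\<lambda>x. f x + g x)"
proof -
  obtain c c' where
    "f = (\<lambda>x. \<Sum>a | (\<Sum>i\<in>UNIV. a i) = d. c a * (\<Prod>i\<in>UNIV. (x $ i) ^ a i))"
    "g = (\<lambda>x. \<Sum>a | (\<Sum>i\<in>UNIV. a i) = d. c' a * (\<Prod>i\<in>UNIV. (x $ i) ^ a i))"
    using assms unfolding homogeneous_form_def by blast
  then show ?thesis
    unfolding homogeneous_form_def
    by (intro exI[of _ "\<lambda>a. c a + c' a"]) (simp add: sum.distrib distrib_right)
qed

lemma homogeneous_form_sum:
  assumes "\<And>i. i \<in> I \<Longrightarrow> homogeneous_form d (f i)"
  shows "homogeneous_form d (\<lambda>x. \<Sum>i\<in>I. f i x)"
  using assms
  by (induction I rule: infinite_finite_induct)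
     (auto intro: homogeneous_form_zero homogeneous_form_add)

lemma homogeneous_form_mult:
  fixes f g :: "complex ^ 'i \<Rightarrow> complex"
  assumes "homogeneous_form d f" "homogeneous_form e g"
  shows "homogeneous_form (d + e) (\<lambda>x. f x * g x)"
proof -
  obtain c where c: "f = (\<lambda>x. \<Sum>a | (\<Sum>i\<in>UNIV. a i) = d. c a * (\<Prod>i\<in>UNIV. (x $ i) ^ a i))"
    using assms(1) unfolding homogeneous_form_def by blast
  obtain c' where c': "g = (\<lambda>x. \<Sum>b | (\<Sum>i\<in>UNIV. b i) = e. c' b * (\<Prod>i\<in>UNIV. (x $ i) ^ b i))"
    using assms(2) unfolding homogeneous_form_def by blast
  have "(\<lambda>x. f x * g x) = (\<lambda>x. \<Sum>a | (\<Sum>i\<in>UNIV. a i) = d. \<Sum>b | (\<Sum>i\<in>UNIV. b i) = e.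
      (c a * c' b) * (\<Prod>i\<in>UNIV. (x $ i) ^ (a i + b i)))"
    unfolding c c' sum_product
    by (intro ext sum.cong refl) (simp add: power_add prod.distrib)
  moreover have "homogeneous_form (d + e) \<dots>"
  proof (intro homogeneous_form_sum homogeneous_form_scale)
    fix a b :: "'i \<Rightarrow> nat"
    assume "a \<in> {a. (\<Sum>i\<in>UNIV. a i) = d}" "b \<in> {b. (\<Sum>i\<in>UNIV. b i) = e}"
    then show "homogeneous_form (d + e) (\<lambda>x :: complex ^ 'i. \<Prod>i\<in>UNIV. (x $ i) ^ (a i + b i))"
      using homogeneous_form_monomial[of "\<lambda>i. a i + b i"] by (simp add: sum.distrib)
  qed
  ultimately show ?thesis by simp
qed

lemma homogeneous_form_const: "homogeneous_form 0 (\<lambda>_. k)"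
  using homogeneous_form_scale[OF homogeneous_form_monomial[of "\<lambda>_. 0"], of k] by simp

lemma homogeneous_form_prod:
  assumes "finite I" "\<And>i. i \<in> I \<Longrightarrow> homogeneous_form d (f i)"
  shows "homogeneous_form (card I * d) (\<lambda>x. \<Prod>i\<in>I. f i x)"
  using assms
  by (induction I) (auto intro: homogeneous_form_const homogeneous_form_mult)

lemma homogeneous_form_coord: "homogeneous_form 1 (\<lambda>x :: complex ^ 'i. x $ i)"
proof -
  have "(\<Prod>j\<in>UNIV. (x $ j) ^ (if j = i then 1 else 0)) = x $ i" for x :: "complex ^ 'i"
  proof -
    have "(\<Prod>j\<in>UNIV. (x $ j) ^ (if j = i then 1 else 0)) = (\<Prod>j\<in>UNIV. if j = i then x $ j else 1)"
      by (rule prod.cong) auto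
    then show ?thesis by simp
  qed
  then show ?thesis
    using homogeneous_form_monomial[of "\<lambda>j. if j = i then 1 else 0"] by simp
qed

lemma homogeneous_form_det:
  fixes M :: "complex ^ 'w \<Rightarrow> complex ^ 'n ^ 'n"
  assumes "\<And>i j. homogeneous_form d (\<lambda>x. M x $ i $ j)"
  shows "homogeneous_form (CARD('n) * d) (\<lambda>x. det (M x))"
  unfolding det_def
  by (intro homogeneous_form_sum homogeneous_form_scale homogeneous_form_prod assms) auto

lemma homogeneous_form_scale_arg:
  assumes "homogeneous_form d f"
  shows "f (k *s x) = k ^ d * f x"
proof -
  obtain c where c: "f = (\<lambda>x. \<Sum>a | (\<Sum>i\<in>UNIV. a i) = d. c a * (\<Prod>i\<in>UNIV. (x $ i) ^ a i))"
    using assms unfolding homogeneous_form_def by blast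
  have "c a * (\<Prod>i\<in>UNIV. ((k *s x) $ i) ^ a i) = k ^ d * (c a * (\<Prod>i\<in>UNIV. (x $ i) ^ a i))"
    if "(\<Sum>i\<in>UNIV. a i) = d" for a
  proof -
    have "(\<Prod>i\<in>UNIV. k ^ a i) = k ^ d" using that by (simp flip: power_sum)
    then show ?thesis by (simp add: power_mult_distrib prod.distrib)
  qed
  then show ?thesis unfolding c sum_distrib_left by (intro sum.cong) auto
qed

text \<open>
  Taking variables out of a monomial one at a time exhibits a quadratic monomial as a product of
  two coordinates.
\<close>

lemma monomial_split:
  fixes a :: "'i::finite \<Rightarrow> nat"
  assumes "(\<Sum>i\<in>UNIV. a i) = Suc d"
  shows "\<exists>i b. (\<Sum>i\<in>UNIV. b i) = d \<and>
    (\<forall>x :: complex ^ 'i. (\<Prod>j\<in>UNIV. (x $ j) ^ a j) = x $ i * (\<Prod>j\<in>UNIV. (x $ j) ^ b j))"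
proof -
  obtain i where i: "a i \<noteq> 0"
    using assms by (metis nat.distinct(1) sum.neutral)
  define b where "b = a(i := a i - 1)"
  have rest: "(\<Sum>j\<in>UNIV - {i}. b j) = (\<Sum>j\<in>UNIV - {i}. a j)"
    "(\<Prod>j\<in>UNIV - {i}. (x $ j) ^ b j) = (\<Prod>j\<in>UNIV - {i}. (x $ j) ^ a j)" for x :: "complex ^ 'i"
    by (auto simp: b_def intro: sum.cong prod.cong)
  have ai: "a i = Suc (b i)" using i by (simp add: b_def)
  have "(\<Sum>i\<in>UNIV. b i) = d"
    using assms rest(1) ai by (simp add: sum.remove[of UNIV i])
  moreover have "(\<Prod>j\<in>UNIV. (x $ j) ^ a j) = x $ i * (\<Prod>j\<in>UNIV. (x $ j) ^ b j)"
    for x :: "complex ^ 'i"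
    by (simp add: prod.remove[of UNIV i] rest(2) ai mult.assoc)
  ultimately show ?thesis by blast
qed

definition sym_bilinear :: "(complex ^ 'i \<Rightarrow> complex ^ 'i \<Rightarrow> complex) \<Rightarrow> bool" where
  "sym_bilinear B \<longleftrightarrow> (\<forall>x y. B x y = B y x) \<and> (\<forall>x y z. B (x + y) z = B x z + B y z) \<and>
     (\<forall>c x y. B (c *s x) y = c * B x y)"

lemma quadratic_form_bilinear:
  fixes f :: "complex ^ 'i \<Rightarrow> complex"
  assumes "homogeneous_form 2 f"
  obtains B where "sym_bilinear B" "\<And>x. f x = B x x"
proof -
  obtain c where c: "f = (\<lambda>x. \<Sum>a | (\<Sum>i\<in>UNIV. a i) = 2. c a * (\<Prod>i\<in>UNIV. (x $ i) ^ a i))"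
    using assms unfolding homogeneous_form_def by blast
  have "\<exists>i j. \<forall>x :: complex ^ 'i. (\<Prod>k\<in>UNIV. (x $ k) ^ a k) = x $ i * x $ j"
    if a: "(\<Sum>i\<in>UNIV. a i) = 2" for a
  proof -
    obtain i b where b: "(\<Sum>i\<in>UNIV. b i) = 1"
      "\<forall>x :: complex ^ 'i. (\<Prod>j\<in>UNIV. (x $ j) ^ a j) = x $ i * (\<Prod>j\<in>UNIV. (x $ j) ^ b j)"
      using monomial_split[of a 1] a by auto
    obtain j b' where b': "(\<Sum>i\<in>UNIV. b' i) = 0"
      "\<forall>x :: complex ^ 'i. (\<Prod>k\<in>UNIV. (x $ k) ^ b k) = x $ j * (\<Prod>k\<in>UNIV. (x $ k) ^ b' k)"
      using monomial_split[of b 0] b(1) by (metis One_nat_def)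
    show ?thesis using b(2) b' by auto
  qed
  then obtain p q where pq: "\<And>a (x :: complex ^ 'i). (\<Sum>i\<in>UNIV. a i) = 2 \<Longrightarrow>
      (\<Prod>k\<in>UNIV. (x $ k) ^ a k) = x $ p a * x $ q a"
    by metis
  define B where "B x y = (\<Sum>a | (\<Sum>i\<in>UNIV. a i) = 2. c a * ((x $ p a * y $ q a + y $ p a * x $ q a) / 2))"
    for x y :: "complex ^ 'i"
  have "sym_bilinear B"
    unfolding sym_bilinear_def
  proof (intro conjI allI)
    fix x y z :: "complex ^ 'i" and k
    show "B x y = B y x"
      unfolding B_def by (intro sum.cong refl) (simp add: add.commute)
    show "B (x + y) z = B x z + B y z"
      unfolding B_def sum.distrib[symmetric] by (intro sum.cong refl) (simp add: field_simps)
    show "B (k *s x) y = k * B x y"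
      unfolding B_def sum_distrib_left by (intro sum.cong refl) (simp add: field_simps)
  qed
  moreover have "f x = B x x" for x
    unfolding c B_def by (intro sum.cong) (auto simp: pq)
  ultimately show ?thesis using that by blast
qed

context
  fixes B :: "complex ^ 'i \<Rightarrow> complex ^ 'i \<Rightarrow> complex"
  assumes B: "sym_bilinear B"
begin

lemma sym_bilinear_sym: "B x y = B y x"
  using B unfolding sym_bilinear_def by blast

lemma sym_bilinear_add_left: "B (x + y) z = B x z + B y z"
  using B unfolding sym_bilinear_def by blast

lemma sym_bilinear_add_right: "B z (x + y) = B z x + B z y"
  using sym_bilinear_add_left sym_bilinear_sym by metis

lemma sym_bilinear_scale_left: "B (c *s x) y = c * B x y"
  using B unfolding sym_bilinear_def by blast

lemma sym_bilinear_scale_right: "B y (c *s x) = c * B y x"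
  using sym_bilinear_scale_left sym_bilinear_sym by metis

lemma sym_bilinear_minus_left: "B (- x) y = - B x y"
  using sym_bilinear_scale_left[of "-1" x y] by simp

lemma sym_bilinear_minus_right: "B y (- x) = - B y x"
  using sym_bilinear_scale_right[of y "-1" x] by simp

lemma sym_bilinear_zero_left: "B 0 y = 0"
  using sym_bilinear_scale_left[of 0 0 y] by simp

lemma sym_bilinear_zero_right: "B y 0 = 0"
  using sym_bilinear_scale_right[of y 0 0] by simp

lemma sym_bilinear_lincomb_left: "B (\<Sum>i\<in>I. c i *s x i) y = (\<Sum>i\<in>I. c i * B (x i) y)"
  by (induction I rule: infinite_finite_induct)
     (simp_all add: sym_bilinear_zero_left sym_bilinear_add_left sym_bilinear_scale_left)

lemma sym_bilinear_lincomb_right: "B y (\<Sum>i\<in>I. c i *s x i) = (\<Sum>i\<in>I. c i * B y (x i))"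
  by (induction I rule: infinite_finite_induct)
     (simp_all add: sym_bilinear_zero_right sym_bilinear_add_right sym_bilinear_scale_right)

lemma sym_bilinear_polarize:
  assumes "B (x + y) (x + y) = 0" "B (x - y) (x - y) = 0"
  shows "B x y = 0"
proof -
  have "B (x - y) (x - y) = B (x + - y) (x + - y)" by simp
  also have "\<dots> = B x x - 2 * B x y + B y y"
    by (simp only: sym_bilinear_add_left sym_bilinear_add_right sym_bilinear_minus_left
        sym_bilinear_minus_right sym_bilinear_sym[of y x]) simp
  finally have "4 * B x y = B (x + y) (x + y) - B (x - y) (x - y)"
    by (simp only: sym_bilinear_add_left sym_bilinear_add_right sym_bilinear_sym[of y x]) simp
  then show ?thesis using assms by simp
qed

end

section \<open>Polarizing quadratic forms on the fourth exterior power\<close>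

lemma wedge_list_add: "wedge_list (xs @ (a + b) # ys) = wedge_list (xs @ a # ys) + wedge_list (xs @ b # ys)"
  by (simp add: wedge_list_append wedge_list_Cons ext_vec_add wedge_add_left wedge_add_right)

context
  fixes B :: "complex ^ ('n::{finite,linorder} set) \<Rightarrow> complex ^ ('n set) \<Rightarrow> complex"
  assumes B: "sym_bilinear B"
    and B0: "\<And>u v a b c d. B (wedge_list [u, v, a, b]) (wedge_list [u, v, c, d]) = 0"
begin

text \<open>
  Let \<open>D(x, y, z; x', y', z')\<close> be the sum that has to vanish.  Polarizing the hypothesis in its first
  vector gives \<open>D(v, a, b; v, c, d) = 0\<close>, and polarizing this in \<open>v\<close> shows that exchanging \<open>x\<close> with
  \<open>x'\<close> changes the sign of \<open>D\<close>.  As \<open>D\<close> is unchanged by a simultaneous permutation of both triples,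
  the same holds for \<open>y\<close> and \<open>z\<close>.  After three exchanges the sign is \<open>-1\<close>; but exchanging the two
  triples completely leaves \<open>D\<close> unchanged, by the symmetry of \<open>B\<close>.  So \<open>D = - D\<close>.
\<close>

lemma exchange_first:
  "B (wedge_list [u, x, y, z]) (wedge_list [u', x', y', z']) =
   - B (wedge_list [u', x, y, z]) (wedge_list [u, x', y', z'])"
proof -
  have wl1: "wedge_list [a + b, x, y, z] = wedge_list [a, x, y, z] + wedge_list [b, x, y, z]"
    for a b x y z :: "(complex, 'n) vec"
    using wedge_list_add[of "[]" a b "[x, y, z]"] by simp
  have wl2: "wedge_list [x, a + b, y, z] = wedge_list [x, a, y, z] + wedge_list [x, b, y, z]"
    for a b x y z :: "(complex, 'n) vec"
    using wedge_list_add[of "[x]" a b "[y, z]"] by simp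
  define D where "D x y z x' y' z' = B (wedge_list [u, x, y, z]) (wedge_list [u', x', y', z']) +
    B (wedge_list [u', x, y, z]) (wedge_list [u, x', y', z'])" for x y z x' y' z'
  have D0: "D v a b v c d = 0" for v a b c d
  proof -
    have "0 = B (wedge_list [u + u', v, a, b]) (wedge_list [u + u', v, c, d])"
      by (simp only: B0)
    also have "\<dots> = D v a b v c d"
      by (simp only: wl1 sym_bilinear_add_left[OF B] sym_bilinear_add_right[OF B] B0 D_def) simp
    finally show ?thesis ..
  qed
  \<comment> \<open>The two terms whose first and fourth arguments coincide vanish by \<open>D0\<close>.\<close>
  have swap1: "D x y z x' y' z' = - D x' y z x y' z'" for x y z x' y' z'
  proof -
    have "0 = D (x + x') y z (x + x') y' z'" by (simp only: D0)
    also have "\<dots> = D x y z x y' z' + D x' y z x' y' z' + (D x y z x' y' z' + D x' y z x y' z')"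
      unfolding D_def
      by (simp only: wl2 sym_bilinear_add_left[OF B] sym_bilinear_add_right[OF B]) simp
    finally show ?thesis by (simp add: D0 eq_neg_iff_add_eq_0)
  qed
  have perm: "wedge_list [w, x, y, z] = - wedge_list [w, y, x, z]"
    "wedge_list [w, x, y, z] = - wedge_list [w, x, z, y]" for w x y z :: "(complex, 'n) vec"
    using wedge_list_swap[of "[w]" x y "[z]"] wedge_list_swap[of "[w, x]" y z "[]"] by simp_all
  have minus: "B (- x) (- y) = B x y" for x y
    by (simp only: sym_bilinear_minus_left[OF B] sym_bilinear_minus_right[OF B]) simp
  have rot: "D x y z x' y' z' = D y x z y' x' z'" "D x y z x' y' z' = D x z y x' z' y'" for x y z x' y' z'
    unfolding D_def
    by (subst perm(1)[of _ x y z], subst perm(1)[of _ x' y' z'], subst perm(1)[of _ x y z],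
        subst perm(1)[of _ x' y' z'], simp only: minus)
       (subst perm(2)[of _ x y z], subst perm(2)[of _ x' y' z'], subst perm(2)[of _ x y z],
        subst perm(2)[of _ x' y' z'], simp only: minus)
  have swap2: "D x y z x' y' z' = - D x y' z x' y z'" for x y z x' y' z'
    using rot(1)[of x y z x' y' z'] swap1[of y x z y' x' z'] rot(1)[of y' x z y x' z'] by simp
  have swap3: "D x y z x' y' z' = - D x y z' x' y' z" for x y z x' y' z'
    using rot(2)[of x y z x' y' z'] swap2[of x z y x' z' y'] rot(2)[of x z' y x' z y'] by simp
  have "D x y z x' y' z' = - D x' y' z' x y z"
    using swap1[of x y z x' y' z'] swap2[of x' y z x y' z'] swap3[of x' y' z x y z'] by simp
  also have "D x' y' z' x y z = D x y z x' y' z'"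
    unfolding D_def using sym_bilinear_sym[OF B] by (simp add: add.commute)
  finally have "D x y z x' y' z' = 0" by (rule eq_uminus_zero)
  then show ?thesis unfolding D_def by (simp add: eq_neg_iff_add_eq_0)
qed

text \<open>
  Inside either half this is the antisymmetry of the wedge product; across the middle it is
  \<open>exchange_first\<close>, after the fourth vector has been moved to the front.
\<close>

lemma alternating_pairing:
  "alternating 8 (\<lambda>l. B (wedge_list (take 4 l)) (wedge_list (drop 4 l)))"
  unfolding alternating_def
proof (intro allI impI)
  fix xs ys :: "(complex, 'n) vec list" and a b
  let ?P = "\<lambda>l. B (wedge_list (take 4 l)) (wedge_list (drop 4 l))"
  assume len: "length (xs @ a # b # ys) = 8"
  consider "length xs \<le> 2" | "length xs = 3" | "length xs \<ge> 4" by linarith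
  then show "?P (xs @ a # b # ys) = - ?P (xs @ b # a # ys)"
  proof cases
    case 1
    define us where "us = take (2 - length xs) ys"
    define vs where "vs = drop (2 - length xs) ys"
    have *: "take 4 (xs @ p # q # ys) = xs @ p # q # us" "drop 4 (xs @ p # q # ys) = vs" for p q
      using 1 by (auto simp: us_def vs_def take_Cons' drop_Cons' numeral_eq_Suc)
    show ?thesis
      unfolding * by (subst wedge_list_swap) (simp only: sym_bilinear_minus_left[OF B])
  next
    case 2
    obtain x y z where xs: "xs = [x, y, z]"
      using 2 by (auto simp: length_Suc_conv numeral_eq_Suc)
    obtain x' y' z' where ys: "ys = [x', y', z']"
      using len 2 by (auto simp: length_Suc_conv numeral_eq_Suc)
    have front: "wedge_list [x, y, z, p] = - wedge_list [p, x, y, z]" for p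
      using wedge_list_swap[of "[x, y]" z p "[]"] wedge_list_swap[of "[x]" y p "[z]"]
        wedge_list_swap[of "[]" x p "[y, z]"] by simp
    have "?P (xs @ a # b # ys) = B (wedge_list [x, y, z, a]) (wedge_list [b, x', y', z'])"
      by (simp add: xs ys)
    also have "\<dots> = - B (wedge_list [x, y, z, b]) (wedge_list [a, x', y', z'])"
      unfolding front sym_bilinear_minus_left[OF B]
      by (subst exchange_first) simp
    also have "\<dots> = - ?P (xs @ b # a # ys)"
      by (simp add: xs ys)
    finally show ?thesis .
  next
    case 3
    define us where "us = drop 4 xs"
    have *: "take 4 (xs @ p # q # ys) = take 4 xs" "drop 4 (xs @ p # q # ys) = us @ p # q # ys" for p q
      using 3 by (auto simp: us_def)
    show ?thesis
      unfolding * by (subst wedge_list_swap) (simp only: sym_bilinear_minus_right[OF B])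
  qed
qed

text \<open>
  An alternating function of eight vectors is determined by its values on increasing lists of basis
  vectors, so it is \<open>\<phi>\<close> of their wedge product for a linear functional \<open>\<phi>\<close>.  Hence
  \<open>B x x = \<phi> (x \<and> x)\<close>.
\<close>

lemma bilinear_vanishes_on_square_zero:
  assumes x: "x \<in> ext_power 4" and sq: "x \<and>\<^sub>E x = 0"
  shows "B x x = 0"
proof -
  define ax :: "'n list \<Rightarrow> (complex, 'n) vec list" where "ax = map (\<lambda>i. axis i 1)"
  define P where "P l = B (wedge_list (take 4 (ax l))) (wedge_list (drop 4 (ax l)))" for l
  define \<phi> where "\<phi> w = (\<Sum>R\<in>UNIV. w $ R * P (sorted_list_of_set R))" for w :: "complex ^ ('n set)"
  have \<phi>_axis: "\<phi> (axis R 1) = P (sorted_list_of_set R)" for R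
    by (simp add: \<phi>_def axis_def if_distrib[of "\<lambda>c. c * _"] cong: if_cong)
  have \<phi>_minus: "\<phi> (- w) = - \<phi> w" for w
    by (simp add: \<phi>_def sum_negf)
  have \<phi>_lincomb: "\<phi> (\<Sum>i\<in>I. c i *s w i) = (\<Sum>i\<in>I. c i * \<phi> (w i))" for I and c :: "'b \<Rightarrow> complex" and w
    unfolding \<phi>_def
    by (simp add: sum_distrib_left sum_distrib_right mult_ac sum.swap[of _ I])
  define H where "H l = P l - \<phi> (wedge_list (ax l))" for l
  have "alternating 8 H"
    unfolding alternating_def
  proof (intro allI impI)
    fix xs ys and a b :: 'n
    assume "length (xs @ a # b # ys) = 8"
    then have "P (xs @ a # b # ys) = - P (xs @ b # a # ys)"
      using alternatingD[OF alternating_pairing, of "ax xs" "axis a 1" "axis b 1" "ax ys"]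
      by (simp add: P_def ax_def)
    moreover have "wedge_list (ax (xs @ a # b # ys)) = - wedge_list (ax (xs @ b # a # ys))"
      using wedge_list_swap[of "ax xs" "axis a 1" "axis b 1" "ax ys"] by (simp add: ax_def)
    ultimately show "H (xs @ a # b # ys) = - H (xs @ b # a # ys)"
      unfolding H_def by (simp only: \<phi>_minus) simp
  qed
  moreover have "H l = 0" if "sorted_wrt (<) l" for l
  proof -
    have "sorted_list_of_set (set l) = l"
      using that by (simp add: strict_sorted_iff sorted_list_of_set.idem_if_sorted_distinct)
    then show ?thesis
      using that by (simp add: H_def ax_def wedge_list_sorted_axes \<phi>_axis)
  qed
  ultimately have H: "H l = 0" if "length l = 8" for l
    using alternating_zero that by blast
  have basis: "B (axis S 1) (axis T 1) = \<phi> (axis S 1 \<and>\<^sub>E axis T 1)" if "card S = 4" "card T = 4" for S T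
  proof -
    let ?l = "sorted_list_of_set S @ sorted_list_of_set T"
    have "B (axis S 1) (axis T 1) = P ?l"
      using that by (simp add: P_def ax_def basis_list_def[symmetric] wedge_list_basis_list)
    also have "\<dots> = \<phi> (wedge_list (ax ?l))"
      using H[of ?l] that by (simp add: H_def)
    also have "wedge_list (ax ?l) = axis S 1 \<and>\<^sub>E axis T 1"
      by (simp add: ax_def wedge_list_append basis_list_def[symmetric] wedge_list_basis_list)
    finally show ?thesis .
  qed
  let ?e = "\<lambda>S. axis S 1 :: complex ^ ('n set)"
  have "B x x = B (\<Sum>S\<in>UNIV. x $ S *s ?e S) (\<Sum>T\<in>UNIV. x $ T *s ?e T)"
    by (simp only: basis_expansion)
  also have "\<dots> = (\<Sum>S\<in>UNIV. x $ S * (\<Sum>T\<in>UNIV. x $ T * B (?e S) (?e T)))"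
    by (subst sym_bilinear_lincomb_left[OF B]) (simp only: sym_bilinear_lincomb_right[OF B])
  also have "\<dots> = (\<Sum>S\<in>UNIV. x $ S * (\<Sum>T\<in>UNIV. x $ T * \<phi> (?e S \<and>\<^sub>E ?e T)))"
  proof (rule sum.cong[OF refl])
    fix S :: "'n set"
    show "x $ S * (\<Sum>T\<in>UNIV. x $ T * B (?e S) (?e T)) =
        x $ S * (\<Sum>T\<in>UNIV. x $ T * \<phi> (?e S \<and>\<^sub>E ?e T))"
    proof (cases "x $ S = 0")
      case False
      then have S: "card S = 4" using x by (simp add: ext_power_def)
      have "x $ T * B (?e S) (?e T) = x $ T * \<phi> (?e S \<and>\<^sub>E ?e T)" for T
        using x basis[OF S, of T] by (cases "x $ T = 0") (auto simp: ext_power_def)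
      then show ?thesis by (simp only:)
    qed simp
  qed
  also have "\<dots> = \<phi> (\<Sum>S\<in>UNIV. x $ S *s (\<Sum>T\<in>UNIV. x $ T *s (?e S \<and>\<^sub>E ?e T)))"
    by (simp only: \<phi>_lincomb)
  also have "(\<Sum>S\<in>UNIV. x $ S *s (\<Sum>T\<in>UNIV. x $ T *s (?e S \<and>\<^sub>E ?e T))) = x \<and>\<^sub>E x"
    by (simp only: wedge_lincomb_left[symmetric] wedge_lincomb_right[symmetric] basis_expansion)
  finally show ?thesis using sq by (simp add: \<phi>_def)
qed

end

section \<open>From invertible to arbitrary matrices\<close>

lemma continuous_on_scale_vec [continuous_intros]:
  fixes g :: "'a::topological_space \<Rightarrow> complex ^ 'i"
  assumes "continuous_on S f" "continuous_on S g"
  shows "continuous_on S (\<lambda>t. f t *s g t)"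
  unfolding vector_scalar_mult_def by (intro continuous_intros assms)

lemma continuous_on_wedge:
  fixes f g :: "'a::topological_space \<Rightarrow> complex ^ ('n::{finite,linorder} set)"
  assumes "continuous_on S f" "continuous_on S g"
  shows "continuous_on S (\<lambda>t. f t \<and>\<^sub>E g t)"
  unfolding wedge_def by (intro continuous_intros assms)

lemma continuous_on_wedge_list:
  fixes gs :: "('a::topological_space \<Rightarrow> complex ^ 'n::{finite,linorder}) list"
  assumes "\<And>g. g \<in> set gs \<Longrightarrow> continuous_on S g"
  shows "continuous_on S (\<lambda>t. wedge_list (map (\<lambda>g. g t) gs))"
  using assms
proof (induction gs)
  case (Cons g gs)
  have "continuous_on S (\<lambda>t. ext_vec (g t))"
    unfolding ext_vec_def using Cons.prems by (intro continuous_intros) auto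
  with Cons show ?case by (simp add: wedge_list_Cons continuous_on_wedge)
qed simp

lemma continuous_on_homogeneous_form:
  assumes "homogeneous_form d f"
  shows "continuous_on UNIV f"
proof -
  obtain c where "f = (\<lambda>x. \<Sum>a | (\<Sum>i\<in>UNIV. a i) = d. c a * (\<Prod>i\<in>UNIV. (x $ i) ^ a i))"
    using assms unfolding homogeneous_form_def by blast
  then show ?thesis by (simp) (intro continuous_intros)
qed

lemma matrix_vector_mult_axis: "A *v axis j 1 = column j A"
  by (simp add: matrix_vector_mult_def column_def vec_eq_iff axis_def if_distrib cong: if_cong)

text \<open>
  On the line from \<open>A\<close> to the identity the determinant is a polynomial with value 1 at the identity,
  so all but finitely many matrices on the line are invertible, and \<open>h A\<close> is a limit of zeros.
\<close>

lemma generic_matrix_limit: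
  fixes h :: "complex ^ 'n ^ 'n \<Rightarrow> complex"
  assumes cont: "\<And>N :: complex \<Rightarrow> complex ^ 'n ^ 'n. continuous_on UNIV N \<Longrightarrow> continuous_on UNIV (\<lambda>t. h (N t))"
    and zero: "\<And>A. det A \<noteq> 0 \<Longrightarrow> h A = 0"
  shows "h A = 0"
proof -
  define N where "N t = (\<chi> i j. A $ i $ j + t * (mat 1 $ i $ j - A $ i $ j))" for t :: complex
  define q where "q = (\<Sum>p | p permutes (UNIV :: 'n set). smult (of_int (sign p))
    (\<Prod>i\<in>UNIV. [: A $ i $ p i, mat 1 $ i $ p i - A $ i $ p i :]))"
  have q: "det (N t) = poly q t" for t
    by (simp add: det_def q_def N_def poly_sum poly_prod)
  have "N 1 = mat 1" by (simp add: N_def vec_eq_iff)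
  then have "poly q 1 \<noteq> 0" using q[of 1] by simp
  then have "q \<noteq> 0" by auto
  then have "finite {t. poly q t = 0}" by (rule poly_roots_finite)
  then have "closed ({t. poly q t = 0} - {0})" by (intro finite_imp_closed finite_Diff)
  then have op: "open (- ({t. poly q t = 0} - {0}))" by (rule open_Compl)
  have "h (N t) = 0" if "t \<in> - ({t. poly q t = 0} - {0})" "t \<noteq> 0" for t
    using that zero[of "N t"] q[of t] by auto
  then have "eventually (\<lambda>t. h (N t) = 0) (at 0)"
    unfolding eventually_at_topological
    by (intro exI[of _ "- ({t. poly q t = 0} - {0})"]) (use op in auto)
  then have lim0: "((\<lambda>t. h (N t)) \<longlongrightarrow> 0) (at 0)" by (rule tendsto_eventually)
  have "continuous_on UNIV N"
    unfolding N_def by (intro continuous_intros)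
  then have "continuous_on UNIV (\<lambda>t. h (N t))" by (rule cont)
  then have "((\<lambda>t. h (N t)) \<longlongrightarrow> h (N 0)) (at 0)"
    by (simp add: continuous_on_def)
  with lim0 have "h (N 0) = 0"
    by (rule tendsto_unique[OF at_neq_bot, symmetric])
  moreover have "N 0 = A" by (simp add: N_def vec_eq_iff)
  ultimately show ?thesis by simp
qed

text \<open>
  The six vectors are the images of six basis vectors under a matrix.  The lemma removes the
  assumption that they are linearly independent, under which the points are visibly tangent vectors
  and points of chords.
\<close>

lemma form_vanishes_on_split_bivectors:
  fixes p :: "nat \<Rightarrow> 'n::{finite,linorder}"
  assumes f: "homogeneous_form 2 f" and p: "inj_on p {..<6}"
    and gen: "\<And>A. det A \<noteq> 0 \<Longrightarrow>
      f (wedge_list (map (\<lambda>k. A *v axis (p k) 1) [0, 1, 2, 3]) +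
         wedge_list (map (\<lambda>k. A *v axis (p k) 1) [0, 1, 4, 5])) = 0"
  shows "f (wedge_list [u, v, a, b] + wedge_list [u, v, c, d]) = 0"
proof -
  let ?h = "\<lambda>A. f (wedge_list (map (\<lambda>k. A *v axis (p k) 1) [0, 1, 2, 3]) +
         wedge_list (map (\<lambda>k. A *v axis (p k) 1) [0, 1, 4, 5]))"
  have "continuous_on UNIV (\<lambda>t. ?h (N t))"
    if N: "continuous_on UNIV N" for N :: "complex \<Rightarrow> ((complex, 'n) vec, 'n) vec"
  proof (rule continuous_on_compose2[OF continuous_on_homogeneous_form[OF f]])
    have col: "continuous_on UNIV (\<lambda>t. N t *v axis (p k) 1)" for k
      unfolding matrix_vector_mult_def by (intro continuous_intros N)
    have "continuous_on UNIV (\<lambda>t. wedge_list (map (\<lambda>g. g t) (map (\<lambda>k t. N t *v axis (p k) 1) ks)))" for ks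
      by (rule continuous_on_wedge_list) (use col in auto)
    then have "continuous_on UNIV (\<lambda>t. wedge_list (map (\<lambda>k. N t *v axis (p k) 1) ks))" for ks
      by (simp add: comp_def)
    then show "continuous_on UNIV (\<lambda>t. wedge_list (map (\<lambda>k. N t *v axis (p k) 1) [0, 1, 2, 3]) +
         wedge_list (map (\<lambda>k. N t *v axis (p k) 1) [0, 1, 4, 5]))"
      by (intro continuous_intros)
  qed auto
  then have all: "?h A = 0" for A
    using gen by (rule generic_matrix_limit)
  define w where "w j = [u, v, a, b, c, d] ! (inv_into {..<6} p j)" for j
  \<comment> \<open>The columns at the indices \<open>p 0, \<dots>, p 5\<close> are the six given vectors.\<close>
  define A where "A = (\<chi> i j. w j $ i)"
  have "A *v axis (p k) 1 = [u, v, a, b, c, d] ! k" if "k < 6" for k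
    using that p by (simp add: matrix_vector_mult_axis column_def A_def w_def vec_lambda_eta)
  then show ?thesis using all[of A] by (simp add: numeral_eq_Suc)
qed

section \<open>Quadratic hulls\<close>

lemma homogeneous_form_square:
  "homogeneous_form 2 (\<lambda>w :: complex ^ ('n::{finite,linorder} set). (w \<and>\<^sub>E w) $ R)"
proof -
  have "homogeneous_form (1 + 1) (\<lambda>w :: complex ^ ('n set). w $ T * w $ (R - T))" for T
    by (intro homogeneous_form_mult homogeneous_form_coord)
  then have "homogeneous_form 2 (\<lambda>w :: complex ^ ('n set). \<Sum>T\<in>Pow R. shuffle_sign T (R - T) * (w $ T * w $ (R - T)))"
    by (intro homogeneous_form_sum homogeneous_form_scale) (simp add: numeral_2_eq_2)
  then show ?thesis by (simp add: wedge_def mult.assoc)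
qed

lemma proj_point_eq: "proj_point w = range (\<lambda>c. c *s w)"
  by (simp add: proj_point_def vec.span_singleton)

lemma mem_proj_point: "w \<in> proj_point w"
  by (simp add: proj_point_def vec.span_base)

lemma form_zero_on_point:
  assumes "homogeneous_form d f" "f w = 0" "x \<in> proj_point w" "d \<noteq> 0"
  shows "f x = 0"
  using assms homogeneous_form_scale_arg[OF assms(1)] by (auto simp: proj_point_eq)

definition square_zero :: "(complex ^ ('n::{finite,linorder} set)) set set" where
  "square_zero = {proj_point \<omega> | \<omega>. \<omega> \<in> ext_power 4 \<and> \<omega> \<noteq> 0 \<and> \<omega> \<and>\<^sub>E \<omega> = 0}"

text \<open>
  The last hypothesis holds in particular if the points \<open>u \<and> v \<and> (a \<and> b + c \<and> d)\<close> with linearly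
  independent vectors belong to \<open>Y\<close>.  Replacing \<open>c\<close> by \<open>-c\<close> isolates the value of the polar form on
  \<open>u \<and> v \<and> a \<and> b\<close> and \<open>u \<and> v \<and> c \<and> d\<close>.
\<close>

lemma quadratic_hull_eq_square_zero:
  fixes Y :: "(complex ^ ('n::{finite,linorder} set)) set set" and p :: "nat \<Rightarrow> 'n"
  assumes sq: "\<And>y x. y \<in> Y \<Longrightarrow> x \<in> y \<Longrightarrow> x \<and>\<^sub>E x = 0"
    and p: "inj_on p {..<6}"
    and gen: "\<And>f A. f \<in> vanishing_forms 2 Y \<Longrightarrow> det A \<noteq> 0 \<Longrightarrow>
      f (wedge_list (map (\<lambda>k. A *v axis (p k) 1) [0, 1, 2, 3]) +
         wedge_list (map (\<lambda>k. A *v axis (p k) 1) [0, 1, 4, 5])) = 0"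
  shows "quadratic_hull (ext_power 4) Y = square_zero"
proof (intro set_eqI iffI)
  fix y assume "y \<in> quadratic_hull (ext_power 4) Y"
  then obtain w where w: "y = proj_point w" "w \<in> ext_power 4" "w \<noteq> 0"
    and van: "\<And>f. f \<in> vanishing_forms 2 Y \<Longrightarrow> f w = 0"
    unfolding quadratic_hull_def zero_locus_def proj_def using mem_proj_point by blast
  have "(\<lambda>w. (w \<and>\<^sub>E w) $ R) \<in> vanishing_forms 2 Y" for R
    unfolding vanishing_forms_def using sq homogeneous_form_square by auto
  from van[OF this] have "w \<and>\<^sub>E w = 0" by (simp add: vec_eq_iff)
  with w show "y \<in> square_zero" unfolding square_zero_def by blast
next
  fix y :: "(complex ^ ('n set)) set" assume "y \<in> square_zero"
  then obtain w where w: "y = proj_point w" "w \<in> ext_power 4" "w \<noteq> 0" "w \<and>\<^sub>E w = 0"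
    unfolding square_zero_def by blast
  have "f w = 0" if f: "f \<in> vanishing_forms 2 Y" for f
  proof -
    have hf: "homogeneous_form 2 f" using f by (simp add: vanishing_forms_def)
    obtain B where B: "sym_bilinear B" "\<And>x. f x = B x x"
      using quadratic_form_bilinear[OF hf] by blast
    have split: "f (wedge_list [u, v, a, b] + wedge_list [u, v, c, d]) = 0" for u v a b c d
      using form_vanishes_on_split_bivectors[OF hf p] gen[OF f] by blast
    have "B (wedge_list [u, v, a, b]) (wedge_list [u, v, c, d]) = 0" for u v a b c d
    proof (rule sym_bilinear_polarize[OF B(1)])
      show "B (wedge_list [u, v, a, b] + wedge_list [u, v, c, d])
          (wedge_list [u, v, a, b] + wedge_list [u, v, c, d]) = 0"
        using split by (simp add: B(2))
      have "wedge_list [u, v, - 1 *s c, d] = - wedge_list [u, v, c, d]"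
        by (simp only: wedge_list_Cons ext_vec_scale wedge_scale_left wedge_scale_right) simp
      then show "B (wedge_list [u, v, a, b] - wedge_list [u, v, c, d])
          (wedge_list [u, v, a, b] - wedge_list [u, v, c, d]) = 0"
        using split[of u v a b "- 1 *s c" d] by (simp add: B(2)[symmetric])
    qed
    then show ?thesis
      using bilinear_vanishes_on_square_zero[OF B(1) _ w(2,4)] B(2) by simp
  qed
  then have "f x = 0" if "f \<in> vanishing_forms 2 Y" "x \<in> y" for f x
    using that form_zero_on_point[of 2 f w x] w(1) by (simp add: vanishing_forms_def)
  then show "y \<in> quadratic_hull (ext_power 4) Y"
    unfolding quadratic_hull_def zero_locus_def proj_def using w by blast
qed

lemma form_vanishes_on_closure:
  assumes "homogeneous_form d f" "\<And>y x. y \<in> Y \<Longrightarrow> x \<in> y \<Longrightarrow> f x = 0"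
    and "y \<in> zariski_closure W Y" "x \<in> y"
  shows "f x = 0"
  using assms unfolding zariski_closure_def zero_locus_def vanishing_forms_def by blast

lemma mem_zariski_closure:
  assumes "y \<in> Y" "y \<in> proj W"
  shows "y \<in> zariski_closure W Y"
  using assms unfolding zariski_closure_def zero_locus_def vanishing_forms_def by blast

section \<open>Splitting off a basis vector\<close>

definition free_of :: "'n \<Rightarrow> complex ^ ('n::{finite,linorder} set) \<Rightarrow> bool" where
  "free_of s x \<longleftrightarrow> (\<forall>S. s \<in> S \<longrightarrow> x $ S = 0)"

lemma free_of_zero [simp]: "free_of s 0"
  by (simp add: free_of_def)

lemma free_of_add: "free_of s x \<Longrightarrow> free_of s y \<Longrightarrow> free_of s (x + y)"
  by (simp add: free_of_def)

lemma free_of_diff: "free_of s x \<Longrightarrow> free_of s y \<Longrightarrow> free_of s (x - y)"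
  by (simp add: free_of_def)

lemma free_of_scale: "free_of s x \<Longrightarrow> free_of s (c *s x)"
  by (simp add: free_of_def)

lemma free_of_wedge:
  assumes "free_of s x" "free_of s y"
  shows "free_of s (x \<and>\<^sub>E y)"
  unfolding free_of_def
proof (intro allI impI)
  fix S assume "s \<in> S"
  have "x $ T = 0 \<or> y $ (S - T) = 0" if "T \<subseteq> S" for T
    using assms \<open>s \<in> S\<close> unfolding free_of_def by (cases "s \<in> T") auto
  then show "(x \<and>\<^sub>E y) $ S = 0"
    unfolding wedge_def vec_lambda_beta by (intro sum.neutral) auto
qed

lemma wedge_single_left:
  "(axis {s} 1 \<and>\<^sub>E a) $ S = (if s \<in> S then shuffle_sign {s} (S - {s}) * a $ (S - {s}) else 0)"
  by (simp add: wedge_axis_left)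

lemma split_unique:
  assumes "axis {s} 1 \<and>\<^sub>E a + b = 0" "free_of s a" "free_of s b"
  shows "a = 0" "b = 0"
proof -
  have "b $ S = 0" for S
  proof (cases "s \<in> S")
    case False
    then have "(axis {s} 1 \<and>\<^sub>E a + b) $ S = b $ S" by (simp add: wedge_single_left)
    then show ?thesis by (simp add: assms(1))
  qed (use assms(3) in \<open>simp add: free_of_def\<close>)
  then show "b = 0" by (simp add: vec_eq_iff)
  have "a $ S = 0" for S
  proof (cases "s \<in> S")
    case False
    have "(axis {s} 1 \<and>\<^sub>E a + b) $ insert s S = shuffle_sign {s} S * a $ S"
      using False \<open>b = 0\<close> by (simp add: wedge_single_left)
    then show ?thesis by (simp add: assms(1) shuffle_sign_nonzero)
  qed (use assms(2) in \<open>simp add: free_of_def\<close>)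
  then show "a = 0" by (simp add: vec_eq_iff)
qed

text \<open>
  Together with \<open>restrict_free\<close> this gives the two parts of \<open>x = e\<^sub>s \<and> x' + x''\<close>.  The sign is that of
  moving \<open>e\<^sub>s\<close> from the front into its place, so \<open>s\<close> can be any index.
\<close>

definition contract :: "'n \<Rightarrow> complex ^ ('n::{finite,linorder} set) \<Rightarrow> complex ^ ('n set)" where
  "contract s x = (\<chi> S. if s \<in> S then 0 else shuffle_sign {s} S * x $ insert s S)"

definition restrict_free :: "'n \<Rightarrow> complex ^ ('n::{finite,linorder} set) \<Rightarrow> complex ^ ('n set)" where
  "restrict_free s x = (\<chi> S. if s \<in> S then 0 else x $ S)"

lemma shuffle_sign_square: "shuffle_sign T U * shuffle_sign T U = 1"
  by (simp add: shuffle_sign_def flip: power_mult_distrib)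

lemma split_decomposition: "x = axis {s} 1 \<and>\<^sub>E contract s x + restrict_free s x"
proof -
  have "x $ S = (axis {s} 1 \<and>\<^sub>E contract s x + restrict_free s x) $ S" for S
    by (cases "s \<in> S")
       (simp_all add: wedge_single_left contract_def restrict_free_def insert_absorb
         shuffle_sign_square flip: mult.assoc)
  then show ?thesis unfolding vec_eq_iff by blast
qed

lemma free_of_contract: "free_of s (contract s x)"
  by (simp add: free_of_def contract_def)

lemma free_of_restrict_free: "free_of s (restrict_free s x)"
  by (simp add: free_of_def restrict_free_def)

lemma ext_power_contract:
  assumes "x \<in> ext_power (Suc k)"
  shows "contract s x \<in> ext_power k"
  using assms by (auto simp: ext_power_def contract_def split: if_splits)

lemma ext_power_restrict_free: "x \<in> ext_power k \<Longrightarrow> restrict_free s x \<in> ext_power k"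
  by (auto simp: ext_power_def restrict_free_def split: if_splits)

lemma split_vector:
  obtains u where "ext_vec v = v $ s *s axis {s} 1 + ext_vec u" "free_of s (ext_vec u)"
proof
  let ?u = "\<chi> i. if i = s then 0 else v $ i"
  have "v = v $ s *s axis s 1 + ?u"
    by (simp add: vec_eq_iff axis_def)
  then have "ext_vec v = ext_vec (v $ s *s axis s 1 + ?u)" by (rule arg_cong)
  then show "ext_vec v = v $ s *s axis {s} 1 + ext_vec ?u"
    by (simp only: ext_vec_add ext_vec_scale ext_vec_axis)
  show "free_of s (ext_vec ?u)"
    unfolding free_of_def ext_vec_nth by (auto simp: card_1_singleton_iff)
qed

lemma swap_past_single:
  "ext_vec u \<and>\<^sub>E (axis {s} 1 \<and>\<^sub>E x) = - (axis {s} 1 \<and>\<^sub>E (ext_vec u \<and>\<^sub>E x))"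
  using ext_vec_swap[of u "axis s 1"]
  by (simp add: ext_vec_axis wedge_minus_left flip: wedge_assoc)

text \<open>
  If \<open>v = c e\<^sub>s + u\<close> with \<open>c \<noteq> 0\<close> and \<open>x = e\<^sub>s \<and> a + b\<close>, then the part of \<open>v \<and> x\<close> that contains \<open>e\<^sub>s\<close> is
  \<open>e\<^sub>s \<and> (c b - u \<and> a)\<close>.  So \<open>c b = u \<and> a\<close> and \<open>c x = v \<and> a\<close>.
\<close>

lemma annihilated_divisible:
  assumes "v \<noteq> 0" "ext_vec v \<and>\<^sub>E x = 0"
  shows "\<exists>g. x = ext_vec v \<and>\<^sub>E g"
proof -
  obtain s where s: "v $ s \<noteq> 0" using assms(1) by (auto simp: vec_eq_iff)
  let ?e = "axis {s} 1 :: complex ^ ('a set)"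
  let ?a = "contract s x" and ?b = "restrict_free s x"
  obtain u where u: "ext_vec v = v $ s *s ?e + ext_vec u" "free_of s (ext_vec u)"
    by (rule split_vector)
  have sq: "?e \<and>\<^sub>E (?e \<and>\<^sub>E y) = 0" for y
    using ext_vec_square_wedge[of "axis s 1"] by (simp add: ext_vec_axis)
  have "ext_vec v \<and>\<^sub>E x = ext_vec v \<and>\<^sub>E (?e \<and>\<^sub>E ?a + ?b)"
    by (subst split_decomposition[of x s]) (rule refl)
  also have "\<dots> = ?e \<and>\<^sub>E (v $ s *s ?b - ext_vec u \<and>\<^sub>E ?a) + ext_vec u \<and>\<^sub>E ?b"
    by (simp only: u(1) wedge_add_left wedge_add_right wedge_diff_right wedge_scale_left
        wedge_scale_right sq swap_past_single) simp
  finally have "?e \<and>\<^sub>E (v $ s *s ?b - ext_vec u \<and>\<^sub>E ?a) + ext_vec u \<and>\<^sub>E ?b = 0"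
    by (simp only: assms(2))
  from split_unique(1)[OF this] have b: "v $ s *s ?b = ext_vec u \<and>\<^sub>E ?a"
    using u(2) by (simp add: free_of_diff free_of_scale free_of_wedge free_of_contract free_of_restrict_free)
  have "v $ s *s x = v $ s *s (?e \<and>\<^sub>E ?a + ?b)"
    by (subst split_decomposition[of x s]) (rule refl)
  also have "\<dots> = ext_vec v \<and>\<^sub>E ?a"
    by (simp only: vec.scale_right_distrib b u(1) wedge_add_left wedge_scale_left)
  finally have "x = ext_vec v \<and>\<^sub>E (inverse (v $ s) *s ?a)"
    using s by (metis wedge_scale_right vec.scale_scale left_inverse vec.scale_one)
  then show ?thesis by blast
qed

lemma annihilated_square_zero:
  assumes "v \<noteq> 0" "ext_vec v \<and>\<^sub>E x = 0" "x \<in> ext_power k"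
  shows "x \<and>\<^sub>E x = 0"
proof -
  obtain g where g: "x = ext_vec v \<and>\<^sub>E g" using annihilated_divisible assms by blast
  have "x \<and>\<^sub>E ext_vec v = 0"
    using wedge_commute_graded[OF assms(3) ext_vec_ext_power, of v] assms(2) by simp
  then have "(x \<and>\<^sub>E ext_vec v) \<and>\<^sub>E g = 0" by simp
  then show ?thesis using g by (metis wedge_assoc)
qed

section \<open>The tangential variety\<close>

lemma ext_map_lincomb: "ext_map A (\<Sum>i\<in>I. c i *s x i) = (\<Sum>i\<in>I. c i *s ext_map A (x i))"
  unfolding ext_map_def
  by (simp add: vec.scale_sum_left vec.scale_sum_right sum.swap[of _ I])

lemma ext_map_scale: "ext_map A (c *s x) = c *s ext_map A x"
  by (simp add: ext_map_def vec.scale_sum_right)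

lemma ext_map_add: "ext_map A (x + y) = ext_map A x + ext_map A y"
  by (simp add: ext_map_def vec.scale_left_distrib sum.distrib)

lemma ext_map_minus: "ext_map A (- x) = - ext_map A x"
  using ext_map_scale[of A "-1" x] by simp

lemma ext_map_sum: "ext_map A (\<Sum>i\<in>I. x i) = (\<Sum>i\<in>I. ext_map A (x i))"
  using ext_map_lincomb[of A "\<lambda>_. 1" x I] by simp

lemma sum_axis: "(\<Sum>S\<in>UNIV. axis T (1::complex) $ S *s f S) = f T"
  by (simp add: axis_def if_distrib[of "\<lambda>c. c *s _"] cong: if_cong)

lemma ext_map_axis: "ext_map A (axis S 1) = wedge_list (map ((*v) A) (basis_list S))"
  unfolding ext_map_def by (rule sum_axis)

text \<open>
  Both sides are alternating in \<open>l\<close>, and on increasing lists this is the definition of \<open>ext_map\<close>.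
\<close>

lemma ext_map_wedge_list_axes:
  fixes l :: "'n::{finite,linorder} list"
  shows "ext_map A (wedge_list (map (\<lambda>i. axis i 1) l)) = wedge_list (map (\<lambda>i. A *v axis i 1) l)"
proof -
  define H where "H l = ext_map A (wedge_list (map (\<lambda>i. axis i 1) l)) -
    wedge_list (map (\<lambda>i. A *v axis i 1) l)" for l :: "'n list"
  have "alternating (length l) H"
    unfolding alternating_def
  proof (intro allI impI)
    fix xs ys and a b :: 'n
    show "H (xs @ a # b # ys) = - H (xs @ b # a # ys)"
      unfolding H_def map_append list.map
      by (subst wedge_list_swap, subst (2) wedge_list_swap) (simp add: ext_map_minus)
  qed
  moreover have "H l = 0" if "sorted_wrt (<) l" for l
  proof -
    have "sorted_list_of_set (set l) = l"
      using that by (simp add: strict_sorted_iff sorted_list_of_set.idem_if_sorted_distinct)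
    then show ?thesis
      using that by (simp add: H_def wedge_list_sorted_axes ext_map_axis basis_list_def comp_def)
  qed
  ultimately have "H l = 0" using alternating_zero by blast
  then show ?thesis by (simp add: H_def)
qed

lemma ext_map_wedge_list_update:
  fixes l :: "'n::{finite,linorder} list"
  assumes "j < length l"
  shows "ext_map A (wedge_list ((map (\<lambda>i. axis i 1) l)[j := w])) =
    wedge_list ((map (\<lambda>i. A *v axis i 1) l)[j := A *v w])"
proof -
  have w: "w = (\<Sum>i\<in>UNIV. w $ i *s axis i 1)" by (simp add: basis_expansion)
  have "wedge_list ((map (\<lambda>i. axis i 1) l)[j := w]) =
      (\<Sum>i\<in>UNIV. w $ i *s wedge_list (map (\<lambda>i. axis i 1) (l[j := i])))"
    using assms by (subst w) (simp only: wedge_list_lincomb length_map map_update)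
  moreover have "A *v w = (\<Sum>i\<in>UNIV. w $ i *s (A *v axis i 1))"
    by (subst w) (simp only: vec.linear_sum[OF matrix_vector_mul_linear_gen] vector_scalar_commute)
  then have "wedge_list ((map (\<lambda>i. A *v axis i 1) l)[j := A *v w]) =
      (\<Sum>i\<in>UNIV. w $ i *s wedge_list (map (\<lambda>i. A *v axis i 1) (l[j := i])))"
    using assms by (simp only: wedge_list_lincomb length_map map_update)
  ultimately show ?thesis by (simp only: ext_map_lincomb ext_map_wedge_list_axes)
qed

text \<open>
  The tangent space to the cone over the Grassmannian at the wedge product of \<open>vs\<close>.
\<close>

definition tangent_vectors :: "(complex ^ 'n::{finite,linorder}) list \<Rightarrow> (complex ^ ('n set)) set" where
  "tangent_vectors vs = {\<Sum>j<length vs. wedge_list (vs[j := w j]) | w. True}"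

lemma wedge_list_update:
  assumes "j < length vs"
  shows "wedge_list (vs[j := w]) = wedge_list (take j vs) \<and>\<^sub>E ext_vec w \<and>\<^sub>E wedge_list (drop (Suc j) vs)"
  using assms by (simp add: upd_conv_take_nth_drop wedge_list_append wedge_list_Cons)

lemma wedge_list_update_scale:
  assumes "j < length vs"
  shows "wedge_list (vs[j := c *s w]) = c *s wedge_list (vs[j := w])"
  using assms by (simp add: wedge_list_update ext_vec_scale wedge_scale_left wedge_scale_right)

lemma tangent_vectors_subspace: "vec.subspace (tangent_vectors vs)"
proof (rule vec.subspaceI)
  have "(\<Sum>j<length vs. wedge_list (vs[j := 0])) = 0"
    by (intro sum.neutral) (simp add: wedge_list_update)
  then show "0 \<in> tangent_vectors vs"
    unfolding tangent_vectors_def by (auto intro!: exI[of _ "\<lambda>_. 0"])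
next
  fix x y assume "x \<in> tangent_vectors vs" "y \<in> tangent_vectors vs"
  then obtain w w' where "x = (\<Sum>j<length vs. wedge_list (vs[j := w j]))"
    "y = (\<Sum>j<length vs. wedge_list (vs[j := w' j]))"
    unfolding tangent_vectors_def by blast
  then have "x + y = (\<Sum>j<length vs. wedge_list (vs[j := w j + w' j]))"
    by (simp add: wedge_list_update ext_vec_add wedge_add_left wedge_add_right flip: sum.distrib)
  then show "x + y \<in> tangent_vectors vs"
    unfolding tangent_vectors_def by (intro CollectI exI[of _ "\<lambda>j. w j + w' j"]) simp
next
  fix c x assume "x \<in> tangent_vectors vs"
  then obtain w where "x = (\<Sum>j<length vs. wedge_list (vs[j := w j]))"
    unfolding tangent_vectors_def by blast
  then have "c *s x = (\<Sum>j<length vs. wedge_list (vs[j := c *s w j]))"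
    by (simp add: wedge_list_update ext_vec_scale wedge_scale_left wedge_scale_right vec.scale_sum_right)
  then show "c *s x \<in> tangent_vectors vs"
    unfolding tangent_vectors_def by (intro CollectI exI[of _ "\<lambda>j. c *s w j"]) simp
qed

lemma wedge_list_tangent:
  assumes "vs \<noteq> []"
  shows "wedge_list vs \<in> tangent_vectors vs"
proof -
  have "wedge_list (vs[j := if j = 0 then vs ! 0 else 0]) = (if j = 0 then wedge_list vs else 0)"
    if "j < length vs" for j
    using that by (auto simp: wedge_list_update[of j vs 0])
  then have "(\<Sum>j<length vs. wedge_list (vs[j := if j = 0 then vs ! 0 else 0])) = wedge_list vs"
    using assms by (simp add: sum.delta)
  then show ?thesis
    unfolding tangent_vectors_def by (intro CollectI exI[of _ "\<lambda>j. if j = 0 then vs ! 0 else 0"]) simp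
qed

text \<open>
  Two terms replace at most two of the three or more vectors, so they share one that is kept.
\<close>

lemma tangent_vectors_square_zero:
  assumes "x \<in> tangent_vectors vs" "length vs \<ge> 3"
  shows "x \<and>\<^sub>E x = 0"
proof -
  obtain w where x: "x = (\<Sum>j<length vs. wedge_list (vs[j := w j]))"
    using assms unfolding tangent_vectors_def by blast
  have "wedge_list (vs[j := w j]) \<and>\<^sub>E wedge_list (vs[k := w k]) = 0"
    if "j < length vs" "k < length vs" for j k
  proof -
    have "\<not> {..<length vs} \<subseteq> {j, k}"
      using assms(2) card_mono[of "{j, k}" "{..<length vs}"] card_insert_le_m1[of 2 "{k}" j] by auto
    then obtain m where m: "m < length vs" "m \<noteq> j" "m \<noteq> k" by auto
    then have "vs ! m \<in> set (vs[j := w j])" "vs ! m \<in> set (vs[k := w k])"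
      by (metis length_list_update nth_list_update_neq nth_mem)+
    then have "\<not> distinct (vs[j := w j] @ vs[k := w k])" by auto
    then show ?thesis using wedge_list_repeat by (metis wedge_list_append)
  qed
  then show ?thesis by (simp add: x wedge_sum_left wedge_sum_right)
qed

lemma ext_deriv_scale: "ext_deriv A (c *s x) = c *s ext_deriv A x"
  by (simp add: ext_deriv_def vec.scale_sum_right)

lemma ext_deriv_axis:
  "ext_deriv A (axis S 1) = (\<Sum>j<card S. wedge_list ((basis_list S)[j := A *v (basis_list S ! j)]))"
  unfolding ext_deriv_def by (rule sum_axis)

lemma osculating_space_one:
  assumes "S \<noteq> {}"
  shows "osculating_space \<gg> ext_deriv 1 (c *s axis S 1) \<subseteq> tangent_vectors (basis_list S)"
  unfolding osculating_space_def
proof (rule vec.span_minimal[OF _ tangent_vectors_subspace], rule subsetI)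
  fix y assume "y \<in> {foldr ext_deriv Xs (c *s axis S 1) | Xs. set Xs \<subseteq> \<gg> \<and> length Xs \<le> 1}"
  then obtain Xs where Xs: "y = foldr ext_deriv Xs (c *s axis S 1)" "length Xs \<le> 1" by blast
  have "basis_list S \<noteq> []" using assms by (metis card_eq_0_iff finite length_0_conv length_basis_list)
  then have "axis S 1 \<in> tangent_vectors (basis_list S)"
    using wedge_list_tangent wedge_list_basis_list by metis
  moreover have "ext_deriv X (axis S 1) \<in> tangent_vectors (basis_list S)" for X
    unfolding tangent_vectors_def ext_deriv_axis by auto
  ultimately show "y \<in> tangent_vectors (basis_list S)"
    using Xs by (cases Xs) (auto simp: ext_deriv_scale intro: vec.subspace_scale[OF tangent_vectors_subspace])
qed

lemma ext_map_tangent: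
  assumes "x \<in> tangent_vectors (basis_list S)"
  shows "ext_map A x \<in> tangent_vectors (map ((*v) A) (basis_list S))"
proof -
  obtain w where x: "x = (\<Sum>j<card S. wedge_list ((basis_list S)[j := w j]))"
    using assms unfolding tangent_vectors_def by auto
  have "ext_map A x = (\<Sum>j<card S. wedge_list ((map ((*v) A) (basis_list S))[j := A *v w j]))"
    unfolding x ext_map_sum basis_list_def
    by (intro sum.cong refl) (simp add: ext_map_wedge_list_update comp_def)
  then show ?thesis unfolding tangent_vectors_def by auto
qed

lemma ext_deriv_diagonal:
  assumes "\<And>i j. i \<noteq> j \<Longrightarrow> A $ i $ j = 0"
  shows "ext_deriv A x $ S = (\<Sum>i\<in>S. A $ i $ i) * x $ S"
proof -
  have col: "A *v axis k 1 = A $ k $ k *s axis k 1" for k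
    unfolding matrix_vector_mult_axis using assms by (auto simp: column_def vec_eq_iff axis_def)
  have "ext_deriv A (axis T 1) = (\<Sum>i\<in>T. A $ i $ i) *s axis T 1" for T
  proof -
    let ?l = "sorted_list_of_set T"
    have "wedge_list ((basis_list T)[j := A *v (basis_list T ! j)]) = A $ (?l ! j) $ (?l ! j) *s axis T 1"
      if "j < card T" for j
    proof -
      have "A *v (basis_list T ! j) = A $ (?l ! j) $ (?l ! j) *s (basis_list T ! j)"
        using that by (simp add: basis_list_def col)
      then have "wedge_list ((basis_list T)[j := A *v (basis_list T ! j)]) =
          A $ (?l ! j) $ (?l ! j) *s wedge_list ((basis_list T)[j := basis_list T ! j])"
        using that by (simp add: wedge_list_update_scale del: list_update_id)
      then show ?thesis by (simp add: wedge_list_basis_list)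
    qed
    then have "ext_deriv A (axis T 1) = (\<Sum>j<card T. A $ (?l ! j) $ (?l ! j)) *s axis T 1"
      by (simp add: ext_deriv_axis vec.scale_sum_left)
    also have "(\<Sum>j<card T. A $ (?l ! j) $ (?l ! j)) = (\<Sum>i\<in>T. A $ i $ i)"
      by (rule sum.reindex_bij_betw, rule bij_betw_nth) auto
    finally show ?thesis .
  qed
  moreover have "ext_deriv A x = (\<Sum>T\<in>UNIV. x $ T *s ext_deriv A (axis T 1))"
    unfolding ext_deriv_axis by (rule ext_deriv_def)
  ultimately have "ext_deriv A x = (\<Sum>T\<in>UNIV. x $ T *s ((\<Sum>i\<in>T. A $ i $ i) *s axis T 1))"
    by (simp only:)
  then show ?thesis
    by (simp add: axis_def if_distrib cong: if_cong)
qed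

text \<open>
  Two different index sets \<open>S\<close> and \<open>T\<close> of the same size have different weights: the traceless
  diagonal matrix with entries \<open>1\<close> at an element of \<open>S - T\<close> and \<open>-1\<close> at an element of \<open>T - S\<close> separates them.  So a weight
  vector has only one nonzero coordinate.
\<close>

lemma highest_weight_vector_decomposable:
  fixes v :: "complex ^ ('n::{finite,linorder} set)"
  assumes "highest_weight_vector k v"
  obtains S c where "card S = k" "c \<noteq> 0" "v = c *s axis S 1"
proof -
  have v: "v \<in> ext_power k" "v \<noteq> 0"
    and wt: "\<And>A. A \<in> sl \<Longrightarrow> (\<forall>i j. A $ i $ j \<noteq> 0 \<longrightarrow> i = j) \<Longrightarrow> \<exists>c. ext_deriv A v = c *s v"
    using assms unfolding highest_weight_vector_def by auto
  obtain S where S: "v $ S \<noteq> 0" using v(2) by (auto simp: vec_eq_iff)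
  have "T = S" if T: "v $ T \<noteq> 0" for T
  proof (rule ccontr)
    assume "T \<noteq> S"
    have card: "card S = k" "card T = k" using v(1) S T by (auto simp: ext_power_def)
    obtain i where i: "i \<in> S" "i \<notin> T"
      using card \<open>T \<noteq> S\<close> by (metis card_subset_eq finite subsetI)
    obtain j where j: "j \<in> T" "j \<notin> S"
      using card \<open>T \<noteq> S\<close> by (metis card_subset_eq finite subsetI)
    define A :: "((complex, 'n) vec, 'n) vec" where
      "A = (\<chi> p q. if p = q then (if p = i then 1 else 0) - (if p = j then 1 else 0) else 0)"
    have "A \<in> sl"
      by (simp add: sl_def trace_def A_def sum_subtractf)
    moreover have diag: "p \<noteq> q \<Longrightarrow> A $ p $ q = 0" for p q by (simp add: A_def)
    ultimately obtain c where "ext_deriv A v = c *s v" using wt by metis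
    then have eq: "(\<Sum>p\<in>U. A $ p $ p) * v $ U = c * v $ U" for U
      using ext_deriv_diagonal[OF diag, of v U] by auto
    have "(\<Sum>p\<in>S. A $ p $ p) = 1" "(\<Sum>p\<in>T. A $ p $ p) = - 1"
      using i j by (simp_all add: A_def sum_subtractf)
    then show False using eq[of S] eq[of T] S T by simp
  qed
  then have "v = v $ S *s axis S 1"
    by (auto simp: vec_eq_iff axis_def)
  moreover have "card S = k" using v(1) S by (auto simp: ext_power_def)
  ultimately show ?thesis using that S by blast
qed

lemma complex_nth_root:
  fixes z :: complex
  assumes "z \<noteq> 0" "n > 0"
  obtains w where "w \<noteq> 0" "w ^ n = z"
proof
  show "exp (Ln z / of_nat n) \<noteq> 0" by simp
  show "exp (Ln z / of_nat n) ^ n = z"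
    using assms by (simp flip: exp_of_nat_mult)
qed

text \<open>
  The factor \<open>c\<close> is a root of the determinant whose order is the dimension.
\<close>

lemma det_nonzero_scale_SL:
  fixes A :: "complex ^ 'n ^ 'n"
  assumes "det A \<noteq> 0"
  obtains c A' where "A' \<in> SL" "\<And>x. A *v x = c *s (A' *v x)"
proof -
  obtain c where c: "c \<noteq> 0" "c ^ CARD('n) = det A"
    using complex_nth_root[OF assms, of "CARD('n)"] by auto
  define A' where "A' = (\<chi> i. inverse c *s A $ i)"
  have "det A' = inverse c ^ CARD('n) * det A"
    unfolding A'_def by (subst det_rows_mul) (simp add: vec_nth_inverse)
  also have "\<dots> = 1"
    unfolding c(2)[symmetric] using c(1) by (simp add: power_inverse)
  finally have "A' \<in> SL" by (simp add: SL_def)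
  moreover have "A *v x = c *s (A' *v x)" for x
    using c(1) by (auto simp: A'_def matrix_vector_mult_def vec_eq_iff sum_distrib_left field_simps intro!: sum.cong)
  ultimately show ?thesis using that by blast
qed

lemma wedge_list_scale_all:
  "wedge_list (map (\<lambda>x. c *s g x) l) = c ^ length l *s wedge_list (map g l)"
  by (induction l)
     (simp_all add: wedge_list_Nil wedge_list_Cons ext_vec_scale wedge_scale_left wedge_scale_right)

lemma square_zero_on_closure:
  assumes "\<And>y x. y \<in> Y \<Longrightarrow> x \<in> y \<Longrightarrow> x \<and>\<^sub>E x = 0" "y \<in> zariski_closure W Y" "x \<in> y"
  shows "x \<and>\<^sub>E x = 0"
proof -
  have "(x \<and>\<^sub>E x) $ R = 0" for R
    by (rule form_vanishes_on_closure[OF homogeneous_form_square _ assms(2,3)]) (simp add: assms(1))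
  then show ?thesis by (simp add: vec_eq_iff)
qed

lemma wedge_list_4_ext_power: "wedge_list [a, b, c, d] \<in> ext_power 4"
  using wedge_list_ext_power[of "[a, b, c, d]"] by (simp add: numeral_eq_Suc)

text \<open>
  With \<open>v\<close> a multiple of \<open>s\<^sub>0 \<and> s\<^sub>1 \<and> s\<^sub>2 \<and> s\<^sub>3\<close>, the nilpotent matrix \<open>X\<close> with \<open>s\<^sub>3 \<mapsto> y\<close> and
  \<open>s\<^sub>2 \<mapsto> z\<close> sends \<open>v\<close> to a multiple of \<open>s\<^sub>0 \<and> s\<^sub>1 \<and> (s\<^sub>2 \<and> y + z \<and> s\<^sub>3)\<close>, whose images under
  invertible matrices are the points required by \<open>quadratic_hull_eq_square_zero\<close>.
\<close>

lemma M_SL_eq_square_zero: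
  fixes v :: "complex ^ ('n::{finite,linorder} set)"
  assumes "highest_weight_vector 4 v" "CARD('n) \<ge> 6"
  shows "M_SL 1 4 v = square_zero"
proof -
  obtain S c where S: "card S = 4" "c \<noteq> 0" "v = c *s axis S 1"
    using highest_weight_vector_decomposable[OF assms(1)] by blast
  define l where "l = sorted_list_of_set S"
  have "length l = 4" using S(1) by (simp add: l_def)
  then obtain s0 s1 s2 s3 where l: "l = [s0, s1, s2, s3]"
    by (auto simp: numeral_eq_Suc length_Suc_conv)
  have dl: "distinct l" "set l = S" by (simp_all add: l_def)
  have "card (- S) \<ge> 2" using S(1) assms(2) by (simp add: Compl_eq_Diff_UNIV card_Diff_subset)
  then obtain y z where yz: "y \<notin> S" "z \<notin> S" "y \<noteq> z"
    by (metis Compl_iff card_2_iff' card_le_Suc0_iff_eq finite not_less_eq_eq numeral_2_eq_2)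
  define ps where "ps = [s0, s1, s2, y, z, s3]"
  have ps: "inj_on (\<lambda>k. ps ! k) {..<6}"
    using dl yz by (intro inj_on_nth) (auto simp: ps_def l)
  have bl: "basis_list S = [axis s0 1, axis s1 1, axis s2 1, axis s3 1]"
    by (simp add: basis_list_def flip: l_def) (simp add: l)
  define X :: "((complex, 'n) vec, 'n) vec" where
    "X = (\<chi> i j. if i = y \<and> j = s3 \<or> i = z \<and> j = s2 then 1 else 0)"
  have "X \<in> sl"
    using dl yz by (auto simp: sl_def trace_def X_def l intro!: sum.neutral)
  have X: "X *v axis s0 1 = 0" "X *v axis s1 1 = 0" "X *v axis s2 1 = axis z 1" "X *v axis s3 1 = axis y 1"
    unfolding matrix_vector_mult_axis
    using dl yz by (auto simp: column_def X_def vec_eq_iff axis_def l)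
  define x0 where "x0 = wedge_list [axis s0 1, axis s1 1, axis s2 1, axis y 1] +
    wedge_list [axis s0 1, axis s1 1, axis z 1, axis s3 1]"
  have "ext_deriv X (axis S 1) = x0"
    unfolding ext_deriv_axis S(1) bl x0_def
    by (simp add: numeral_eq_Suc X wedge_list_Cons)
  then have "ext_deriv X v = c *s x0" by (simp add: S(3) ext_deriv_scale)
  moreover have "ext_deriv X v \<in> osculating_space sl ext_deriv 1 v"
    unfolding osculating_space_def
    by (rule vec.span_base) (use \<open>X \<in> sl\<close> in \<open>auto intro!: exI[of _ "[X]"]\<close>)
  ultimately have "c *s x0 \<in> osculating_space sl ext_deriv 1 v" by simp
  then have "inverse c *s (c *s x0) \<in> osculating_space sl ext_deriv 1 v"
    unfolding osculating_space_def by (rule vec.span_scale)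
  then have x0: "x0 \<in> osculating_space sl ext_deriv 1 v" using S(2) by simp
  define Y :: "(complex ^ ('n set)) set set" where
    "Y = {ext_map g ` L | g L. g \<in> SL \<and> L \<in> proj (osculating_space sl ext_deriv 1 v)}"
  have Ysq: "x \<and>\<^sub>E x = 0" if qx: "q \<in> Y" "x \<in> q" for q x
  proof -
    obtain g w where g: "x \<in> ext_map g ` proj_point w" "w \<in> osculating_space sl ext_deriv 1 v"
      using qx unfolding Y_def proj_def by blast
    have "S \<noteq> {}" using S(1) by auto
    then have "w \<in> tangent_vectors (basis_list S)"
      using g(2) osculating_space_one S(3) by blast
    then have "proj_point w \<subseteq> tangent_vectors (basis_list S)"
      unfolding proj_point_def using tangent_vectors_subspace by (intro vec.span_minimal) auto
    then have "x \<in> tangent_vectors (map ((*v) g) (basis_list S))"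
      using g(1) ext_map_tangent by blast
    then show ?thesis
      by (rule tangent_vectors_square_zero) (simp add: S(1))
  qed
  have "quadratic_hull (ext_power 4) (zariski_closure (ext_power 4) Y) = square_zero"
  proof (rule quadratic_hull_eq_square_zero[OF _ ps])
    show "x \<and>\<^sub>E x = 0" if "q \<in> zariski_closure (ext_power 4) Y" "x \<in> q" for q x
      using that by (rule square_zero_on_closure[OF Ysq, rotated -2])
  next
    fix f and A :: "((complex, 'n) vec, 'n) vec"
    assume f: "f \<in> vanishing_forms 2 (zariski_closure (ext_power 4) Y)" and "det A \<noteq> 0"
    have hf: "homogeneous_form 2 f" using f by (simp add: vanishing_forms_def)
    obtain k A' where A': "A' \<in> SL" "\<And>x. A *v x = k *s (A' *v x)"
      using det_nonzero_scale_SL[OF \<open>det A \<noteq> 0\<close>] by blast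
    let ?W = "\<lambda>A. wedge_list (map (\<lambda>k. A *v axis (ps ! k) 1) [0, 1, 2, 3]) +
         wedge_list (map (\<lambda>k. A *v axis (ps ! k) 1) [0, 1, 4, 5])"
    have W: "?W A = k ^ 4 *s ?W A'"
      unfolding A'(2) wedge_list_scale_all
      by (simp add: vec.scale_right_distrib power4_eq_xxxx mult.assoc)
    have W': "?W A' = ext_map A' x0"
      unfolding x0_def ext_map_add
      using ext_map_wedge_list_axes[of A' "[s0, s1, s2, y]"] ext_map_wedge_list_axes[of A' "[s0, s1, z, s3]"]
      by (simp add: ps_def numeral_eq_Suc)
    have "f (?W A') = 0"
    proof (cases "?W A' = 0")
      case True
      then show ?thesis
        using homogeneous_form_scale_arg[OF hf, of 0 0] by simp
    next
      case False
      then have "x0 \<noteq> 0" using W' ext_map_scale[of A' 0 0] by auto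
      then have "ext_map A' ` proj_point x0 \<in> Y"
        unfolding Y_def proj_def using A'(1) x0 by blast
      moreover have img: "ext_map A' ` proj_point x0 = proj_point (?W A')"
        unfolding W' proj_point_eq by (auto simp: ext_map_scale image_image)
      moreover have "?W A' \<in> ext_power 4"
        by (simp add: ext_power_add wedge_list_4_ext_power)
      then have "proj_point (?W A') \<in> proj (ext_power 4)"
        unfolding proj_def using False by blast
      ultimately have "proj_point (?W A') \<in> zariski_closure (ext_power 4) Y"
        using mem_zariski_closure by metis
      then show ?thesis
        using f mem_proj_point unfolding vanishing_forms_def by blast
    qed
    then show "f (?W A) = 0"
      unfolding W by (simp only: homogeneous_form_scale_arg[OF hf]) simp
  qed
  then show ?thesis
    unfolding M_SL_def osculating_variety_def Y_def .
qed

section \<open>The restricted chordal variety\<close>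

text \<open>
  One vector more than the dimension of \<open>L\<close> is linearly dependent.
\<close>

lemma ext_vec_wedge_pluecker:
  assumes L: "vec.subspace L" and u: "u \<in> L" and x: "x \<in> pluecker L"
  shows "ext_vec u \<and>\<^sub>E x = 0" "x \<in> ext_power (vec.dim L)"
proof -
  let ?K = "{x. ext_vec u \<and>\<^sub>E x = 0 \<and> x \<in> ext_power (vec.dim L)}"
  have "pluecker L \<subseteq> ?K"
    unfolding pluecker_def
  proof (rule vec.span_minimal)
    show "vec.subspace ?K"
      by (rule vec.subspaceI) (auto simp: wedge_add_right wedge_scale_right ext_power_add ext_power_scale)
    have "wedge_list (u # vs) = 0" if "set vs \<subseteq> L" "length vs = vec.dim L" for vs
    proof (cases "distinct (u # vs)")
      case True
      then have "card (set (u # vs)) = Suc (vec.dim L)"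
        using that(2) by (simp only: distinct_card) simp
      moreover have "set (u # vs) \<subseteq> L" using that u by simp
      ultimately have "vec.dependent (set (u # vs))"
        using vec.independent_card_le_dim by (metis Suc_n_not_le_n)
      then show ?thesis by (rule wedge_list_dependent)
    qed (rule wedge_list_repeat)
    then have "ext_vec u \<and>\<^sub>E wedge_list vs = 0" if "set vs \<subseteq> L" "length vs = vec.dim L" for vs
      using that by (simp add: wedge_list_Cons)
    moreover have "wedge_list vs \<in> ext_power (vec.dim L)" if "length vs = vec.dim L" for vs
      using that wedge_list_ext_power[of vs] by simp
    ultimately show "{wedge_list vs | vs. set vs \<subseteq> L \<and> length vs = vec.dim L} \<subseteq> ?K"
      by blast
  qed
  then show "ext_vec u \<and>\<^sub>E x = 0" "x \<in> ext_power (vec.dim L)" using x by auto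
qed

lemma independent_columns:
  fixes A :: "complex ^ 'n ^ 'n"
  assumes "det A \<noteq> 0"
  shows "vec.independent ((\<lambda>i. A *v axis i 1) ` I)" "inj (\<lambda>i. A *v axis i 1)"
proof -
  have inv: "invertible A" using assms by (simp add: invertible_det_nz)
  then have inj: "inj ((*v) A)"
    using matrix_left_invertible_injective invertible_left_inverse by blast
  have "vec.independent ((\<lambda>i. axis i 1 :: complex ^ 'n) ` I)"
    by (rule vec.independent_mono[OF vec.independent_Basis]) (auto simp: cart_basis_def)
  then have "vec.independent ((*v) A ` ((\<lambda>i. axis i 1) ` I))"
    using inj by (intro vec.linear_independent_injective_image matrix_vector_mul_linear_gen)
      (auto intro: inj_on_subset)
  then show "vec.independent ((\<lambda>i. A *v axis i 1) ` I)" by (simp add: image_image)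
  have "inj (\<lambda>i. axis i 1 :: complex ^ 'n)" by (rule injI) (simp add: axis_eq_axis)
  then show "inj (\<lambda>i. A *v axis i 1)" using inj_compose[OF inj] by (simp add: comp_def)
qed

text \<open>
  For independent vectors the point \<open>b\<^sub>0 \<and> b\<^sub>1 \<and> (b\<^sub>2 \<and> b\<^sub>3 + b\<^sub>4 \<and> b\<^sub>5)\<close> lies on the chord through the planes spanned by
  \<open>b\<^sub>0, b\<^sub>1, b\<^sub>2, b\<^sub>3\<close> and \<open>b\<^sub>0, b\<^sub>1, b\<^sub>4, b\<^sub>5\<close>, which meet in dimension 2.
\<close>

lemma restricted_chordal_hull_eq_square_zero:
  assumes "CARD('n::{finite,linorder}) \<ge> 6"
  shows "quadratic_hull (ext_power 4) (restricted_chordal 2 4) =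
    (square_zero :: (complex ^ ('n set)) set set)"
proof -
  define Y :: "(complex ^ ('n set)) set set" where
    "Y = \<Union> {proj_line (pluecker L) (pluecker M) | L M.
             L \<in> planes 4 \<and> M \<in> planes 4 \<and> L \<noteq> M \<and> 4 + 1 \<le> vec.dim (L \<inter> M) + 2 * 2}"
  have Ysq: "x \<and>\<^sub>E x = 0" if qx: "q \<in> Y" "x \<in> q" for q x
  proof -
    obtain L M where "L \<in> planes 4" "M \<in> planes 4" "4 + 1 \<le> vec.dim (L \<inter> M) + 2 * 2"
      and q: "q \<in> proj_line (pluecker L) (pluecker M)"
      using qx(1) unfolding Y_def by blast
    then have LM: "vec.subspace L" "vec.dim L = 4" "vec.subspace M" "vec.dim M = 4"
      "vec.dim (L \<inter> M) \<ge> 1"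
      by (auto simp: planes_def)
    obtain w where w: "w \<in> vec.span (pluecker L \<union> pluecker M)" "x \<in> proj_point w"
      using q qx(2) unfolding proj_line_def proj_def by blast
    have "\<not> L \<inter> M \<subseteq> {0}"
      using LM(5) vec.dim_eq_0 by (metis not_one_le_zero)
    then obtain u where u: "u \<in> L" "u \<in> M" "u \<noteq> 0" by blast
    let ?K = "{x. ext_vec u \<and>\<^sub>E x = 0 \<and> x \<in> ext_power 4}"
    have K: "vec.subspace ?K"
      by (rule vec.subspaceI) (auto simp: wedge_add_right wedge_scale_right ext_power_add ext_power_scale)
    have "pluecker L \<union> pluecker M \<subseteq> ?K"
      using ext_vec_wedge_pluecker[OF LM(1) u(1)] ext_vec_wedge_pluecker[OF LM(3) u(2)] LM(2,4) by auto
    then have "w \<in> ?K" using w(1) vec.span_minimal[OF _ K] by blast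
    then have "x \<in> ?K" using w(2) vec.subspace_scale[OF K] unfolding proj_point_eq by blast
    then show ?thesis using annihilated_square_zero[OF u(3)] by blast
  qed
  obtain ps :: "'n list" where ps: "distinct ps" "length ps = 6"
  proof -
    obtain T :: "'n set" where "card T = 6" using obtain_subset_with_card_n[OF assms] by blast
    then show ?thesis using that[of "sorted_list_of_set T"] by simp
  qed
  have inj: "inj_on (\<lambda>k. ps ! k) {..<6}"
    using ps by (intro inj_on_nth) auto
  have "quadratic_hull (ext_power 4) (zariski_closure (ext_power 4) Y) = square_zero"
  proof (rule quadratic_hull_eq_square_zero[OF _ inj])
    show "x \<and>\<^sub>E x = 0" if "q \<in> zariski_closure (ext_power 4) Y" "x \<in> q" for q x
      using that by (rule square_zero_on_closure[OF Ysq, rotated -2])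
  next
    fix f and A :: "((complex, 'n) vec, 'n) vec"
    assume f: "f \<in> vanishing_forms 2 (zariski_closure (ext_power 4) Y)" and A: "det A \<noteq> 0"
    have hf: "homogeneous_form 2 f" using f by (simp add: vanishing_forms_def)
    define b where "b k = A *v axis (ps ! k) 1" for k
    have ind: "vec.independent (b ` I)" if "I \<subseteq> {..<6}" for I
      using independent_columns(1)[OF A, of "(\<lambda>k. ps ! k) ` I"] by (simp add: b_def image_image)
    have binj: "inj_on b {..<6}"
      using comp_inj_on[OF inj inj_on_subset[OF independent_columns(2)[OF A] subset_UNIV]]
      by (simp add: b_def[abs_def] comp_def)
    have dim: "vec.dim (vec.span (b ` I)) = card I" if "I \<subseteq> {..<6}" for I
      using ind[OF that] binj that by (simp add: vec.dim_eq_card_independent card_image inj_on_subset)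
    define L M where "L = vec.span (b ` {0, 1, 2, 3})" and "M = vec.span (b ` {0, 1, 4, 5})"
    have planes: "L \<in> planes 4" "M \<in> planes 4"
      using dim[of "{0, 1, 2, 3}"] dim[of "{0, 1, 4, 5}"] by (simp_all add: planes_def L_def M_def)
    have "b 2 \<notin> M"
    proof
      assume "b 2 \<in> M"
      then have "vec.span (b ` {0, 1, 2, 4, 5}) = M"
        unfolding M_def using vec.span_redundant[of "b 2" "b ` {0, 1, 4, 5}"] by (simp add: insert_commute)
      then show False using dim[of "{0, 1, 2, 4, 5}"] dim[of "{0, 1, 4, 5}"] by (simp add: M_def)
    qed
    moreover have "b 2 \<in> L" unfolding L_def by (rule vec.span_base) simp
    ultimately have "L \<noteq> M" by blast
    have "vec.span (b ` {0}) \<subseteq> L \<inter> M"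
      unfolding L_def M_def by (intro Int_greatest vec.span_mono) auto
    then have "vec.dim (vec.span (b ` {0})) \<le> vec.dim (L \<inter> M)" by (rule vec.dim_subset)
    moreover have "vec.dim (vec.span (b ` {0})) = card {0 :: nat}" by (rule dim) simp
    ultimately have "card {0 :: nat} \<le> vec.dim (L \<inter> M)" by (simp only:)
    then have "1 \<le> vec.dim (L \<inter> M)" by simp
    let ?W = "wedge_list (map b [0, 1, 2, 3]) + wedge_list (map b [0, 1, 4, 5])"
    have W: "f ?W = 0"
    proof (cases "?W = 0")
      case True
      then show ?thesis
        using homogeneous_form_scale_arg[OF hf, of 0 0] by simp
    next
      case False
      have "wedge_list (map b [0, 1, 2, 3]) \<in> pluecker L"
        unfolding pluecker_def
        by (rule vec.span_base) (use planes vec.span_base[of _ "b ` {0, 1, 2, 3}"] in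
          \<open>auto simp: planes_def L_def intro!: exI[of _ "[b 0, b 1, b 2, b 3]"]\<close>)
      moreover have "wedge_list (map b [0, 1, 4, 5]) \<in> pluecker M"
        unfolding pluecker_def
        by (rule vec.span_base) (use planes vec.span_base[of _ "b ` {0, 1, 4, 5}"] in
          \<open>auto simp: planes_def M_def intro!: exI[of _ "[b 0, b 1, b 4, b 5]"]\<close>)
      ultimately have "?W \<in> vec.span (pluecker L \<union> pluecker M)"
        by (intro vec.span_add vec.span_base) auto
      then have "proj_point ?W \<in> proj_line (pluecker L) (pluecker M)"
        unfolding proj_line_def proj_def using False by blast
      moreover have "4 + 1 \<le> vec.dim (L \<inter> M) + 2 * 2"
        using \<open>1 \<le> vec.dim (L \<inter> M)\<close> by simp
      ultimately have "proj_point ?W \<in> Y"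
        unfolding Y_def using planes \<open>L \<noteq> M\<close> by blast
      moreover have "?W \<in> ext_power 4"
        by (simp add: ext_power_add wedge_list_4_ext_power)
      then have "proj_point ?W \<in> proj (ext_power 4)"
        unfolding proj_def using False by blast
      ultimately have "proj_point ?W \<in> zariski_closure (ext_power 4) Y"
        by (rule mem_zariski_closure)
      then show ?thesis
        using f mem_proj_point unfolding vanishing_forms_def by blast
    qed
    then show "f (wedge_list (map (\<lambda>k. A *v axis (ps ! k) 1) [0, 1, 2, 3]) +
         wedge_list (map (\<lambda>k. A *v axis (ps ! k) 1) [0, 1, 4, 5])) = 0"
      unfolding b_def by simp
  qed
  then show ?thesis unfolding restricted_chordal_def Y_def .
qed

section \<open>Generic divisibility and reducibility\<close>

text \<open>
  Injectivity is an open condition: if \<open>C\<close> is a left inverse of \<open>L w\<^sub>0\<close>, the determinant of \<open>C (L w)\<close> is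
  a form in \<open>w\<close> that is 1 at \<open>w\<^sub>0\<close> and vanishes wherever \<open>L w\<close> is not injective.
\<close>

lemma generic_injective:
  fixes L :: "complex ^ 'w \<Rightarrow> complex ^ 'i \<Rightarrow> complex ^ 'j"
  assumes lin: "\<And>w. Vector_Spaces.linear (*s) (*s) (L w)"
    and form: "\<And>x j. homogeneous_form 1 (\<lambda>w. L w x $ j)"
    and inj: "\<And>x. L w0 x = 0 \<Longrightarrow> x = 0"
  obtains d F where "homogeneous_form d F" "F w0 \<noteq> 0" "\<And>w x. F w \<noteq> 0 \<Longrightarrow> L w x = 0 \<Longrightarrow> x = 0"
proof -
  have works: "matrix (L w) *v x = L w x" for w x
    using matrix_works[OF lin] .
  obtain C where C: "C ** matrix (L w0) = mat 1"
    using inj works matrix_left_invertible_ker by metis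
  define F where "F w = det (C ** matrix (L w))" for w
  have "homogeneous_form 1 (\<lambda>w. (C ** matrix (L w)) $ i $ j)" for i j
    unfolding matrix_matrix_mult_def matrix_def
    by (simp, intro homogeneous_form_sum homogeneous_form_scale) (use form in simp)
  then have "homogeneous_form (CARD('i) * 1) F"
    unfolding F_def by (rule homogeneous_form_det)
  moreover have "F w0 \<noteq> 0" by (simp add: F_def C)
  moreover have "x = 0" if "F w \<noteq> 0" "L w x = 0" for w x
  proof -
    have "invertible (C ** matrix (L w))" using that(1) by (simp add: F_def invertible_det_nz)
    then have "inj ((*v) (C ** matrix (L w)))"
      using matrix_left_invertible_injective invertible_left_inverse by blast
    moreover have "(C ** matrix (L w)) *v x = (C ** matrix (L w)) *v 0"
      using that(2) by (simp add: works flip: matrix_vector_mul_assoc)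
    ultimately show ?thesis by (rule injD)
  qed
  ultimately show ?thesis using that by blast
qed

lemma contract_zero: "contract s 0 = 0"
  by (simp add: contract_def vec_eq_iff)

lemma contract_wedge:
  assumes "free_of s a"
  shows "contract s (axis {s} 1 \<and>\<^sub>E a) = a"
proof -
  let ?x = "axis {s} 1 \<and>\<^sub>E a"
  have "axis {s} 1 \<and>\<^sub>E (contract s ?x - a) + restrict_free s ?x =
      (axis {s} 1 \<and>\<^sub>E contract s ?x + restrict_free s ?x) - ?x"
    by (simp add: wedge_diff_right)
  also have "\<dots> = 0" by (simp flip: split_decomposition)
  finally have "axis {s} 1 \<and>\<^sub>E (contract s ?x - a) + restrict_free s ?x = 0" .
  from split_unique(1)[OF this] show ?thesis
    using assms by (simp add: free_of_diff free_of_contract free_of_restrict_free)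
qed

lemma odd_square_zero:
  assumes "x \<in> ext_power k" "odd k"
  shows "x \<and>\<^sub>E x = 0"
  using wedge_commute_graded[OF assms(1) assms(1)] assms(2)
  by (intro eq_uminus_zero) simp

text \<open>
  With \<open>x = e\<^sub>s \<and> a + b\<close> and \<open>b\<close> of even degree, \<open>x \<and> x = 2 e\<^sub>s \<and> (a \<and> b) + b \<and> b\<close>.
\<close>

lemma contract_restrict_orthogonal:
  assumes x: "x \<in> ext_power 4" and sq: "x \<and>\<^sub>E x = 0"
  shows "contract s x \<and>\<^sub>E restrict_free s x = 0"
proof -
  let ?e = "axis {s} 1 :: complex ^ ('a set)"
  let ?a = "contract s x" and ?b = "restrict_free s x"
  have a: "?a \<in> ext_power 3" using x by (intro ext_power_contract) (simp add: numeral_eq_Suc)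
  have b: "?b \<in> ext_power 4" using x by (rule ext_power_restrict_free)
  have e: "?e \<in> ext_power 1" using ext_vec_ext_power[of "axis s 1"] by (simp add: ext_vec_axis)
  have ea: "?e \<and>\<^sub>E ?a \<in> ext_power 4" using ext_power_wedge[OF e a] by simp
  have ee: "?e \<and>\<^sub>E (?e \<and>\<^sub>E y) = 0" for y
    using ext_vec_square_wedge[of "axis s 1"] by (simp add: ext_vec_axis)
  have "(?e \<and>\<^sub>E ?a) \<and>\<^sub>E (?e \<and>\<^sub>E ?a) = 0"
    using annihilated_square_zero[of "axis s 1" "?e \<and>\<^sub>E ?a"] ea by (simp add: ext_vec_axis ee)
  moreover have "?b \<and>\<^sub>E (?e \<and>\<^sub>E ?a) = (?e \<and>\<^sub>E ?a) \<and>\<^sub>E ?b"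
    using wedge_commute_graded[OF b ea] by simp
  moreover have "x \<and>\<^sub>E x = (?e \<and>\<^sub>E ?a + ?b) \<and>\<^sub>E (?e \<and>\<^sub>E ?a + ?b)"
    by (simp flip: split_decomposition)
  ultimately have "(?e \<and>\<^sub>E ?a) \<and>\<^sub>E ?b + (?e \<and>\<^sub>E ?a) \<and>\<^sub>E ?b + ?b \<and>\<^sub>E ?b = 0"
    using sq by (simp add: wedge_add_left wedge_add_right)
  then have "?e \<and>\<^sub>E (?a \<and>\<^sub>E ?b + ?a \<and>\<^sub>E ?b) + ?b \<and>\<^sub>E ?b = 0"
    by (simp only: wedge_add_right wedge_assoc)
  moreover have "free_of s (?a \<and>\<^sub>E ?b)" "free_of s (?b \<and>\<^sub>E ?b)"
    by (intro free_of_wedge free_of_contract free_of_restrict_free)+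
  ultimately have "?a \<and>\<^sub>E ?b + ?a \<and>\<^sub>E ?b = 0"
    using split_unique(1) free_of_add by blast
  then show ?thesis by (intro eq_uminus_zero) (simp only: eq_neg_iff_add_eq_0)
qed

lemma homogeneous_form_contract: "homogeneous_form 1 (\<lambda>w. contract s w $ T)"
proof (cases "s \<in> T")
  case True
  then show ?thesis by (simp add: contract_def homogeneous_form_zero)
next
  case False
  then show ?thesis
    by (simp add: contract_def homogeneous_form_scale homogeneous_form_coord[unfolded One_nat_def])
qed

lemma homogeneous_form_wedge_left:
  assumes "\<And>T. homogeneous_form d (\<lambda>w. f w $ T)"
  shows "homogeneous_form d (\<lambda>w. (f w \<and>\<^sub>E x) $ S)"
proof -
  have "homogeneous_form d (\<lambda>w. \<Sum>T\<in>Pow S. (shuffle_sign T (S - T) * x $ (S - T)) * f w $ T)"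
    by (intro homogeneous_form_sum homogeneous_form_scale assms)
  then show ?thesis by (simp add: wedge_def mult_ac)
qed

lemma homogeneous_form_wedge_right:
  assumes "\<And>T. homogeneous_form d (\<lambda>w. f w $ T)"
  shows "homogeneous_form d (\<lambda>w. (x \<and>\<^sub>E f w) $ S)"
proof -
  have "homogeneous_form d (\<lambda>w. \<Sum>T\<in>Pow S. (shuffle_sign T (S - T) * x $ T) * f w $ (S - T))"
    by (intro homogeneous_form_sum homogeneous_form_scale assms)
  then show ?thesis by (simp add: wedge_def)
qed

lemma linearI_vec:
  assumes "\<And>x y. f (x + y) = f x + f y" "\<And>c x. f (c *s x) = c *s f x"
  shows "Vector_Spaces.linear (*s) (*s) (f :: complex ^ 'i \<Rightarrow> complex ^ 'j)"
  using assms by unfold_locales auto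

definition drop_coord :: "'n \<Rightarrow> complex ^ 'n \<Rightarrow> complex ^ 'n" where
  "drop_coord s v = (\<chi> i. if i = s then 0 else v $ i)"

lemma free_of_drop_coord: "free_of s (ext_vec (drop_coord s v))"
  unfolding free_of_def ext_vec_nth by (auto simp: drop_coord_def card_1_singleton_iff)

text \<open>
  The sets \<open>p i\<close> name coordinates by which a multiple \<open>u \<and> \<alpha>\<close> can be subtracted from an element of the
  kernel: there are as many as the dimension of the space of such \<open>u\<close>.  By hypothesis,
  \<open>L1\<close> (product with \<open>\<alpha>\<close> together with these coordinates) and \<open>L2\<close> (the same coordinates of \<open>u \<and> \<alpha>\<close>) are
  injective at \<open>e\<^sub>s \<and> \<alpha>\<close>.  Where both remain injective, \<open>L2\<close> is surjective and provides \<open>u\<close> such that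
  \<open>\<beta> - u \<and> \<alpha>\<close> has vanishing coordinates \<open>p i\<close>, and \<open>L1\<close> shows that this difference is zero.
\<close>

lemma generic_divisibility:
  fixes \<alpha> :: "complex ^ ('n::{finite,linorder} set)" and p :: "'n \<Rightarrow> 'n set"
  assumes \<alpha>: "\<alpha> \<in> ext_power 3" "free_of s \<alpha>" "\<alpha> \<noteq> 0"
    and ker: "\<And>x. x \<in> ext_power 4 \<Longrightarrow> free_of s x \<Longrightarrow> \<alpha> \<and>\<^sub>E x = 0 \<Longrightarrow>
      (\<And>i. i \<noteq> s \<Longrightarrow> x $ p i = 0) \<Longrightarrow> x = 0"
    and inj: "\<And>u. u $ s = 0 \<Longrightarrow> ext_vec u \<and>\<^sub>E \<alpha> = 0 \<Longrightarrow> u = 0"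
  obtains d F where "homogeneous_form d F" "F (axis {s} 1 \<and>\<^sub>E \<alpha>) \<noteq> 0"
    "\<And>w. w \<in> ext_power 4 \<Longrightarrow> w \<and>\<^sub>E w = 0 \<Longrightarrow> F w \<noteq> 0 \<Longrightarrow> \<exists>v. v \<noteq> 0 \<and> ext_vec v \<and>\<^sub>E w = 0"
proof -
  let ?e = "axis {s} 1 :: complex ^ ('n set)"
  define w0 where "w0 = ?e \<and>\<^sub>E \<alpha>"
  have c0: "contract s w0 = \<alpha>" unfolding w0_def using \<alpha>(2) by (rule contract_wedge)
  have "w0 \<noteq> 0" using c0 \<alpha>(3) contract_zero by metis
  then obtain h where h: "w0 $ h \<noteq> 0" by (auto simp: vec_eq_iff)
  have odd: "ext_vec u \<and>\<^sub>E a \<in> ext_power 4" "a \<and>\<^sub>E (ext_vec u \<and>\<^sub>E a) = 0" if a: "a \<in> ext_power 3" for a u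
  proof -
    show "ext_vec u \<and>\<^sub>E a \<in> ext_power 4" using ext_power_wedge[OF ext_vec_ext_power a, of u] by simp
    have "(ext_vec u \<and>\<^sub>E a) \<and>\<^sub>E a = 0"
      using odd_square_zero[OF a] by (simp add: wedge_assoc)
    then show "a \<and>\<^sub>E (ext_vec u \<and>\<^sub>E a) = 0"
      using wedge_commute_graded[OF a \<open>ext_vec u \<and>\<^sub>E a \<in> ext_power 4\<close>] by simp
  qed
  define K where "K = {T. s \<notin> T \<and> card T = 4}"
  define cut where "cut x = (\<chi> T. if T \<in> K then x $ T else 0)" for x :: "complex ^ ('n set)"
  have cut: "cut x \<in> ext_power 4" "free_of s (cut x)" for x
    by (auto simp: cut_def K_def ext_power_def free_of_def)
  have cut_id: "cut x = x" if "x \<in> ext_power 4" "free_of s x" for x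
    using that by (auto simp: cut_def K_def ext_power_def free_of_def vec_eq_iff)
  \<comment> \<open>The factor \<open>w $ h\<close>, nonzero at \<open>w0\<close>, makes all entries linear in \<open>w\<close>.  The cut and the rows
    outside \<open>K\<close> turn a condition on forms of degree 4 free of \<open>s\<close> into one on the whole space.\<close>
  define L1 :: "complex ^ ('n set) \<Rightarrow> complex ^ ('n set) \<Rightarrow> complex ^ ('n set \<times> bool)" where
    "L1 w x = (\<chi> j. if snd j then (contract s w \<and>\<^sub>E cut x) $ fst j
      else if fst j \<notin> K \<or> fst j \<in> p ` (- {s}) then x $ fst j * w $ h else 0)" for w x
  obtain d1 F1 where F1: "homogeneous_form d1 F1" "F1 w0 \<noteq> 0"
    "\<And>w x. F1 w \<noteq> 0 \<Longrightarrow> L1 w x = 0 \<Longrightarrow> x = 0"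
  proof (rule generic_injective[of L1 w0])
    fix w
    have cut_lin: "cut (x + y) = cut x + cut y" "cut (c *s x) = c *s cut x" for x y c
      by (auto simp: cut_def vec_eq_iff)
    show "Vector_Spaces.linear (*s) (*s) (L1 w)"
      by (intro linearI_vec; rule vec_eq_iff[THEN iffD2])
         (simp_all add: L1_def cut_lin wedge_add_right wedge_scale_right distrib_right)
  next
    fix x j
    show "homogeneous_form 1 (\<lambda>w. L1 w x $ j)"
      using homogeneous_form_wedge_left[OF homogeneous_form_contract[of s], of "cut x" "fst j"]
        homogeneous_form_scale[OF homogeneous_form_coord, of "x $ fst j" h]
      by (cases "snd j"; cases "fst j \<notin> K \<or> fst j \<in> p ` (- {s})")
         (simp_all add: L1_def homogeneous_form_zero)
  next
    fix x assume "L1 w0 x = 0"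
    then have 0: "L1 w0 x $ (T, b) = 0" for T b by simp
    have "\<alpha> \<and>\<^sub>E cut x = 0"
      using 0[of _ True] c0 by (simp add: L1_def vec_eq_iff)
    moreover have x0: "x $ T = 0" if "T \<notin> K \<or> T \<in> p ` (- {s})" for T
      using 0[of T False] that h by (simp add: L1_def)
    then have "cut x $ p i = 0" if "i \<noteq> s" for i using that by (auto simp: cut_def)
    ultimately have "cut x = 0" using ker[OF cut] by blast
    moreover have "cut x = x" using x0 by (auto simp: cut_def vec_eq_iff)
    ultimately show "x = 0" by simp
  qed blast
  \<comment> \<open>The row at \<open>s\<close> only serves to make \<open>L2 w\<close> an endomorphism, for which injective means surjective.\<close>
  define L2 :: "complex ^ ('n set) \<Rightarrow> (complex, 'n) vec \<Rightarrow> (complex, 'n) vec" where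
    "L2 w v = (\<chi> i. if i = s then v $ s * w $ h
      else (ext_vec (drop_coord s v) \<and>\<^sub>E contract s w) $ p i)" for w v
  have L2_lin: "Vector_Spaces.linear (*s) (*s) (L2 w)" for w
  proof -
    have drop_lin: "drop_coord s (x + y) = drop_coord s x + drop_coord s y"
      "drop_coord s (c *s x) = c *s drop_coord s x" for x y :: "(complex, 'n) vec" and c
      by (auto simp: drop_coord_def vec_eq_iff)
    show ?thesis
      by (intro linearI_vec; rule vec_eq_iff[THEN iffD2])
         (simp_all add: L2_def drop_lin wedge_add_left wedge_scale_left distrib_right
           ext_vec_add ext_vec_scale)
  qed
  obtain d2 F2 where F2: "homogeneous_form d2 F2" "F2 w0 \<noteq> 0"
    "\<And>w x. F2 w \<noteq> 0 \<Longrightarrow> L2 w x = 0 \<Longrightarrow> x = 0"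
  proof (rule generic_injective[of L2 w0, OF L2_lin])
    fix x j
    show "homogeneous_form 1 (\<lambda>w. L2 w x $ j)"
      using homogeneous_form_wedge_right[OF homogeneous_form_contract[of s], of "ext_vec (drop_coord s x)" "p j"]
        homogeneous_form_scale[OF homogeneous_form_coord, of "x $ s" h]
      by (cases "j = s") (simp_all add: L2_def)
  next
    fix v assume "L2 w0 v = 0"
    then have 0: "L2 w0 v $ i = 0" for i by simp
    have "v $ s = 0" using 0[of s] h by (simp add: L2_def)
    then have v: "drop_coord s v = v" by (auto simp: drop_coord_def vec_eq_iff)
    have "ext_vec v \<and>\<^sub>E \<alpha> = 0"
    proof (rule ker)
      show "free_of s (ext_vec v \<and>\<^sub>E \<alpha>)"
        using free_of_drop_coord[of s v] \<alpha>(2) by (simp add: v free_of_wedge)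
      show "(ext_vec v \<and>\<^sub>E \<alpha>) $ p i = 0" if "i \<noteq> s" for i
        using 0[of i] that by (simp add: L2_def v c0)
    qed (use odd[OF \<alpha>(1)] in auto)
    then show "v = 0" using inj \<open>v $ s = 0\<close> by blast
  qed blast
  define F where "F w = F1 w * F2 w" for w
  have "homogeneous_form (d1 + d2) F"
    unfolding F_def using F1(1) F2(1) by (rule homogeneous_form_mult)
  moreover have "F w0 \<noteq> 0" using F1(2) F2(2) by (simp add: F_def)
  moreover have "\<exists>v. v \<noteq> 0 \<and> ext_vec v \<and>\<^sub>E w = 0"
    if w: "w \<in> ext_power 4" "w \<and>\<^sub>E w = 0" "F w \<noteq> 0" for w
  proof -
    let ?a = "contract s w" and ?b = "restrict_free s w"
    have a: "?a \<in> ext_power 3" using w(1) by (intro ext_power_contract) (simp add: numeral_eq_Suc)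
    have "inj (L2 w)"
      using F2(3)[of w] w(3) vec.linear_inj_iff_eq_0[OF L2_lin] by (simp add: F_def)
    then have "surj (L2 w)" by (rule vec.linear_injective_imp_surjective[OF L2_lin]) (rule refl)
    then obtain v where v: "L2 w v = (\<chi> i. if i = s then 0 else ?b $ p i)" by (metis surjD)
    define u where "u = drop_coord s v"
    have "?b - ext_vec u \<and>\<^sub>E ?a = 0"
    proof -
      let ?x = "?b - ext_vec u \<and>\<^sub>E ?a"
      have "- 1 *s (ext_vec u \<and>\<^sub>E ?a) \<in> ext_power 4"
        by (rule ext_power_scale) (rule odd(1)[OF a])
      then have x4: "?x \<in> ext_power 4"
        using ext_power_add[OF ext_power_restrict_free[OF w(1)], of "- 1 *s (ext_vec u \<and>\<^sub>E ?a)"] by simp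
      have xs: "free_of s ?x"
        by (simp add: u_def free_of_diff free_of_wedge free_of_drop_coord free_of_contract free_of_restrict_free)
      have ax: "?a \<and>\<^sub>E ?x = 0"
        using contract_restrict_orthogonal[OF w(1,2)] odd(2)[OF a] by (simp add: wedge_diff_right)
      have xp: "?x $ p i = 0" if "i \<noteq> s" for i
        using arg_cong[OF v, of "\<lambda>y. y $ i"] that by (simp add: L2_def u_def)
      have "?x $ T = 0" if "T \<notin> K" for T
        using that x4 xs unfolding ext_power_def free_of_def K_def by blast
      moreover have "?x $ T = 0" if "T \<in> p ` (- {s})" for T
        using that xp by blast
      ultimately have "?x $ T * w $ h = 0" if "T \<notin> K \<or> T \<in> p ` (- {s})" for T
        using that by (metis mult_zero_left)
      then have "L1 w ?x = 0"
        unfolding L1_def cut_id[OF x4 xs] ax vec_eq_iff by (simp del: vector_minus_component)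
      then show ?thesis using F1(3)[of w ?x] w(3) by (simp add: F_def)
    qed
    then have b: "?b = ext_vec u \<and>\<^sub>E ?a" by simp
    \<comment> \<open>Here \<open>e\<^sub>s \<and> \<beta> = e\<^sub>s \<and> u \<and> \<alpha>\<close> cancels \<open>u \<and> e\<^sub>s \<and> \<alpha>\<close>.\<close>
    have "ext_vec (axis s 1 + u) \<and>\<^sub>E w = (?e + ext_vec u) \<and>\<^sub>E (?e \<and>\<^sub>E ?a + ?b)"
      by (simp add: ext_vec_add ext_vec_axis flip: split_decomposition)
    also have "\<dots> = 0"
      using ext_vec_square_wedge[of "axis s 1"] unfolding b
      by (simp add: ext_vec_axis wedge_add_left wedge_add_right swap_past_single ext_vec_square_wedge)
    finally have "ext_vec (axis s 1 + u) \<and>\<^sub>E w = 0" .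
    moreover have "(axis s 1 + u) $ s = 1" by (simp add: u_def drop_coord_def)
    then have "axis s 1 + u \<noteq> 0" by (metis zero_index zero_neq_one)
    ultimately show ?thesis by blast
  qed
  ultimately show ?thesis using that w0_def by blast
qed

lemma zero_locus_point:
  assumes "w \<in> W" "w \<noteq> 0" "\<And>f. f \<in> F \<Longrightarrow> \<exists>d. homogeneous_form d f"
  shows "proj_point w \<in> zero_locus W F \<longleftrightarrow> (\<forall>f\<in>F. f w = 0)"
proof
  assume "proj_point w \<in> zero_locus W F"
  then show "\<forall>f\<in>F. f w = 0" using mem_proj_point unfolding zero_locus_def by blast
next
  assume *: "\<forall>f\<in>F. f w = 0"
  have "f x = 0" if fx: "f \<in> F" "x \<in> proj_point w" for f x
  proof -
    obtain d where "homogeneous_form d f" using assms(3) fx(1) by blast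
    moreover obtain c where "x = c *s w" using fx(2) by (auto simp: proj_point_eq)
    ultimately show ?thesis using * fx(1) homogeneous_form_scale_arg by fastforce
  qed
  then show "proj_point w \<in> zero_locus W F"
    unfolding zero_locus_def proj_def using assms(1,2) by blast
qed

text \<open>
  The two pieces are cut out by \<open>G\<close>, which vanishes on all \<open>\<omega>\<close> divisible by a vector, and by \<open>F\<close>,
  which vanishes on all other points of the variety.  The point \<open>w1\<close> is not on the first piece and \<open>e\<^sub>s \<and> \<alpha>\<close> is not on the
  second.
\<close>

lemma reducible_square_zero:
  fixes \<alpha> w1 :: "complex ^ ('n::{finite,linorder} set)" and p :: "'n \<Rightarrow> 'n set"
  assumes \<alpha>: "\<alpha> \<in> ext_power 3" "free_of s \<alpha>" "\<alpha> \<noteq> 0"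
    and ker: "\<And>x. x \<in> ext_power 4 \<Longrightarrow> free_of s x \<Longrightarrow> \<alpha> \<and>\<^sub>E x = 0 \<Longrightarrow>
      (\<And>i. i \<noteq> s \<Longrightarrow> x $ p i = 0) \<Longrightarrow> x = 0"
    and inj: "\<And>u. u $ s = 0 \<Longrightarrow> ext_vec u \<and>\<^sub>E \<alpha> = 0 \<Longrightarrow> u = 0"
    and w1: "w1 \<in> ext_power 4" "w1 \<and>\<^sub>E w1 = 0"
    and w1_indiv: "\<And>v. ext_vec v \<and>\<^sub>E w1 = 0 \<Longrightarrow> v = 0"
  shows "reducible_variety (ext_power 4) (square_zero :: (complex ^ ('n set)) set set)"
proof -
  let ?w0 = "axis {s} 1 \<and>\<^sub>E \<alpha>"
  obtain d F where F: "homogeneous_form d F" "F ?w0 \<noteq> 0"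
    "\<And>w. w \<in> ext_power 4 \<Longrightarrow> w \<and>\<^sub>E w = 0 \<Longrightarrow> F w \<noteq> 0 \<Longrightarrow> \<exists>v. v \<noteq> 0 \<and> ext_vec v \<and>\<^sub>E w = 0"
    using generic_divisibility[OF \<alpha> ker inj] by blast
  obtain e G where G: "homogeneous_form e G" "G w1 \<noteq> 0"
    "\<And>w v. G w \<noteq> 0 \<Longrightarrow> ext_vec v \<and>\<^sub>E w = 0 \<Longrightarrow> v = 0"
  proof (rule generic_injective[of "\<lambda>w v. ext_vec v \<and>\<^sub>E w" w1])
    show "Vector_Spaces.linear (*s) (*s) (\<lambda>v. ext_vec v \<and>\<^sub>E w)" for w :: "complex ^ ('n set)"
      by (rule linearI_vec) (simp_all add: ext_vec_add ext_vec_scale wedge_add_left wedge_scale_left)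
    show "homogeneous_form 1 (\<lambda>w. (ext_vec x \<and>\<^sub>E w) $ j)" for x :: "(complex, 'n) vec" and j
      by (rule homogeneous_form_wedge_right) (rule homogeneous_form_coord)
  qed (use w1_indiv in blast)+
  define Q where "Q = range (\<lambda>R (w :: complex ^ ('n set)). (w \<and>\<^sub>E w) $ R)"
  have Q: "(\<forall>f\<in>Q. f w = 0) \<longleftrightarrow> w \<and>\<^sub>E w = 0" for w by (auto simp: Q_def vec_eq_iff)
  have Q_form: "\<exists>d. homogeneous_form d f" if "f \<in> Q" for f
    using that homogeneous_form_square unfolding Q_def by blast
  have locus: "zero_locus (ext_power 4) (Q \<union> H) =
      {proj_point w | w. w \<in> ext_power 4 \<and> w \<noteq> 0 \<and> w \<and>\<^sub>E w = 0 \<and> (\<forall>f\<in>H. f w = 0)}"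
    if H: "\<And>f. f \<in> H \<Longrightarrow> \<exists>d. homogeneous_form d f" for H
  proof (intro set_eqI)
    fix y
    have pt: "proj_point w \<in> zero_locus (ext_power 4) (Q \<union> H) \<longleftrightarrow> w \<and>\<^sub>E w = 0 \<and> (\<forall>f\<in>H. f w = 0)"
      if "w \<in> ext_power 4" "w \<noteq> 0" for w
    proof -
      have "proj_point w \<in> zero_locus (ext_power 4) (Q \<union> H) \<longleftrightarrow> (\<forall>f\<in>Q \<union> H. f w = 0)"
        using that H Q_form by (intro zero_locus_point) auto
      then show ?thesis using Q[of w] by blast
    qed
    have "y \<in> zero_locus (ext_power 4) (Q \<union> H) \<longrightarrow> (\<exists>w. y = proj_point w \<and> w \<in> ext_power 4 \<and> w \<noteq> 0)"
      unfolding zero_locus_def proj_def by blast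
    then show "y \<in> zero_locus (ext_power 4) (Q \<union> H) \<longleftrightarrow>
        y \<in> {proj_point w | w. w \<in> ext_power 4 \<and> w \<noteq> 0 \<and> w \<and>\<^sub>E w = 0 \<and> (\<forall>f\<in>H. f w = 0)}"
      using pt by blast
  qed
  have closed: "zariski_closed (ext_power 4) (zero_locus (ext_power 4) (Q \<union> H))"
    if "\<And>f. f \<in> H \<Longrightarrow> \<exists>d. homogeneous_form d f" for H
    unfolding zariski_closed_def
    by (intro exI[of _ "Q \<union> H"] conjI refl ballI) (use that Q_form in auto)
  let ?Y1 = "zero_locus (ext_power 4) (Q \<union> {G})" and ?Y2 = "zero_locus (ext_power 4) (Q \<union> {F})"
  have sz: "square_zero = zero_locus (ext_power 4) (Q \<union> {})"
    by (subst locus) (auto simp: square_zero_def)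
  have not_mem: "proj_point w \<notin> zero_locus (ext_power 4) (Q \<union> {f})" if "f w \<noteq> 0" for f w
    using that mem_proj_point unfolding zero_locus_def by blast
  have w1': "proj_point w1 \<in> square_zero"
  proof -
    have "w1 \<noteq> 0" using w1_indiv[of "axis s 1"] by (auto simp: axis_eq_0_iff)
    then show ?thesis using w1 unfolding square_zero_def by blast
  qed
  have w0': "proj_point ?w0 \<in> square_zero"
  proof -
    have "ext_vec (axis s 1) \<and>\<^sub>E \<alpha> \<in> ext_power (1 + 3)"
      by (rule ext_power_wedge[OF ext_vec_ext_power \<alpha>(1)])
    then have "?w0 \<in> ext_power 4" by (simp add: ext_vec_axis)
    moreover have "?w0 \<noteq> 0"
      using contract_wedge[OF \<alpha>(2)] \<alpha>(3) contract_zero by metis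
    moreover have "?w0 \<and>\<^sub>E ?w0 = 0"
      using annihilated_square_zero[of "axis s 1" ?w0 4] ext_vec_square_wedge[of "axis s 1" \<alpha>]
        \<open>?w0 \<in> ext_power 4\<close> by (simp add: ext_vec_axis)
    ultimately show ?thesis unfolding square_zero_def by blast
  qed
  have "square_zero = ?Y1 \<union> ?Y2"
  proof -
    have "G w = 0 \<or> F w = 0" if "w \<in> ext_power 4" "w \<and>\<^sub>E w = 0" for w
      using F(3)[OF that] G(3)[of w] by blast
    moreover have "?Y1 = {proj_point w | w. w \<in> ext_power 4 \<and> w \<noteq> 0 \<and> w \<and>\<^sub>E w = 0 \<and> G w = 0}"
      by (subst locus) (use G(1) in auto)
    moreover have "?Y2 = {proj_point w | w. w \<in> ext_power 4 \<and> w \<noteq> 0 \<and> w \<and>\<^sub>E w = 0 \<and> F w = 0}"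
      by (subst locus) (use F(1) in auto)
    ultimately show ?thesis unfolding square_zero_def by blast
  qed
  moreover have "?Y1 \<noteq> square_zero" using w1' not_mem[of G w1] G(2) by blast
  moreover have "?Y2 \<noteq> square_zero" using w0' not_mem[of F ?w0] F(2) by blast
  moreover have "zariski_closed (ext_power 4) (square_zero :: (complex ^ ('n set)) set set)"
    unfolding sz by (rule closed) simp
  moreover have "zariski_closed (ext_power 4) ?Y1" using G(1) by (intro closed) auto
  moreover have "zariski_closed (ext_power 4) ?Y2" using F(1) by (intro closed) auto
  ultimately show ?thesis unfolding reducible_variety_def by blast
qed

section \<open>Solving sparse equations in the exterior algebra\<close>

text \<open>
  Index sets are represented by increasing lists of integers, on which the sparse equations can be
  checked by rewriting.
\<close>

definition set_diff :: "int list \<Rightarrow> int list \<Rightarrow> int list" where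
  "set_diff R t = filter (\<lambda>i. i \<notin> set t) R"

definition sgn_list :: "int list \<Rightarrow> int list \<Rightarrow> int" where
  "sgn_list t u = (if even (length (filter (\<lambda>(i, j). j < i) (List.product t u))) then 1 else - 1)"

text \<open>
  The equation for the coefficient of \<open>e\<^sub>R\<close> in the product of \<open>\<Sum>\<^sub>t e\<^sub>t\<close> with \<open>\<Sum>\<^sub>T f T e\<^sub>T\<close>.
\<close>

definition equation_sum :: "int list list \<Rightarrow> (int list \<Rightarrow> int) \<Rightarrow> int list \<Rightarrow> int" where
  "equation_sum ts f R =
    (\<Sum>t\<leftarrow>filter (\<lambda>t. set t \<subseteq> set R) ts. sgn_list t (set_diff R t) * f (set_diff R t))"

text \<open>
  An entry \<open>(k, t, c)\<close> of \<open>tab\<close> at a quadruple \<open>T\<close> asserts that the unknown \<open>x\<^sub>T\<close> is \<open>c\<close> times the unknown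
  \<open>x\<^sub>q\<close>.  For \<open>k > 0\<close> this follows from the equation at the set \<open>T \<union> t\<close>, since all its other unknowns
  have entries with a smaller \<open>k\<close>.  For \<open>k = 0\<close> either \<open>T\<close> is \<open>q\<close> or \<open>x\<^sub>T\<close> is assumed to be zero.
\<close>

definition elimination_step_ok :: "int list list \<Rightarrow> (int list \<Rightarrow> int \<times> int list \<times> int) \<Rightarrow> int list list \<Rightarrow>
    int list \<Rightarrow> int list \<Rightarrow> bool" where
  "elimination_step_ok ts tab P q T =
    (case tab T of (k, t, c) \<Rightarrow>
      if k = 0 then T \<in> set P \<and> c = 0 \<or> T = q \<and> c = 1
      else k > 0 \<and> t \<in> set ts \<and> set t \<inter> set T = {} \<and>
        (let R = sort (T @ t) in
          list_all (\<lambda>t'. set t' \<subseteq> set R \<longrightarrow> t' = t \<or> fst (tab (set_diff R t')) < k) ts \<and>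
          equation_sum ts (\<lambda>T. snd (snd (tab T))) R = 0))"

definition quadruples :: "int list list" where
  "quadruples = [[a, b, c, d]. a \<leftarrow> [0..7], b \<leftarrow> [a+1..8], c \<leftarrow> [b+1..9], d \<leftarrow> [c+1..10]]"

text \<open>
  The map \<open>e\<close> numbers the twelve basis vectors, \<open>e 11\<close> being the one that is split off.  Since it is
  increasing, signs can be computed from the numbers.
\<close>

context
  fixes e :: "int \<Rightarrow> 'n::{finite,linorder}"
  assumes mono: "strict_mono_on {0..11} e"
begin

lemma enumeration_inj: "inj_on e {0..11}"
  using mono by (rule strict_mono_on_imp_inj_on)

lemma enumeration_less: "i \<in> {0..11} \<Longrightarrow> j \<in> {0..11} \<Longrightarrow> e i < e j \<longleftrightarrow> i < j"
  using strict_mono_on_less[OF mono] by blast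

lemma image_set_diff:
  assumes "set t \<subseteq> {0..11}" "set R \<subseteq> {0..11}"
  shows "e ` set (set_diff R t) = e ` set R - e ` set t"
  using assms inj_on_image_set_diff[OF enumeration_inj, of "set R" "set t"]
  by (auto simp: set_diff_def set_diff_eq intro!: arg_cong[of _ _ "(`) e"])

lemma shuffle_sign_list:
  assumes "distinct t" "distinct u" "set t \<subseteq> {0..11}" "set u \<subseteq> {0..11}"
  shows "shuffle_sign (e ` set t) (e ` set u) = of_int (sgn_list t u)"
proof -
  let ?l = "filter (\<lambda>(i, j). j < i) (List.product t u)"
  have "{(x, y). x \<in> e ` set t \<and> y \<in> e ` set u \<and> y < x} = map_prod e e ` set ?l"
    using assms(3,4) enumeration_less by (force simp: image_iff)
  moreover have "inj_on (map_prod e e) (set ?l)"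
  proof (rule inj_on_subset)
    show "inj_on (map_prod e e) ({0..11} \<times> {0..11})" by (intro map_prod_inj_on enumeration_inj)
    show "set ?l \<subseteq> {0..11} \<times> {0..11}" using assms(3,4) by auto
  qed
  ultimately have "card {(x, y). x \<in> e ` set t \<and> y \<in> e ` set u \<and> y < x} = card (set ?l)"
    by (simp only: card_image)
  also have "\<dots> = length ?l"
    using assms(1,2) by (intro distinct_card) (simp add: distinct_product)
  finally have "card {(x, y). x \<in> e ` set t \<and> y \<in> e ` set u \<and> y < x} = length ?l" .
  then show ?thesis by (simp add: shuffle_sign_def sgn_list_def)
qed

definition monomial_sum :: "int list list \<Rightarrow> complex ^ ('n set)" where
  "monomial_sum ts = (\<Sum>t\<leftarrow>ts. axis (e ` set t) 1)"

definition equation_term :: "complex ^ ('n set) \<Rightarrow> int list \<Rightarrow> int list \<Rightarrow> complex" where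
  "equation_term x R t = (if set t \<subseteq> set R then of_int (sgn_list t (set_diff R t)) * x $ (e ` set (set_diff R t)) else 0)"

lemma monomial_sum_wedge:
  assumes "\<And>t. t \<in> set ts \<Longrightarrow> distinct t \<and> set t \<subseteq> {0..11}" "distinct R" "set R \<subseteq> {0..11}"
  shows "(monomial_sum ts \<and>\<^sub>E x) $ (e ` set R) = (\<Sum>t\<leftarrow>ts. equation_term x R t)"
  using assms(1)
proof (induction ts)
  case (Cons t ts)
  then have t: "distinct t" "set t \<subseteq> {0..11}" by auto
  have "e ` set t \<subseteq> e ` set R \<longleftrightarrow> set t \<subseteq> set R"
    using enumeration_inj t(2) assms(3) by (rule inj_on_image_subset_iff)
  moreover have "shuffle_sign (e ` set t) (e ` set R - e ` set t) = of_int (sgn_list t (set_diff R t))"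
    using shuffle_sign_list[of t "set_diff R t"] t assms(2,3) image_set_diff[OF t(2) assms(3)]
    by (auto simp: set_diff_def)
  ultimately have "(axis (e ` set t) 1 \<and>\<^sub>E x) $ (e ` set R) = equation_term x R t"
    by (simp add: wedge_axis_left equation_term_def image_set_diff[OF t(2) assms(3)])
  with Cons show ?case by (simp add: monomial_sum_def wedge_add_left)
qed (simp add: monomial_sum_def)

context
  fixes ts x tab P q
  assumes ts: "\<And>t. t \<in> set ts \<Longrightarrow> length t = 3 \<and> distinct t \<and> set t \<subseteq> {0..10}" "distinct ts"
    and zero: "monomial_sum ts \<and>\<^sub>E x = 0"
    and rows: "list_all (elimination_step_ok ts tab P q) quadruples"
    and P: "\<And>p. p \<in> set P \<Longrightarrow> x $ (e ` set p) = 0"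
begin

lemma equation_at:
  assumes "distinct R" "set R \<subseteq> {0..10}"
  shows "(\<Sum>t\<in>{t \<in> set ts. set t \<subseteq> set R}.
    of_int (sgn_list t (set_diff R t)) * x $ (e ` set (set_diff R t))) = 0"
proof -
  have "set R \<subseteq> {0..11}" using assms(2) by auto
  moreover have "distinct t \<and> set t \<subseteq> {0..11}" if "t \<in> set ts" for t
    using ts(1)[OF that] by auto
  ultimately have "(\<Sum>t\<leftarrow>ts. equation_term x R t) = 0"
    using monomial_sum_wedge[of ts R x] assms(1) zero by simp
  then have "(\<Sum>t\<in>set ts. equation_term x R t) = 0"
    using ts(2) by (simp add: sum_list_distinct_conv_sum_set)
  then show ?thesis
    by (simp add: equation_term_def sum.inter_filter)
qed

lemma equation_sum_eq:
  "of_int (equation_sum ts f R) =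
    (\<Sum>t\<in>{t \<in> set ts. set t \<subseteq> set R}. of_int (sgn_list t (set_diff R t)) * of_int (f (set_diff R t)) :: complex)"
  using ts(2) by (simp add: equation_sum_def sum_list_distinct_conv_sum_set)

lemma mem_quadruples:
  assumes "sorted_wrt (<) T" "set T \<subseteq> {0..10}" "length T = 4"
  shows "T \<in> set quadruples"
proof -
  obtain a b c d where T: "T = [a, b, c, d]"
    using assms(3) by (auto simp: numeral_eq_Suc length_Suc_conv)
  then have "a \<in> set [0..7]" "b \<in> set [a+1..8]" "c \<in> set [b+1..9]" "d \<in> set [c+1..10]"
    using assms(1,2) by auto
  moreover have "z \<in> set (concat (map f ys))" if "y \<in> set ys" "z \<in> set (f y)" for z y f and ys :: "int list"
    using that by auto
  ultimately show ?thesis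
    unfolding quadruples_def T by (metis (no_types, lifting) image_eqI set_map)
qed

text \<open>
  By induction on the first component of the entries: the solution \<open>x\<close> and the multiples recorded in
  the table satisfy the same equation at \<open>T \<union> t\<close>, and their other terms agree.
\<close>

lemma coefficient_multiple:
  assumes "sorted_wrt (<) T" "set T \<subseteq> {0..10}" "length T = 4"
  shows "x $ (e ` set T) = of_int (snd (snd (tab T))) * x $ (e ` set q)"
  using assms
proof (induction "nat (fst (tab T))" arbitrary: T rule: less_induct)
  case less
  obtain k t c where tab: "tab T = (k, t, c)" by (cases "tab T")
  have row: "elimination_step_ok ts tab P q T"
    using rows mem_quadruples less.prems by (simp add: list_all_iff)
  show ?case
  proof (cases "k = 0")
    case True
    then show ?thesis using row P by (auto simp: elimination_step_ok_def tab)
  next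
    case False
    define R where "R = sort (T @ t)"
    let ?C = "\<lambda>T. snd (snd (tab T))"
    have t: "t \<in> set ts" "set t \<inter> set T = {}" and "k > 0"
      and smaller: "\<And>t'. t' \<in> set ts \<Longrightarrow> set t' \<subseteq> set R \<Longrightarrow> t' \<noteq> t \<Longrightarrow> fst (tab (set_diff R t')) < k"
      and sum0: "equation_sum ts ?C R = 0"
      using row False by (auto simp: elimination_step_ok_def tab R_def Let_def list_all_iff)
    have dT: "distinct T" "sorted T" using less.prems(1) by (simp_all add: strict_sorted_iff)
    have R: "sorted_wrt (<) R" "set R = set T \<union> set t" "length R = 7" "set R \<subseteq> {0..10}"
      using t ts(1)[OF t(1)] dT less.prems by (auto simp: R_def strict_sorted_iff)
    have diff: "sorted_wrt (<) (set_diff R t')" "set (set_diff R t') \<subseteq> {0..10}" "length (set_diff R t') = 4"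
      if "t' \<in> set ts" "set t' \<subseteq> set R" for t'
    proof -
      show "sorted_wrt (<) (set_diff R t')" unfolding set_diff_def by (rule sorted_wrt_filter[OF R(1)])
      show "set (set_diff R t') \<subseteq> {0..10}" using R(4) by (auto simp: set_diff_def)
      have "distinct R" using R(1) by (simp add: strict_sorted_iff)
      then have "length (set_diff R t') = card (set R - set t')"
        by (subst distinct_card[symmetric]) (auto simp: set_diff_def set_diff_eq)
      also have "\<dots> = 7 - 3"
        using that ts(1)[OF that(1)] R(3) \<open>distinct R\<close> by (simp add: card_Diff_subset distinct_card)
      finally show "length (set_diff R t') = 4" by simp
    qed
    have "set T = set (set_diff R t)" using R(2) t(2) by (auto simp: set_diff_def)
    then have T: "set_diff R t = T"
      using diff(1)[OF t(1)] R(2) less.prems(1) strict_sorted_equal by blast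
    let ?y = "x $ (e ` set q)" and ?s = "\<lambda>t'. of_int (sgn_list t' (set_diff R t')) :: complex"
    let ?d = "\<lambda>t'. ?s t' * (x $ (e ` set (set_diff R t')) - of_int (?C (set_diff R t')) * ?y)"
    have "distinct R" using R(1) by (simp add: strict_sorted_iff)
    have "(\<Sum>t'\<in>{t \<in> set ts. set t \<subseteq> set R}. ?d t') =
        (\<Sum>t'\<in>{t \<in> set ts. set t \<subseteq> set R}. ?s t' * x $ (e ` set (set_diff R t'))) -
        of_int (equation_sum ts ?C R) * ?y"
      unfolding equation_sum_eq by (simp add: sum_subtractf sum_distrib_left right_diff_distrib mult_ac)
    also have "\<dots> = 0"
      using equation_at[OF \<open>distinct R\<close> R(4)] sum0 by simp
    also have "(\<Sum>t'\<in>{t \<in> set ts. set t \<subseteq> set R}. ?d t') = (\<Sum>t'\<in>{t}. ?d t')"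
    proof (rule sum.mono_neutral_right)
      show "\<forall>t'\<in>{t \<in> set ts. set t \<subseteq> set R} - {t}. ?d t' = 0"
      proof
        fix t' assume t': "t' \<in> {t \<in> set ts. set t \<subseteq> set R} - {t}"
        have "nat (fst (tab (set_diff R t'))) < nat (fst (tab T))"
          using smaller[of t'] t' \<open>k > 0\<close> by (simp add: tab)
        then have "x $ (e ` set (set_diff R t')) = of_int (?C (set_diff R t')) * ?y"
          using t' diff by (intro less.hyps) auto
        then show "?d t' = 0" by simp
      qed
    qed (use t R(2) in auto)
    finally have "x $ (e ` set T) - of_int (?C T) * ?y = 0"
      by (simp add: T sgn_list_def split: if_splits)
    then show ?thesis by simp
  qed
qed

text \<open>
  An equation that the recorded multiples do not satisfy forces \<open>x\<^sub>q = 0\<close>.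
\<close>

lemma coefficients_zero:
  assumes R: "sorted_wrt (<) R" "set R \<subseteq> {0..10}" "length R = 7"
    and nz: "equation_sum ts (\<lambda>T. snd (snd (tab T))) R \<noteq> 0"
    and S: "S \<subseteq> e ` {0..10}" "card S = 4"
  shows "x $ S = 0"
proof -
  let ?y = "x $ (e ` set q)" and ?C = "\<lambda>T. snd (snd (tab T))"
  have "distinct R" using R(1) by (simp add: strict_sorted_iff)
  have eq: "of_int (sgn_list t (set_diff R t)) * x $ (e ` set (set_diff R t)) =
      of_int (sgn_list t (set_diff R t)) * of_int (?C (set_diff R t)) * ?y"
    if "t \<in> {t \<in> set ts. set t \<subseteq> set R}" for t
  proof -
    have "sorted_wrt (<) (set_diff R t)" unfolding set_diff_def by (rule sorted_wrt_filter[OF R(1)])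
    moreover have "set (set_diff R t) \<subseteq> {0..10}" using R(2) by (auto simp: set_diff_def)
    moreover have "length (set_diff R t) = card (set R - set t)"
      using \<open>distinct R\<close> by (subst distinct_card[symmetric]) (auto simp: set_diff_def set_diff_eq)
    then have "length (set_diff R t) = 4"
      using that ts(1)[of t] R(3) \<open>distinct R\<close> by (simp add: card_Diff_subset distinct_card)
    ultimately show ?thesis using coefficient_multiple by (simp add: mult.assoc)
  qed
  have "of_int (equation_sum ts ?C R) * ?y = (\<Sum>t\<in>{t \<in> set ts. set t \<subseteq> set R}.
      of_int (sgn_list t (set_diff R t)) * x $ (e ` set (set_diff R t)))"
    unfolding equation_sum_eq sum_distrib_right by (intro sum.cong refl eq[symmetric])
  also have "\<dots> = 0" using \<open>distinct R\<close> R(2) by (rule equation_at)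
  finally have "of_int (equation_sum ts ?C R) * ?y = 0" .
  then have y: "?y = 0" using nz by simp
  obtain S' where S': "S' \<subseteq> {0..10}" "S = e ` S'" using S(1) by (meson subset_imageE)
  have "finite S'" using S'(1) finite_subset by blast
  have "inj_on e S'" using enumeration_inj by (rule inj_on_subset) (use S'(1) in auto)
  then have "card S' = 4" using S(2) S'(2) by (simp add: card_image)
  then have "x $ (e ` set (sorted_list_of_set S')) = 0"
    using coefficient_multiple[of "sorted_list_of_set S'"] y S'(1) \<open>finite S'\<close> by simp
  then show ?thesis using S'(2) \<open>finite S'\<close> by simp
qed

end

end

section \<open>A generic trivector in eleven variables\<close>

fun pick :: "int \<Rightarrow> 'a list \<Rightarrow> 'a" where
  "pick i [] = undefined"
| "pick i (x # xs) = (if i = 0 then x else pick (i - 1) xs)"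

text \<open>
  A trivector for which the kernel consists of the products \<open>u \<and> \<alpha>\<close>, and eleven coordinates that
  determine such a product.
\<close>

definition sparse_triples :: "int list list" where
  "sparse_triples = [
    [0, 1, 2], [0, 3, 4], [0, 7, 10], [1, 4, 10], [2, 3, 9], [2, 4, 8], [2, 5, 10], [2, 9, 10],
      [3, 5, 8], [3, 7, 10], [3, 9, 10], [4, 5, 6], [4, 8, 9], [4, 9, 10], [5, 6, 10], [6, 7, 9]]"

definition normalizing_quads :: "int list list" where
  "normalizing_quads = [
    [0, 1, 4, 10], [2, 3, 5, 8], [2, 3, 5, 10], [3, 7, 9, 10], [0, 1, 2, 8], [3, 5, 7, 10],
      [0, 1, 2, 9], [0, 6, 7, 10], [0, 4, 7, 10], [0, 1, 7, 10], [0, 1, 2, 10]]"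

text \<open>
  Normalizing eleven coordinates to zero does not yet allow every unknown to be found from an
  equation in which it is the only one left.  If the equation at a set of seven indices is labelled by
  the complementary quadruple, it involves only quadruples disjoint from its label, in a symmetric
  way.  So modulo 2 the matrix of the equations is symmetric with zero diagonal and has even rank,
  whereas such an elimination would give a triangular minor of odd size 319 with entries \<open>\<plusminus>1\<close> on the
  diagonal.  Therefore the value at the quadruple \<open>0567\<close> is carried along as a parameter, with the
  multiples in the third components, until an equation forces it to be zero.
\<close>

definition table_entry :: "int \<Rightarrow> int \<Rightarrow> int \<Rightarrow> int \<Rightarrow> int \<times> int list \<times> int" where
  "table_entry a b c d = (
    if a = 0 then (
     if b = 1 then (
      if c = 2 then (
       pick (d - 3) [(27, [6, 7, 9], -5), (17, [3, 5, 8], -2), (5, [3, 7, 10], 0),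
         (12, [3, 7, 10], -2), (10, [3, 9, 10], 1), (0, [], 0), (0, [], 0), (0, [], 0)])
      else if c = 3 then (
       pick (d - 4) [(4, [6, 7, 9], 0), (1, [6, 7, 9], 0), (7, [4, 8, 9], 0), (4, [4, 5, 6], 0),
         (1, [6, 7, 9], 0), (3, [5, 6, 10], 0), (11, [6, 7, 9], 2)])
      else if c = 4 then (
       pick (d - 5) [(2, [6, 7, 9], 0), (3, [3, 5, 8], 0), (7, [3, 5, 8], 0), (2, [6, 7, 9], 0),
         (2, [3, 5, 8], 0), (0, [], 0)])
      else if c = 5 then (
       pick (d - 6) [(2, [4, 8, 9], 0), (1, [4, 8, 9], 0), (1, [6, 7, 9], 0),
         (23, [3, 7, 10], 10), (5, [6, 7, 9], 0)])
      else if c = 6 then (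
       pick (d - 7) [(1, [3, 5, 8], 0), (1, [3, 9, 10], 0), (1, [3, 5, 8], 0), (2, [3, 5, 8], 0)])
      else if c = 7 then (
       pick (d - 8) [(1, [4, 5, 6], 0), (1, [3, 5, 8], 0), (0, [], 0)])
      else if c = 8 then (
       pick (d - 9) [(1, [5, 6, 10], 0), (7, [6, 7, 9], 0)])
      else (
       pick (d - 10) [(2, [3, 5, 8], 0)]))
     else if b = 2 then (
      if c = 3 then (
       pick (d - 4) [(16, [6, 7, 9], -2), (1, [6, 7, 9], -1), (10, [4, 8, 9], 0),
         (22, [5, 6, 10], 6), (4, [6, 7, 9], 0), (13, [5, 6, 10], -1), (22, [6, 7, 9], -6)])
      else if c = 4 then (
       pick (d - 5) [(9, [6, 7, 9], 0), (13, [3, 5, 8], 0), (20, [3, 5, 8], -4),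
         (8, [6, 7, 9], 0), (18, [3, 5, 8], -8), (28, [3, 5, 8], -19)])
      else if c = 5 then (
       pick (d - 6) [(10, [4, 8, 9], 0), (28, [4, 8, 9], 2), (1, [6, 7, 9], 0),
         (29, [3, 7, 10], -58), (21, [6, 7, 9], -12)])
      else if c = 6 then (
       pick (d - 7) [(1, [3, 5, 8], 0), (5, [3, 7, 10], 0), (9, [3, 5, 8], 0), (5, [3, 5, 8], 0)])
      else if c = 7 then (
       pick (d - 8) [(1, [4, 5, 6], -1), (8, [3, 5, 8], 0), (15, [3, 5, 8], -2)])
      else if c = 8 then (
       pick (d - 9) [(9, [5, 6, 10], 0), (5, [6, 7, 9], 0)])
      else (
       pick (d - 10) [(16, [3, 5, 8], -3)]))
     else if b = 3 then (
      if c = 4 then (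
       pick (d - 5) [(27, [6, 7, 9], -22), (29, [2, 9, 10], 8), (29, [2, 5, 10], -5),
         (20, [6, 7, 9], -2), (33, [5, 6, 10], -23), (20, [6, 7, 9], 1)])
      else if c = 5 then (
       pick (d - 6) [(12, [1, 4, 10], -1), (19, [1, 4, 10], 2), (7, [1, 4, 10], 0),
         (17, [1, 4, 10], 6), (27, [6, 7, 9], 21)])
      else if c = 6 then (
       pick (d - 7) [(19, [2, 4, 8], 2), (4, [1, 4, 10], 0), (8, [1, 4, 10], 0),
         (10, [4, 8, 9], 0)])
      else if c = 7 then (
       pick (d - 8) [(14, [5, 6, 10], 2), (26, [2, 4, 8], 22), (30, [4, 5, 6], -11)])
      else if c = 8 then (
       pick (d - 9) [(11, [5, 6, 10], 0), (4, [6, 7, 9], 0)])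
      else (
       pick (d - 10) [(32, [2, 4, 8], 12)]))
     else if b = 4 then (
      if c = 5 then (
       pick (d - 6) [(19, [2, 9, 10], -12), (28, [2, 3, 9], 2), (15, [6, 7, 9], -2),
         (29, [3, 7, 10], -8), (21, [6, 7, 9], -3)])
      else if c = 6 then (
       pick (d - 7) [(15, [3, 5, 8], 2), (9, [3, 7, 10], 0), (13, [3, 5, 8], 1),
         (21, [3, 5, 8], 2)])
      else if c = 7 then (
       pick (d - 8) [(25, [2, 5, 10], -16), (20, [3, 5, 8], -2), (0, [], 0)])
      else if c = 8 then (
       pick (d - 9) [(31, [3, 7, 10], 12), (14, [6, 7, 9], -2)])
      else (
       pick (d - 10) [(28, [3, 5, 8], 23)]))
     else if b = 5 then (
      if c = 6 then (
       pick (d - 7) [(0, [], 1), (8, [1, 4, 10], 0), (3, [1, 4, 10], 0), (10, [2, 4, 8], 0)])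
      else if c = 7 then (
       pick (d - 8) [(7, [1, 4, 10], 0), (27, [1, 4, 10], 2), (24, [4, 8, 9], 10)])
      else if c = 8 then (
       pick (d - 9) [(6, [1, 4, 10], 0), (15, [6, 7, 9], -3)])
      else (
       pick (d - 10) [(32, [2, 4, 8], 22)]))
     else if b = 6 then (
      if c = 7 then (
       pick (d - 8) [(3, [1, 4, 10], 0), (7, [1, 4, 10], 0), (0, [], 0)])
      else if c = 8 then (
       pick (d - 9) [(3, [1, 4, 10], 0), (6, [2, 3, 9], 0)])
      else (
       pick (d - 10) [(10, [2, 4, 8], 0)]))
     else if b = 7 then (
      if c = 8 then (
       pick (d - 9) [(14, [1, 4, 10], -3), (26, [4, 5, 6], -16)])
      else (
       pick (d - 10) [(8, [3, 5, 8], 0)]))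
     else (
      pick (d - 10) [(32, [4, 5, 6], 12)]))
    else if a = 1 then (
     if b = 2 then (
      if c = 3 then (
       pick (d - 4) [(18, [6, 7, 9], 2), (4, [6, 7, 9], 0), (11, [4, 8, 9], -2),
         (1, [4, 5, 6], 0), (2, [6, 7, 9], 0), (9, [4, 5, 6], -1), (18, [6, 7, 9], 2)])
      else if c = 4 then (
       pick (d - 5) [(8, [6, 7, 9], 0), (6, [3, 5, 8], 0), (24, [5, 6, 10], 2), (4, [6, 7, 9], 0),
         (21, [5, 6, 10], 10), (18, [6, 7, 9], 2)])
      else if c = 5 then (
       pick (d - 6) [(2, [3, 7, 10], 0), (2, [4, 8, 9], 0), (1, [6, 7, 9], 0),
         (26, [3, 7, 10], 4), (8, [6, 7, 9], 0)])
      else if c = 6 then (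
       pick (d - 7) [(1, [3, 5, 8], 0), (1, [3, 7, 10], 0), (3, [3, 5, 8], 0), (3, [3, 5, 8], 0)])
      else if c = 7 then (
       pick (d - 8) [(2, [5, 6, 10], 0), (7, [3, 5, 8], 0), (17, [3, 5, 8], 2)])
      else if c = 8 then (
       pick (d - 9) [(5, [4, 5, 6], 0), (2, [6, 7, 9], 0)])
      else (
       pick (d - 10) [(7, [3, 5, 8], 0)]))
     else if b = 3 then (
      if c = 4 then (
       pick (d - 5) [(18, [6, 7, 9], 2), (20, [0, 7, 10], 4), (18, [5, 6, 10], -8),
         (2, [6, 7, 9], 0), (27, [0, 7, 10], -22), (27, [6, 7, 9], -3)])
      else if c = 5 then (
       pick (d - 6) [(5, [0, 7, 10], 0), (25, [2, 4, 8], -2), (2, [0, 7, 10], 0),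
         (22, [2, 4, 8], -10), (18, [6, 7, 9], -2)])
      else if c = 6 then (
       pick (d - 7) [(1, [2, 4, 8], 0), (2, [0, 7, 10], 0), (10, [2, 5, 10], -2),
         (3, [4, 8, 9], 0)])
      else if c = 7 then (
       pick (d - 8) [(16, [2, 9, 10], -2), (17, [2, 4, 8], -2), (17, [4, 8, 9], 7)])
      else if c = 8 then (
       pick (d - 9) [(2, [0, 7, 10], 0), (7, [6, 7, 9], 0)])
      else (
       pick (d - 10) [(28, [4, 5, 6], 21)]))
     else if b = 4 then (
      if c = 5 then (
       pick (d - 6) [(8, [0, 7, 10], -1), (1, [2, 3, 9], 0), (6, [6, 7, 9], 0),
         (26, [3, 7, 10], 2), (27, [6, 7, 9], 2)])
      else if c = 6 then (
       pick (d - 7) [(17, [3, 5, 8], -2), (2, [3, 7, 10], 0), (6, [3, 5, 8], 0),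
         (14, [3, 5, 8], 2)])
      else if c = 7 then (
       pick (d - 8) [(16, [5, 6, 10], 2), (26, [3, 5, 8], 2), (12, [3, 5, 8], -1)])
      else if c = 8 then (
       pick (d - 9) [(13, [5, 6, 10], 3), (18, [6, 7, 9], 2)])
      else (
       pick (d - 10) [(19, [3, 5, 8], -2)]))
     else if b = 5 then (
      if c = 6 then (
       pick (d - 7) [(3, [2, 4, 8], 0), (2, [0, 7, 10], 0), (4, [0, 3, 4], 0), (5, [2, 4, 8], 1)])
      else if c = 7 then (
       pick (d - 8) [(6, [2, 9, 10], 0), (1, [0, 3, 4], 0), (7, [4, 8, 9], 0)])
      else if c = 8 then (
       pick (d - 9) [(1, [0, 7, 10], 0), (6, [6, 7, 9], 0)])
      else (
       pick (d - 10) [(16, [2, 4, 8], 6)]))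
     else if b = 6 then (
      if c = 7 then (
       pick (d - 8) [(1, [0, 3, 4], 0), (3, [3, 5, 8], 0), (17, [3, 5, 8], -2)])
      else if c = 8 then (
       pick (d - 9) [(6, [2, 5, 10], 0), (3, [2, 3, 9], 0)])
      else (
       pick (d - 10) [(3, [3, 5, 8], 0)]))
     else if b = 7 then (
      if c = 8 then (
       pick (d - 9) [(5, [0, 3, 4], 0), (15, [0, 3, 4], 2)])
      else (
       pick (d - 10) [(7, [3, 5, 8], 0)]))
     else (
      pick (d - 10) [(12, [0, 3, 4], 2)]))
    else if a = 2 then (
     if b = 3 then (
      if c = 4 then (
       pick (d - 5) [(26, [6, 7, 9], 0), (20, [0, 7, 10], 8), (34, [5, 6, 10], 10),
         (27, [6, 7, 9], -5), (30, [0, 7, 10], 5), (29, [6, 7, 9], 24)])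
      else if c = 5 then (
       pick (d - 6) [(21, [1, 4, 10], -4), (19, [1, 4, 10], 8), (0, [], 0), (28, [1, 4, 10], 26),
         (0, [], 0)])
      else if c = 6 then (
       pick (d - 7) [(7, [1, 4, 10], 0), (4, [1, 4, 10], 0), (21, [1, 4, 10], 4),
         (14, [4, 8, 9], -2)])
      else if c = 7 then (
       pick (d - 8) [(18, [1, 4, 10], -7), (25, [1, 4, 10], -1), (33, [4, 8, 9], -2)])
      else if c = 8 then (
       pick (d - 9) [(27, [0, 7, 10], -13), (19, [6, 7, 9], -2)])
      else (
       pick (d - 10) [(31, [4, 5, 6], 4)]))
     else if b = 4 then (
      if c = 5 then (
       pick (d - 6) [(21, [0, 7, 10], 8), (30, [3, 9, 10], 8), (24, [6, 7, 9], 6),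
         (29, [0, 7, 10], 2), (24, [6, 7, 9], -17)])
      else if c = 6 then (
       pick (d - 7) [(19, [3, 5, 8], -7), (1, [0, 7, 10], 0), (28, [3, 5, 8], 17),
         (29, [3, 5, 8], 2)])
      else if c = 7 then (
       pick (d - 8) [(32, [5, 6, 10], 5), (20, [3, 5, 8], -8), (25, [3, 5, 8], -6)])
      else if c = 8 then (
       pick (d - 9) [(26, [0, 7, 10], -13), (20, [6, 7, 9], 6)])
      else (
       pick (d - 10) [(29, [3, 5, 8], -3)]))
     else if b = 5 then (
      if c = 6 then (
       pick (d - 7) [(23, [0, 3, 4], 6), (4, [0, 7, 10], -1), (20, [0, 3, 4], 11),
         (30, [0, 3, 4], -12)])
      else if c = 7 then (
       pick (d - 8) [(17, [1, 4, 10], -2), (27, [1, 4, 10], -2), (28, [4, 8, 9], 5)])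
      else if c = 8 then (
       pick (d - 9) [(15, [0, 7, 10], 3), (19, [6, 7, 9], 0)])
      else (
       pick (d - 10) [(34, [0, 3, 4], -3)]))
     else if b = 6 then (
      if c = 7 then (
       pick (d - 8) [(18, [1, 4, 10], 2), (2, [3, 5, 8], 0), (19, [3, 5, 8], -8)])
      else if c = 8 then (
       pick (d - 9) [(4, [1, 4, 10], 0), (11, [0, 3, 4], 0)])
      else (
       pick (d - 10) [(28, [3, 5, 8], 10)]))
     else if b = 7 then (
      if c = 8 then (
       pick (d - 9) [(18, [1, 4, 10], 0), (31, [0, 3, 4], 6)])
      else (
       pick (d - 10) [(18, [3, 5, 8], 2)]))
     else (
      pick (d - 10) [(31, [4, 5, 6], 2)]))
    else if a = 3 then (
     if b = 4 then (
      if c = 5 then (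
       pick (d - 6) [(28, [0, 1, 2], 5), (3, [0, 1, 2], 0), (16, [0, 7, 10], -2),
         (27, [0, 1, 2], -4), (9, [0, 1, 2], 1)])
      else if c = 6 then (
       pick (d - 7) [(2, [0, 1, 2], 0), (8, [0, 1, 2], 0), (4, [0, 1, 2], 0), (11, [0, 1, 2], 0)])
      else if c = 7 then (
       pick (d - 8) [(5, [0, 1, 2], 0), (8, [0, 1, 2], 0), (23, [0, 1, 2], -12)])
      else if c = 8 then (
       pick (d - 9) [(28, [0, 1, 2], 5), (12, [0, 1, 2], -2)])
      else (
       pick (d - 10) [(28, [0, 1, 2], 4)]))
     else if b = 5 then (
      if c = 6 then (
       pick (d - 7) [(1, [0, 1, 2], 0), (13, [0, 1, 2], 2), (3, [0, 1, 2], 0), (28, [0, 1, 2], 5)])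
      else if c = 7 then (
       pick (d - 8) [(11, [0, 1, 2], -1), (2, [0, 1, 2], 0), (0, [], 0)])
      else if c = 8 then (
       pick (d - 9) [(2, [0, 1, 2], 0), (2, [0, 1, 2], 0)])
      else (
       pick (d - 10) [(6, [0, 1, 2], 0)]))
     else if b = 6 then (
      if c = 7 then (
       pick (d - 8) [(1, [0, 1, 2], 0), (26, [2, 5, 10], 5), (2, [2, 4, 8], 0)])
      else if c = 8 then (
       pick (d - 9) [(2, [0, 1, 2], 0), (1, [0, 1, 2], 0)])
      else (
       pick (d - 10) [(13, [0, 1, 2], -2)]))
     else if b = 7 then (
      if c = 8 then (
       pick (d - 9) [(2, [0, 1, 2], 0), (3, [0, 1, 2], 0)])
      else (
       pick (d - 10) [(0, [], 0)]))
     else (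
      pick (d - 10) [(8, [0, 1, 2], 0)]))
    else if a = 4 then (
     if b = 5 then (
      if c = 6 then (
       pick (d - 7) [(10, [3, 9, 10], 1), (3, [0, 1, 2], 0), (1, [0, 1, 2], 0),
         (18, [0, 1, 2], 2)])
      else if c = 7 then (
       pick (d - 8) [(2, [0, 1, 2], 0), (1, [0, 1, 2], 0), (29, [0, 1, 2], 2)])
      else if c = 8 then (
       pick (d - 9) [(23, [3, 7, 10], 10), (6, [0, 1, 2], 0)])
      else (
       pick (d - 10) [(30, [0, 1, 2], -58)]))
     else if b = 6 then (
      if c = 7 then (
       pick (d - 8) [(2, [0, 1, 2], 0), (17, [3, 5, 8], 2), (6, [3, 5, 8], 0)])
      else if c = 8 then (
       pick (d - 9) [(13, [0, 1, 2], -2), (6, [0, 1, 2], 0)])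
      else (
       pick (d - 10) [(13, [0, 1, 2], -2)]))
     else if b = 7 then (
      if c = 8 then (
       pick (d - 9) [(11, [0, 1, 2], 1), (5, [0, 1, 2], -1)])
      else (
       pick (d - 10) [(22, [0, 1, 2], 11)]))
     else (
      pick (d - 10) [(10, [0, 1, 2], 0)]))
    else if a = 5 then (
     if b = 6 then (
      if c = 7 then (
       pick (d - 8) [(1, [0, 1, 2], 0), (6, [0, 1, 2], 0), (11, [0, 1, 2], -1)])
      else if c = 8 then (
       pick (d - 9) [(1, [0, 1, 2], 0), (2, [0, 1, 2], 0)])
      else (
       pick (d - 10) [(3, [0, 1, 2], 0)]))
     else if b = 7 then (
      if c = 8 then (
       pick (d - 9) [(1, [0, 1, 2], 0), (2, [0, 1, 2], 0)])
      else (
       pick (d - 10) [(27, [0, 1, 2], 4)]))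
     else (
      pick (d - 10) [(2, [0, 1, 2], 0)]))
    else if a = 6 then (
     if b = 7 then (
      if c = 8 then (
       pick (d - 9) [(1, [0, 1, 2], 0), (2, [0, 1, 2], 0)])
      else (
       pick (d - 10) [(3, [3, 5, 8], 0)]))
     else (
      pick (d - 10) [(2, [0, 1, 2], 0)]))
    else (
     pick (d - 10) [(6, [0, 1, 2], 0)]))"

definition elimination_table :: "int list \<Rightarrow> int \<times> int list \<times> int" where
  "elimination_table T = (case T of [a, b, c, d] \<Rightarrow> table_entry a b c d | _ \<Rightarrow> undefined)"

lemma elimination_table_ok:
  "list_all (elimination_step_ok sparse_triples elimination_table normalizing_quads [0, 5, 6, 7]) quadruples"
  by code_simp

lemma monomial_sum_ext_power:
  assumes "strict_mono_on {0..11} (e :: int \<Rightarrow> 'n::{finite,linorder})"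
    and "\<And>t. t \<in> set ts \<Longrightarrow> length t = k \<and> distinct t \<and> set t \<subseteq> {0..11}"
  shows "monomial_sum e ts \<in> ext_power k"
  using assms(2)
proof (induction ts)
  case (Cons t ts)
  have "inj_on e (set t)"
    using enumeration_inj[OF assms(1)] Cons.prems by (meson inj_on_subset list.set_intros(1))
  then have "card (e ` set t) = k"
    using Cons.prems by (simp add: card_image distinct_card)
  then have "axis (e ` set t) 1 \<in> ext_power k" by (simp add: ext_power_def axis_def)
  with Cons show ?case by (simp add: monomial_sum_def[OF assms(1)] ext_power_add)
qed (simp add: monomial_sum_def[OF assms(1)])

text \<open>
  If \<open>R\<close> contains just one of the sets, the coefficient of \<open>e\<^sub>R\<close> is, up to sign, one coordinate of \<open>u\<close>.
\<close>

lemma sole_term_coordinate_zero: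
  assumes e: "strict_mono_on {0..11} (e :: int \<Rightarrow> 'n::{finite,linorder})"
    and ts: "\<And>t. t \<in> set ts \<Longrightarrow> distinct t \<and> set t \<subseteq> {0..11}"
    and R: "distinct R" "set R \<subseteq> {0..11}"
    and sole: "map (set_diff R) (filter (\<lambda>t. set t \<subseteq> set R) ts) = [[i]]"
    and zero: "monomial_sum e ts \<and>\<^sub>E ext_vec u = 0"
  shows "u $ e i = 0"
proof -
  obtain t where t: "filter (\<lambda>t. set t \<subseteq> set R) ts = [t]" "set_diff R t = [i]"
    using sole by (auto simp: map_eq_Cons_conv)
  have "0 = (\<Sum>t\<leftarrow>ts. equation_term e (ext_vec u) R t)"
    using monomial_sum_wedge[OF e ts R, where x = "ext_vec u", of ts] zero by simp
  also have "\<dots> = (\<Sum>t\<leftarrow>filter (\<lambda>t. set t \<subseteq> set R) ts.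
      of_int (sgn_list t (set_diff R t)) * ext_vec u $ (e ` set (set_diff R t)))"
    unfolding sum_list_map_filter' equation_term_def[OF e] ..
  also have "\<dots> = of_int (sgn_list t [i]) * u $ e i"
    by (simp add: t ext_vec_nth)
  finally show ?thesis by (simp add: sgn_list_def split: if_splits)
qed

lemma sparse_triples_valid: "t \<in> set sparse_triples \<Longrightarrow> length t = 3 \<and> distinct t \<and> set t \<subseteq> {0..10}"
  unfolding sparse_triples_def by auto

text \<open>
  The sum of these four products is a tangent vector of rank 4 at \<open>e\<^sub>0 \<and> e\<^sub>1 \<and> e\<^sub>2 \<and> e\<^sub>3\<close>.  Its square
  vanishes because any two of the quadruples meet.
\<close>

definition tangent_quads :: "int list list" where
  "tangent_quads = [[1, 2, 3, 4], [0, 2, 3, 5], [0, 1, 3, 6], [0, 1, 2, 7]]"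

lemma tangent_quads_valid: "t \<in> set tangent_quads \<Longrightarrow> length t = 4 \<and> distinct t \<and> set t \<subseteq> {0..11}"
  unfolding tangent_quads_def by auto

lemma sparse_triples_sole:
  "map (\<lambda>R. map (set_diff R) (filter (\<lambda>t. set t \<subseteq> set R) sparse_triples))
     ([[0, 1, 4, 10], [0, 1, 3, 4], [0, 2, 3, 4]] @ map (\<lambda>i. [0, 1, 2, i]) [3..10]) =
   map (\<lambda>i. [[i]]) [0..10]"
  by code_simp

lemma tangent_quads_sole:
  "map (\<lambda>R. map (set_diff R) (filter (\<lambda>t. set t \<subseteq> set R) tangent_quads))
     ([[0, 1, 2, 3, 4], [0, 1, 2, 3, 5], [0, 1, 2, 3, 6], [0, 1, 2, 3, 7], [0, 2, 3, 4, 5]] @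
       map (\<lambda>i. [1, 2, 3, 4, i]) [5..11]) =
   map (\<lambda>i. [[i]]) [0..11]"
  by code_simp

lemma sparse_triples_distinct: "distinct sparse_triples"
  by code_simp

lemma elimination_contradiction:
  "equation_sum sparse_triples (\<lambda>T. snd (snd (elimination_table T))) [1, 2, 3, 4, 8, 9, 10] \<noteq> 0"
  by code_simp

lemma map_eq_map_obtains:
  assumes "map (\<lambda>R. g R) Rs = map (\<lambda>i. [[i]]) is" "i \<in> set is"
  shows "\<exists>R\<in>set Rs. g R = [[i]]"
proof -
  have "[[i]] \<in> set (map g Rs)" using assms by simp
  then show ?thesis by (metis imageE list.set_map)
qed

theorem reducible_square_zero_12:
  assumes "CARD('n::{finite,linorder}) = 12"
  shows "reducible_variety (ext_power 4) (square_zero :: (complex ^ ('n set)) set set)"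
proof -
  define l where "l = sorted_list_of_set (UNIV :: 'n set)"
  have l: "length l = 12" "sorted_wrt (<) l" "set l = UNIV"
    using assms by (simp_all add: l_def)
  define e where "e i = l ! nat i" for i :: int
  have e: "strict_mono_on {0..11} e"
    using l(1,2) by (intro strict_mono_onI) (auto simp: e_def sorted_wrt_iff_nth_less)
  have inj: "inj_on e {0..11}" by (rule enumeration_inj[OF e])
  have surj: "e ` {0..11} = UNIV"
    using inj assms by (intro card_eq_UNIV_imp_eq_UNIV) (simp_all add: card_image)
  define s where "s = e 11"
  have ne_s: "i \<in> {0..10} \<Longrightarrow> e i \<noteq> s" for i
    using inj_onD[OF inj, of i 11] by (auto simp: s_def)
  have compl: "- {s} = e ` {0..10}"
  proof -
    have "{0..11 :: int} = insert 11 {0..10}" by auto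
    then have "UNIV = insert s (e ` {0..10})" using surj by (metis image_insert s_def)
    moreover have "s \<notin> e ` {0..10}" using ne_s by fastforce
    ultimately show ?thesis by blast
  qed
  let ?\<alpha> = "monomial_sum e sparse_triples" and ?w = "monomial_sum e tangent_quads"
  have valid: "length t = 3 \<and> distinct t \<and> set t \<subseteq> {0..11}" if "t \<in> set sparse_triples" for t
    using sparse_triples_valid[OF that] by auto
  have \<alpha>: "?\<alpha> \<in> ext_power 3" using valid by (rule monomial_sum_ext_power[OF e])
  have \<alpha>_free: "free_of s ?\<alpha>"
  proof -
    have "free_of s (monomial_sum e ts)" if "\<And>t. t \<in> set ts \<Longrightarrow> set t \<subseteq> {0..10}" for ts
      using that
    proof (induction ts)
      case (Cons t ts)
      then have "s \<notin> e ` set t" using ne_s by fastforce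
      then have "free_of s (axis (e ` set t) 1)" by (auto simp: free_of_def axis_def)
      then show ?case using Cons by (simp add: monomial_sum_def[OF e] free_of_add)
    qed (simp add: monomial_sum_def[OF e])
    then show ?thesis using sparse_triples_valid by blast
  qed
  have inj\<alpha>: "u = 0" if "u $ s = 0" "ext_vec u \<and>\<^sub>E ?\<alpha> = 0" for u
  proof -
    have zero: "?\<alpha> \<and>\<^sub>E ext_vec u = 0"
      using wedge_commute_graded[OF \<alpha> ext_vec_ext_power, of u] that(2) by simp
    have "u $ e i = 0" if "i \<in> {0..10}" for i
    proof -
      have i: "i \<in> set [0..10]" using that by simp
      obtain R where R: "R \<in> set ([[0, 1, 4, 10], [0, 1, 3, 4], [0, 2, 3, 4]] @ map (\<lambda>i. [0, 1, 2, i]) [3..10])"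
        "map (set_diff R) (filter (\<lambda>t. set t \<subseteq> set R) sparse_triples) = [[i]]"
        using map_eq_map_obtains[OF sparse_triples_sole i] by (rule bexE)
      have "distinct R" "set R \<subseteq> {0..11}" using R(1) by auto
      then show ?thesis
        by (rule sole_term_coordinate_zero[OF e _ _ _ R(2) zero, rotated]) (simp add: valid)
    qed
    moreover have "j = s \<or> j \<in> e ` {0..10}" for j using compl by blast
    ultimately have "u $ j = 0" for j using that(1) by (metis imageE)
    then show ?thesis by (simp add: vec_eq_iff)
  qed
  have \<alpha>_nz: "?\<alpha> \<noteq> 0"
  proof
    assume "?\<alpha> = 0"
    then have "axis (e 0) 1 = (0 :: (complex, 'n) vec)"
      using ne_s[of 0] by (intro inj\<alpha>) (auto simp: axis_def)
    then show False by (simp add: axis_eq_0_iff)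
  qed
  define p where "p j = e ` set (normalizing_quads ! nat (the_inv_into {0..11} e j))" for j
  have ker: "x = 0"
    if x: "x \<in> ext_power 4" "free_of s x" "?\<alpha> \<and>\<^sub>E x = 0" "\<And>i. i \<noteq> s \<Longrightarrow> x $ p i = 0" for x
  proof -
    have piv: "x $ (e ` set q) = 0" if q: "q \<in> set normalizing_quads" for q
    proof -
      obtain k where "k < length normalizing_quads" "q = normalizing_quads ! k"
        using q by (metis in_set_conv_nth)
      then have k: "k < 11" "q = normalizing_quads ! k" by (simp_all add: normalizing_quads_def)
      have "p (e (int k)) = e ` set q"
        using k by (simp add: p_def the_inv_into_f_f[OF inj])
      then show ?thesis using x(4)[OF ne_s, of "int k"] k(1) by simp
    qed
    have "x $ S = 0" if "S \<subseteq> e ` {0..10}" "card S = 4" for S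
      using coefficients_zero[OF e sparse_triples_valid sparse_triples_distinct x(3) elimination_table_ok piv _ _ _
          elimination_contradiction that] by simp
    moreover have "x $ S = 0" if "card S \<noteq> 4 \<or> s \<in> S" for S
      using that x(1,2) unfolding ext_power_def free_of_def by blast
    moreover have "s \<in> S \<or> S \<subseteq> e ` {0..10}" for S using compl by blast
    ultimately have "x $ S = 0" for S by metis
    then show ?thesis by (simp add: vec_eq_iff)
  qed
  have w: "?w \<in> ext_power 4" using tangent_quads_valid by (rule monomial_sum_ext_power[OF e])
  have w_sq: "?w \<and>\<^sub>E ?w = 0"
    by (simp add: monomial_sum_def[OF e] tangent_quads_def wedge_add_left wedge_add_right wedge_basis)
  have w_indiv: "v = 0" if "ext_vec v \<and>\<^sub>E ?w = 0" for v
  proof -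
    have zero: "?w \<and>\<^sub>E ext_vec v = 0"
      using wedge_commute_graded[OF w ext_vec_ext_power, of v] that by simp
    have "v $ e i = 0" if "i \<in> {0..11}" for i
    proof -
      have i: "i \<in> set [0..11]" using that by simp
      obtain R where R: "R \<in> set ([[0, 1, 2, 3, 4], [0, 1, 2, 3, 5], [0, 1, 2, 3, 6], [0, 1, 2, 3, 7],
          [0, 2, 3, 4, 5]] @ map (\<lambda>i. [1, 2, 3, 4, i]) [5..11])"
        "map (set_diff R) (filter (\<lambda>t. set t \<subseteq> set R) tangent_quads) = [[i]]"
        using map_eq_map_obtains[OF tangent_quads_sole i] by (rule bexE)
      have "distinct R" "set R \<subseteq> {0..11}" using R(1) by auto
      then show ?thesis
        by (rule sole_term_coordinate_zero[OF e _ _ _ R(2) zero, rotated]) (simp add: tangent_quads_valid)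
    qed
    then have "v $ j = 0" for j using surj by (metis UNIV_I imageE)
    then show ?thesis by (simp add: vec_eq_iff)
  qed
  show ?thesis
    by (rule reducible_square_zero[OF \<alpha> \<alpha>_free \<alpha>_nz ker inj\<alpha> w w_sq w_indiv])
qed

theorem proposition4p3:
  "(\<forall>v :: complex ^ (12 set). highest_weight_vector 4 v \<longrightarrow>
      M_SL 1 4 v = quadratic_hull (ext_power 4) (restricted_chordal 2 4)) \<and>
   quadratic_hull (ext_power 4) (restricted_chordal 2 4) =
     {proj_point \<omega> | \<omega> :: complex ^ (12 set). \<omega> \<in> ext_power 4 \<and> \<omega> \<noteq> 0 \<and> \<omega> \<and>\<^sub>E \<omega> = 0} \<and>
   reducible_variety (ext_power 4)
     {proj_point \<omega> | \<omega> :: complex ^ (12 set). \<omega> \<in> ext_power 4 \<and> \<omega> \<noteq> 0 \<and> \<omega> \<and>\<^sub>E \<omega> = 0}"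
proof -
  have card: "CARD(12) = 12" by simp
  have hull: "quadratic_hull (ext_power 4) (restricted_chordal 2 4) =
      (square_zero :: (complex ^ (12 set)) set set)"
    by (rule restricted_chordal_hull_eq_square_zero) simp
  have "M_SL 1 4 v = square_zero" if "highest_weight_vector 4 v" for v :: "complex ^ (12 set)"
    using that by (rule M_SL_eq_square_zero) simp
  moreover have "reducible_variety (ext_power 4) (square_zero :: (complex ^ (12 set)) set set)"
    using card by (rule reducible_square_zero_12)
  ultimately show ?thesis
    using hull unfolding square_zero_def by simp
qed

end
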